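(* Let $X=X(\Sigma)$ be the toric variety associated to a fan $\Sigma$ in a lattice $N$, and let $\Psi$ be a complement map on $N$ such that $\Sigma$ is $\Psi$-generic. Then there is an action of the group $\mathrm{Div}_T(X)$ on $Z^T_*(X)$, i.e. a $\Lambda_{\mathbb Q}$-bilinear map $\mathrm{Div}_T(X)\times Z_*^T(X)\to Z_*^T(X)$, $(D,C)\mapsto D\cdot C$, determined by the following formula for $D\in\mathrm{Div}(X)$ with local equations $\{d_\sigma\}_{\sigma\in\Sigma}$ and $\sigma\in\Sigma$: $$D\cdot V_\sigma=\sum_{\tau\in\Sigma:\ \tau\to\sigma}\langle d_\tau-d_\sigma^\Psi,\,n_{\tau,\sigma}\rangle V_\tau+d_\sigma^\Psi V_\sigma .$$ This action satisfies the following properties. (Lifting) It is a lifting of the action on the equivariant Chow groups: if $\pi:Z_*^T(X)\to A_*^T(X)_{\mathbb Q}$ is the natural surjection, then $\pi(D\cdot C)=D\cdot\pi(C)$ for all $D\in\mathrm{Div}_T(X)$, $C\in Z_*^T(X)$, where on the right $D$ acts on $A_*^T(X)_{\mathbb Q}$ through the ($\Lambda_{\mathbb Q}$-linearly extended) intersection action of equivariant line bundles. (Commutativity) For all $D,E\in\mathrm{Div}_T(X)$ and $C\in Z_*^T(X)$, $D\cdot(E\cdot C)=E\cdot(D\cdot C)$. (Compatibility with the non-equivariant cycle-level intersection) The action is a lifting of the non-equivariant cycle-level action $\odot$ of $\mathrm{Div}(X)$ on $Z_*(X)_{\mathbb Q}$: if $\phi$ denotes the maps $\mathrm{Div}_T(X)\to\mathrm{Div}(X)$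 and $Z_*^T(X)\to Z_*(X)_{\mathbb Q}$ induced by the homomorphism $\Lambda_{\mathbb Q}\to\mathbb Q$ sending $M$ to $0$, then $\phi(D\cdot C)=\phi(D)\odot\phi(C)$ for all $D\in\mathrm{Div}_T(X)$, $C\in Z_*^T(X)$.
   Context: Setting. $N$ is a lattice, $M=\mathrm{Hom}(N,\mathbb Z)$, $\langle\ ,\ \rangle$ is the natural pairing, and a subscript $\mathbb Q$ denotes $\otimes\,\mathbb Q$. $\Lambda=\mathbb Z[M]$ denotes the polynomial ring (symmetric algebra) on $M$, not the group ring, so $\Lambda_{\mathbb Q}=\mathrm{Sym}_{\mathbb Q}(M_{\mathbb Q})$. Cones are rational, strongly convex polyhedral cones, and fans are finite. For a cone $\sigma$, $N_\sigma=N\cap\mathrm{span}(\sigma)$, $N(\sigma)=N/N_\sigma$, $M(\sigma)=M\cap\sigma^\perp$ (dual to $N(\sigma)$) and $M_\sigma=M/M(\sigma)$ (dual to $N_\sigma$). We write $\tau\to\sigma$ if $\sigma$ is a maximal proper (codimension one) face of $\tau$; then $n_{\tau,\sigma}\in N(\sigma)$ is the primitive generator of the ray which is the image of $\tau$ in $N(\sigma)$. $T$ is the torus of $X$ and $V(\sigma)\subset X$ is the $T$-invariant subvariety (orbit closure) of $\sigma\in\Sigma$. Cycles and divisors. $Z_*(X)$ is the free abelian group on $\{V(\sigma):\sigma\in\Sigma\}$; $Z_*^T(X)=Z_*(X)\otimes\Lambda_{\mathbb Q}$, and $V_\sigma$ is $V(\sigma)$ viewed in $Z^T_*(X)$. $\mathrm{Div}(X)$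 is the group of $T$-invariant $\mathbb Q$-Cartier divisors; such a divisor is a collection of local equations $\{d_\sigma\}_{\sigma\in\Sigma}$ with $d_\sigma\in M_{\sigma,\mathbb Q}$ such that $d_\tau\mapsto d_\sigma$ under $M_{\tau,\mathbb Q}\to M_{\sigma,\mathbb Q}$ whenever $\sigma\subset\tau$. $\mathrm{Div}_T(X)=\mathrm{Div}(X)\otimes_{\mathbb Q}\Lambda_{\mathbb Q}$. Complement maps. Let $\mathcal L$ be a set of $\mathbb Q$-subspaces of $N_{\mathbb Q}$ containing $N_{\mathbb Q}$. A complement map $\Psi$ assigns to each pair $L_1\subset L_2$ in $\mathcal L$ a linear section $i^\Psi:L_1^*\to L_2^*$ of the restriction map $L_2^*\to L_1^*$, transitively: for $L_1\subset L_2\subset L_3$ in $\mathcal L$ the section $L_1^*\to L_3^*$ is the composite $L_1^*\to L_2^*\to L_3^*$. A fan $\Sigma$ is $\Psi$-generic if $N_{\sigma,\mathbb Q}\in\mathcal L$ for all $\sigma\in\Sigma$. In this case, for $d\in M_{\sigma,\mathbb Q}$, $d^\Psi\in M_{\mathbb Q}$ is the image of $d$ under $i^\Psi:M_{\sigma,\mathbb Q}=N_{\sigma,\mathbb Q}^*\to N_{\mathbb Q}^*=M_{\mathbb Q}$. If $\tau\to\sigma$, then $d_\tau$ and $d_\sigma^\Psi$ have the same image $d_\sigma$ in $M_{\sigma,\mathbb Q}$, so the difference $d_\tau-d_\sigma^\Psi$ (of $d_\tau$ and the image of $d_\sigma^\Psi$ in $M_{\tau,\mathbb Q}$) is represented by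 an element of $M(\sigma)_{\mathbb Q}$, well defined modulo $M(\tau)_{\mathbb Q}$, and its pairing with $n_{\tau,\sigma}$ is well defined. Equivariant Chow groups. $A_*^T(X)_{\mathbb Q}$ is the $T$-equivariant Chow group with rational coefficients; by Brion it is the quotient of $Z_*^T(X)$ by the $\Lambda_{\mathbb Q}$-submodule generated by $mV_\sigma-\sum_{\tau\to\sigma}\langle m,n_{\tau,\sigma}\rangle V_\tau$ for $\sigma\in\Sigma$, $m\in M(\sigma)$ (this fixes the sign convention for the $M$-action). $D\in\mathrm{Div}(X)$ acts on it by the equivariant first Chern class of $\mathcal O(D)$ with its canonical linearization; in this presentation $D\cdot[V_\sigma]=\sum_{\tau\to\sigma}\langle d_\tau-m,n_{\tau,\sigma}\rangle[V_\tau]+m[V_\sigma]$ for any $m\in M_{\mathbb Q}$ mapping to $d_\sigma$. Non-equivariant cycle-level action (H. Thomas). For $D\in\mathrm{Div}(X)$ with local equations $d_\sigma$, $D\odot V(\sigma)=\sum_{\tau\to\sigma}\langle\pi_\sigma(d_\tau),n_{\tau,\sigma}\rangle V(\tau)$, where $\pi_\sigma:M_{\tau,\mathbb Q}\to\ker(M_{\tau,\mathbb Q}\to M_{\sigma,\mathbb Q})=(M(\sigma)/M(\tau))_{\mathbb Q}$ is the projection with kernel $i^\Psi(M_{\sigma,\mathbb Q})\subset M_{\tau,\mathbb Q}$; it is extended linearly to $Z_*(X)_{\mathbb Q}$. *)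

theory Defs
  imports Complex_Main "HOL-Library.Poly_Mapping"
begin

text \<open>
  A type of this class is the rational vector space \<open>N \<otimes> Q\<close> of a lattice \<open>N\<close> of finite
  rank (possibly 0); \<open>zbasis\<close> is a \<open>Z\<close>-basis of \<open>N\<close>.
\<close>

class lattice_space = ab_group_add +
  fixes qscale :: "rat \<Rightarrow> 'a \<Rightarrow> 'a" (infixr "*Q" 75)
    and zbasis :: "'a set"
  assumes qscale_right_distrib: "c *Q (x + y) = c *Q x + c *Q y"
    and qscale_left_distrib: "(c + d) *Q x = c *Q x + d *Q x"
    and qscale_qscale: "c *Q d *Q x = (c * d) *Q x"
    and qscale_one: "1 *Q x = x"
    and finite_zbasis: "finite zbasis"
    and zbasis_expansion: "\<exists>!f. (\<forall>b. b \<notin> zbasis \<longrightarrow> f b = 0) \<and> x = (\<Sum>b\<in>zbasis. f b *Q b)"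

interpretation lq: vector_space "qscale :: rat \<Rightarrow> 'v::lattice_space \<Rightarrow> 'v"
  by unfold_locales
    (simp_all add: qscale_right_distrib qscale_left_distrib qscale_qscale qscale_one)

interpretation lq: finite_dimensional_vector_space
  "qscale :: rat \<Rightarrow> 'v::lattice_space \<Rightarrow> 'v" "zbasis :: 'v set"
proof unfold_locales
  show "finite (zbasis :: 'v set)"
    by (rule finite_zbasis)
  show "lq.span zbasis = (UNIV :: 'v set)"
  proof -
    have "x \<in> lq.span zbasis" for x :: 'v
    proof -
      obtain f where f: "x = (\<Sum>b\<in>zbasis. f b *Q b)"
        using zbasis_expansion[of x] by blast
      show ?thesis
        unfolding f by (intro lq.span_sum lq.span_scale lq.span_base)
    qed
    then show ?thesis by blast
  qed
  show "lq.independent (zbasis :: 'v set)"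
    unfolding lq.dependent_finite[OF finite_zbasis]
  proof clarify
    fix u :: "'v \<Rightarrow> rat" and b :: 'v
    assume b: "b \<in> zbasis" "u b \<noteq> 0" and sum0: "(\<Sum>v\<in>zbasis. u v *Q v) = 0"
    define w where "w = (\<lambda>v. if v \<in> zbasis then u v else 0)"
    have "(\<Sum>v\<in>zbasis. w v *Q v) = (\<Sum>v\<in>zbasis. u v *Q v)"
      by (rule sum.cong) (simp_all add: w_def)
    then have w: "(\<forall>v. v \<notin> zbasis \<longrightarrow> w v = 0) \<and> (0::'v) = (\<Sum>v\<in>zbasis. w v *Q v)"
      using sum0 by (simp add: w_def)
    have z: "(\<forall>v. v \<notin> zbasis \<longrightarrow> (0::rat) = 0) \<and> (0::'v) = (\<Sum>v\<in>zbasis. 0 *Q v)"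
      by simp
    obtain g where "\<And>h. (\<forall>v. v \<notin> zbasis \<longrightarrow> h v = 0) \<and> (0::'v) = (\<Sum>v\<in>zbasis. h v *Q v)
        \<Longrightarrow> h = g"
      using zbasis_expansion[of "0::'v"] by (elim ex1E) metis
    from this[OF w] this[OF z] have "w = (\<lambda>_. 0)"
      by simp
    then show False
      using b by (metis w_def)
  qed
qed

definition lattice_N :: "'v::lattice_space set" where
  "lattice_N = {x. \<exists>f :: 'v \<Rightarrow> int. x = (\<Sum>b\<in>zbasis. of_int (f b) *Q b)}"


section \<open>Dual spaces and complement maps\<close>

text \<open>
  An element of \<open>L\<^sup>*\<close>, for a subspace \<open>L\<close>, is represented by a function on the whole space that
  is linear on \<open>L\<close> and 0 outside \<open>L\<close>.  Thus \<open>dual UNIV\<close> is \<open>M \<otimes> Q\<close>.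
\<close>

definition dual :: "'v::lattice_space set \<Rightarrow> ('v \<Rightarrow> rat) set" where
  "dual L = {f. (\<forall>x\<in>L. \<forall>y\<in>L. f (x + y) = f x + f y) \<and> (\<forall>c. \<forall>x\<in>L. f (c *Q x) = c * f x) \<and>
    (\<forall>x. x \<notin> L \<longrightarrow> f x = 0)}"

definition restr :: "'v set \<Rightarrow> ('v \<Rightarrow> rat) \<Rightarrow> 'v \<Rightarrow> rat" where
  "restr L f = (\<lambda>x. if x \<in> L then f x else 0)"

definition lattice_M :: "('v::lattice_space \<Rightarrow> rat) set" where
  "lattice_M = {m \<in> dual UNIV. \<forall>x\<in>lattice_N. m x \<in> \<int>}"

text \<open>\<open>\<Psi> L1 L2\<close> is the section \<open>L1\<^sup>* \<rightarrow> L2\<^sup>*\<close>; only its values on \<open>dual L1\<close> matter.\<close>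

definition complement_map ::
    "'v::lattice_space set set \<Rightarrow> ('v set \<Rightarrow> 'v set \<Rightarrow> ('v \<Rightarrow> rat) \<Rightarrow> 'v \<Rightarrow> rat) \<Rightarrow> bool" where
  "complement_map \<L> \<Psi> \<longleftrightarrow>
    (\<forall>L\<in>\<L>. lq.subspace L) \<and> UNIV \<in> \<L> \<and>
    (\<forall>L1\<in>\<L>. \<forall>L2\<in>\<L>. L1 \<subseteq> L2 \<longrightarrow>
      (\<forall>f\<in>dual L1. \<Psi> L1 L2 f \<in> dual L2 \<and> restr L1 (\<Psi> L1 L2 f) = f) \<and>
      (\<forall>f\<in>dual L1. \<forall>g\<in>dual L1. \<Psi> L1 L2 (\<lambda>x. f x + g x) = (\<lambda>x. \<Psi> L1 L2 f x + \<Psi> L1 L2 g x)) \<and>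
      (\<forall>c. \<forall>f\<in>dual L1. \<Psi> L1 L2 (\<lambda>x. c * f x) = (\<lambda>x. c * \<Psi> L1 L2 f x))) \<and>
    (\<forall>L1\<in>\<L>. \<forall>L2\<in>\<L>. \<forall>L3\<in>\<L>. L1 \<subseteq> L2 \<longrightarrow> L2 \<subseteq> L3 \<longrightarrow>
      (\<forall>f\<in>dual L1. \<Psi> L1 L3 f = \<Psi> L2 L3 (\<Psi> L1 L2 f)))"


section \<open>Cones and fans\<close>

text \<open>Cones are taken in \<open>N \<otimes> Q\<close>; a rational cone in \<open>N \<otimes> R\<close> is given by its rational points.\<close>

definition conic_hull :: "'v::lattice_space set \<Rightarrow> 'v set" where
  "conic_hull S = {(\<Sum>s\<in>S. c s *Q s) | c. \<forall>s\<in>S. 0 \<le> c s}"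

definition rational_cone :: "'v::lattice_space set \<Rightarrow> bool" where
  "rational_cone \<sigma> \<longleftrightarrow>
    (\<exists>S. finite S \<and> S \<subseteq> lattice_N \<and> \<sigma> = conic_hull S) \<and> (\<forall>x\<in>\<sigma>. - x \<in> \<sigma> \<longrightarrow> x = 0)"

definition cone_face :: "'v::lattice_space set \<Rightarrow> 'v set \<Rightarrow> bool" where
  "cone_face \<sigma> \<tau> \<longleftrightarrow> (\<exists>u\<in>dual UNIV. (\<forall>x\<in>\<tau>. 0 \<le> u x) \<and> \<sigma> = {x \<in> \<tau>. u x = 0})"

definition toric_fan :: "'v::lattice_space set set \<Rightarrow> bool" where
  "toric_fan \<Sigma> \<longleftrightarrow> finite \<Sigma> \<and> (\<forall>\<sigma>\<in>\<Sigma>. rational_cone \<sigma>) \<and>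
    (\<forall>\<tau>\<in>\<Sigma>. \<forall>\<sigma>. cone_face \<sigma> \<tau> \<longrightarrow> \<sigma> \<in> \<Sigma>) \<and>
    (\<forall>\<sigma>\<in>\<Sigma>. \<forall>\<tau>\<in>\<Sigma>. cone_face (\<sigma> \<inter> \<tau>) \<sigma> \<and> cone_face (\<sigma> \<inter> \<tau>) \<tau>)"

text \<open>\<open>lq.span \<sigma>\<close> is \<open>N\<^sub>\<sigma> \<otimes> Q\<close>, where \<open>N\<^sub>\<sigma> = N \<inter> span \<sigma>\<close>, and \<open>dual (lq.span \<sigma>)\<close> is \<open>M\<^sub>\<sigma> \<otimes> Q\<close>.\<close>

definition psi_generic :: "'v::lattice_space set set \<Rightarrow> 'v set set \<Rightarrow> bool" where
  "psi_generic \<L> \<Sigma> \<longleftrightarrow> (\<forall>\<sigma>\<in>\<Sigma>. lq.span \<sigma> \<in> \<L>)"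

definition facet :: "'v::lattice_space set \<Rightarrow> 'v set \<Rightarrow> bool" where
  "facet \<sigma> \<tau> \<longleftrightarrow> cone_face \<sigma> \<tau> \<and> lq.dim \<tau> = lq.dim \<sigma> + 1"

definition star :: "'v::lattice_space set set \<Rightarrow> 'v set \<Rightarrow> 'v set set" where
  "star \<Sigma> \<sigma> = {\<tau> \<in> \<Sigma>. facet \<sigma> \<tau>}"

definition lattice_M_perp :: "'v::lattice_space set \<Rightarrow> ('v \<Rightarrow> rat) set" where
  "lattice_M_perp \<sigma> = {m \<in> lattice_M. \<forall>x\<in>\<sigma>. m x = 0}"

text \<open>
  The class of \<open>n\<close> in \<open>N(\<sigma>) = N / N\<^sub>\<sigma>\<close> is nonzero, lies in the image of \<open>\<tau>\<close>, and is primitive.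
\<close>

definition primitive_normal :: "'v::lattice_space set \<Rightarrow> 'v set \<Rightarrow> 'v \<Rightarrow> bool" where
  "primitive_normal \<tau> \<sigma> n \<longleftrightarrow> n \<in> lattice_N \<and> n \<notin> lq.span \<sigma> \<and> (\<exists>y\<in>\<tau>. n - y \<in> lq.span \<sigma>) \<and>
    (\<forall>k::nat. \<forall>n'\<in>lattice_N. k \<ge> 2 \<longrightarrow> n - of_nat k *Q n' \<notin> lq.span \<sigma>)"

text \<open>
  A representative in \<open>N\<close> of the primitive generator.  It lies in \<open>lq.span \<tau>\<close>, and only its class
  modulo \<open>N\<^sub>\<sigma>\<close> is relevant: it is paired only with functionals that vanish on \<open>lq.span \<sigma>\<close>.
\<close>

definition normal_gen :: "'v::lattice_space set \<Rightarrow> 'v set \<Rightarrow> 'v" where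
  "normal_gen \<tau> \<sigma> = (SOME n. primitive_normal \<tau> \<sigma> n)"


section \<open>The symmetric algebra\<close>

text \<open>
  The polynomials over \<open>Q\<close> in indeterminates \<open>X b\<close>, \<open>b \<in> zbasis\<close>, where \<open>X b\<close> stands for the
  element of the dual basis of \<open>M\<close> belonging to \<open>b\<close>.
\<close>

type_synonym 'v sympoly = "('v \<Rightarrow>\<^sub>0 nat) \<Rightarrow>\<^sub>0 rat"

definition Lam :: "'v::lattice_space sympoly set" where
  "Lam = {p. \<forall>t \<in> Poly_Mapping.keys p. Poly_Mapping.keys t \<subseteq> zbasis}"

definition const :: "rat \<Rightarrow> 'v sympoly" where
  "const c = Poly_Mapping.single 0 c"

definition linear_form :: "('v::lattice_space \<Rightarrow> rat) \<Rightarrow> 'v sympoly" where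
  "linear_form m = (\<Sum>b\<in>zbasis. Poly_Mapping.single (Poly_Mapping.single b 1) (m b))"

definition augmentation :: "'v sympoly \<Rightarrow> rat" where
  "augmentation p = Poly_Mapping.lookup p 0"


section \<open>Equivariant cycles and divisors\<close>

definition ZT :: "'v::lattice_space set set \<Rightarrow> ('v set \<Rightarrow> 'v sympoly) set" where
  "ZT \<Sigma> = {C. (\<forall>\<sigma>. C \<sigma> \<in> Lam) \<and> (\<forall>\<sigma>. \<sigma> \<notin> \<Sigma> \<longrightarrow> C \<sigma> = 0)}"

text \<open>The basis element \<open>V\<^sub>\<sigma>\<close>, both with polynomial and with rational coefficients.\<close>

definition orbit_cycle :: "'v set \<Rightarrow> 'v set \<Rightarrow> 'r::zero_neq_one" where
  "orbit_cycle \<sigma> = (\<lambda>\<rho>. if \<rho> = \<sigma> then 1 else 0)"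

definition cyc_add ::
    "('v set \<Rightarrow> 'v sympoly) \<Rightarrow> ('v set \<Rightarrow> 'v sympoly) \<Rightarrow> 'v set \<Rightarrow> 'v sympoly" where
  "cyc_add C C' = (\<lambda>\<rho>. C \<rho> + C' \<rho>)"

definition cyc_smul :: "'v sympoly \<Rightarrow> ('v set \<Rightarrow> 'v sympoly) \<Rightarrow> 'v set \<Rightarrow> 'v sympoly" where
  "cyc_smul p C = (\<lambda>\<rho>. p * C \<rho>)"

definition Div :: "'v::lattice_space set set \<Rightarrow> ('v set \<Rightarrow> 'v \<Rightarrow> rat) set" where
  "Div \<Sigma> = {d. (\<forall>\<sigma>\<in>\<Sigma>. d \<sigma> \<in> dual (lq.span \<sigma>)) \<and>
    (\<forall>\<sigma>\<in>\<Sigma>. \<forall>\<tau>\<in>\<Sigma>. \<sigma> \<subseteq> \<tau> \<longrightarrow> restr (lq.span \<sigma>) (d \<tau>) = d \<sigma>) \<and>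
    (\<forall>\<sigma>. \<sigma> \<notin> \<Sigma> \<longrightarrow> d \<sigma> = (\<lambda>x. 0))}"

text \<open>
  \<open>Div \<Sigma>\<close> is a space of rational functions of the pair \<open>(\<sigma>, x)\<close>.  For any space \<open>F\<close> of functions
  \<open>S \<rightarrow> Q\<close> the canonical map from \<open>F \<otimes>\<^sub>Q Lam\<close> to the functions \<open>S \<rightarrow> Lam\<close> is injective, so the
  tensor product is the set of all finite sums \<open>\<Sum> p\<^sub>k d\<^sub>k\<close> with \<open>p\<^sub>k \<in> Lam\<close>, \<open>d\<^sub>k \<in> F\<close>.
\<close>

definition DivT :: "'v::lattice_space set set \<Rightarrow> ('v set \<Rightarrow> 'v \<Rightarrow> 'v sympoly) set" where
  "DivT \<Sigma> = {(\<lambda>\<sigma> x. \<Sum>k<n. p k * const (d k \<sigma> x)) | (n::nat) p d.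
    \<forall>k<n. p k \<in> Lam \<and> d k \<in> Div \<Sigma>}"

definition div_const :: "('v set \<Rightarrow> 'v \<Rightarrow> rat) \<Rightarrow> 'v set \<Rightarrow> 'v \<Rightarrow> 'v sympoly" where
  "div_const d = (\<lambda>\<sigma> x. const (d \<sigma> x))"

text \<open>\<open>Lam\<close>-bilinear maps from \<open>DivT \<Sigma> \<times> A\<close> to \<open>A\<close>, for a \<open>Lam\<close>-module \<open>(A, add, smul)\<close>.\<close>

definition bilinear_action ::
    "'v::lattice_space set set \<Rightarrow> 'a set \<Rightarrow> ('a \<Rightarrow> 'a \<Rightarrow> 'a) \<Rightarrow> ('v sympoly \<Rightarrow> 'a \<Rightarrow> 'a) \<Rightarrow>
     (('v set \<Rightarrow> 'v \<Rightarrow> 'v sympoly) \<Rightarrow> 'a \<Rightarrow> 'a) \<Rightarrow> bool" where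
  "bilinear_action \<Sigma> A add smul act \<longleftrightarrow>
    (\<forall>D\<in>DivT \<Sigma>. \<forall>a\<in>A. act D a \<in> A) \<and>
    (\<forall>D\<in>DivT \<Sigma>. \<forall>E\<in>DivT \<Sigma>. \<forall>a\<in>A. act (\<lambda>\<sigma> x. D \<sigma> x + E \<sigma> x) a = add (act D a) (act E a)) \<and>
    (\<forall>p\<in>Lam. \<forall>D\<in>DivT \<Sigma>. \<forall>a\<in>A. act (\<lambda>\<sigma> x. p * D \<sigma> x) a = smul p (act D a)) \<and>
    (\<forall>D\<in>DivT \<Sigma>. \<forall>a\<in>A. \<forall>b\<in>A. act D (add a b) = add (act D a) (act D b)) \<and>
    (\<forall>p\<in>Lam. \<forall>D\<in>DivT \<Sigma>. \<forall>a\<in>A. act D (smul p a) = smul p (act D a))"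

definition psi_action ::
    "'v::lattice_space set set \<Rightarrow> ('v set \<Rightarrow> 'v set \<Rightarrow> ('v \<Rightarrow> rat) \<Rightarrow> 'v \<Rightarrow> rat) \<Rightarrow>
     (('v set \<Rightarrow> 'v \<Rightarrow> 'v sympoly) \<Rightarrow> ('v set \<Rightarrow> 'v sympoly) \<Rightarrow> 'v set \<Rightarrow> 'v sympoly) \<Rightarrow> bool" where
  "psi_action \<Sigma> \<Psi> act \<longleftrightarrow> bilinear_action \<Sigma> (ZT \<Sigma>) cyc_add cyc_smul act \<and>
    (\<forall>d\<in>Div \<Sigma>. \<forall>\<sigma>\<in>\<Sigma>. let d\<^sub>\<Psi> = \<Psi> (lq.span \<sigma>) UNIV (d \<sigma>) in
      act (div_const d) (orbit_cycle \<sigma>) =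
        (\<lambda>\<rho>. (\<Sum>\<tau>\<in>star \<Sigma> \<sigma>. const (d \<tau> (normal_gen \<tau> \<sigma>) - d\<^sub>\<Psi> (normal_gen \<tau> \<sigma>)) * orbit_cycle \<tau> \<rho>)
              + linear_form d\<^sub>\<Psi> * orbit_cycle \<sigma> \<rho>))"


section \<open>Equivariant Chow groups\<close>

text \<open>Brion's presentation of the rational equivariant Chow group.\<close>

definition chow_generator ::
    "'v::lattice_space set set \<Rightarrow> 'v set \<Rightarrow> ('v \<Rightarrow> rat) \<Rightarrow> 'v set \<Rightarrow> 'v sympoly" where
  "chow_generator \<Sigma> \<sigma> m = (\<lambda>\<rho>. linear_form m * orbit_cycle \<sigma> \<rho>
    - (\<Sum>\<tau>\<in>star \<Sigma> \<sigma>. const (m (normal_gen \<tau> \<sigma>)) * orbit_cycle \<tau> \<rho>))"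

definition chow_relations :: "'v::lattice_space set set \<Rightarrow> ('v set \<Rightarrow> 'v sympoly) set" where
  "chow_relations \<Sigma> = {(\<lambda>\<rho>. \<Sum>k<n. p k * chow_generator \<Sigma> (s k) (m k) \<rho>) | (n::nat) p s m.
    \<forall>k<n. p k \<in> Lam \<and> s k \<in> \<Sigma> \<and> m k \<in> lattice_M_perp (s k)}"

definition chow_equiv ::
    "'v::lattice_space set set \<Rightarrow> (('v set \<Rightarrow> 'v sympoly) \<times> ('v set \<Rightarrow> 'v sympoly)) set" where
  "chow_equiv \<Sigma> = {(C, C'). C \<in> ZT \<Sigma> \<and> C' \<in> ZT \<Sigma> \<and> (\<lambda>\<rho>. C \<rho> - C' \<rho>) \<in> chow_relations \<Sigma>}"

definition chow_group :: "'v::lattice_space set set \<Rightarrow> ('v set \<Rightarrow> 'v sympoly) set set" where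
  "chow_group \<Sigma> = ZT \<Sigma> // chow_equiv \<Sigma>"

definition chow_class ::
    "'v::lattice_space set set \<Rightarrow> ('v set \<Rightarrow> 'v sympoly) \<Rightarrow> ('v set \<Rightarrow> 'v sympoly) set" where
  "chow_class \<Sigma> C = chow_equiv \<Sigma> `` {C}"

definition chow_add :: "'v::lattice_space set set \<Rightarrow> ('v set \<Rightarrow> 'v sympoly) set \<Rightarrow>
    ('v set \<Rightarrow> 'v sympoly) set \<Rightarrow> ('v set \<Rightarrow> 'v sympoly) set" where
  "chow_add \<Sigma> c c' = (\<Union>C\<in>c. \<Union>C'\<in>c'. chow_class \<Sigma> (cyc_add C C'))"

definition chow_smul :: "'v::lattice_space set set \<Rightarrow> 'v sympoly \<Rightarrow>
    ('v set \<Rightarrow> 'v sympoly) set \<Rightarrow> ('v set \<Rightarrow> 'v sympoly) set" where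
  "chow_smul \<Sigma> p c = (\<Union>C\<in>c. chow_class \<Sigma> (cyc_smul p C))"

text \<open>
  The action of equivariant first Chern classes on the equivariant Chow group.  On \<open>Div \<Sigma>\<close> and the
  classes of the \<open>V\<^sub>\<sigma>\<close> it is given by the formula below, for every \<open>m \<in> M \<otimes> Q\<close> that restricts
  to \<open>d\<^sub>\<sigma>\<close>; by bilinearity this determines it.
\<close>

definition chow_action ::
    "'v::lattice_space set set \<Rightarrow> (('v set \<Rightarrow> 'v \<Rightarrow> 'v sympoly) \<Rightarrow>
     ('v set \<Rightarrow> 'v sympoly) set \<Rightarrow> ('v set \<Rightarrow> 'v sympoly) set) \<Rightarrow> bool" where
  "chow_action \<Sigma> \<mu> \<longleftrightarrow> bilinear_action \<Sigma> (chow_group \<Sigma>) (chow_add \<Sigma>) (chow_smul \<Sigma>) \<mu> \<and>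
    (\<forall>d\<in>Div \<Sigma>. \<forall>\<sigma>\<in>\<Sigma>. \<forall>m\<in>dual UNIV. restr (lq.span \<sigma>) m = d \<sigma> \<longrightarrow>
      \<mu> (div_const d) (chow_class \<Sigma> (orbit_cycle \<sigma>)) = chow_class \<Sigma>
        (\<lambda>\<rho>. (\<Sum>\<tau>\<in>star \<Sigma> \<sigma>. const (d \<tau> (normal_gen \<tau> \<sigma>) - m (normal_gen \<tau> \<sigma>)) * orbit_cycle \<tau> \<rho>)
              + linear_form m * orbit_cycle \<sigma> \<rho>))"


section \<open>The non-equivariant action\<close>

text \<open>
  The projection of \<open>M\<^sub>\<tau> \<otimes> Q\<close> onto the kernel of the restriction to \<open>M\<^sub>\<sigma> \<otimes> Q\<close>, along the image
  of \<open>\<Psi>\<close>.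
\<close>

definition psi_proj :: "('v set \<Rightarrow> 'v set \<Rightarrow> ('v \<Rightarrow> rat) \<Rightarrow> 'v \<Rightarrow> rat) \<Rightarrow>
    'v::lattice_space set \<Rightarrow> 'v set \<Rightarrow> ('v \<Rightarrow> rat) \<Rightarrow> 'v \<Rightarrow> rat" where
  "psi_proj \<Psi> \<tau> \<sigma> f = (THE g. g \<in> dual (lq.span \<tau>) \<and> restr (lq.span \<sigma>) g = (\<lambda>x. 0) \<and>
    (\<lambda>x. f x - g x) \<in> \<Psi> (lq.span \<sigma>) (lq.span \<tau>) ` dual (lq.span \<sigma>))"

definition noneq_action :: "'v::lattice_space set set \<Rightarrow>
    ('v set \<Rightarrow> 'v set \<Rightarrow> ('v \<Rightarrow> rat) \<Rightarrow> 'v \<Rightarrow> rat) \<Rightarrow>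
    ('v set \<Rightarrow> 'v \<Rightarrow> rat) \<Rightarrow> ('v set \<Rightarrow> rat) \<Rightarrow> 'v set \<Rightarrow> rat" where
  "noneq_action \<Sigma> \<Psi> d C = (\<lambda>\<rho>. \<Sum>\<sigma>\<in>\<Sigma>. C \<sigma> *
    (\<Sum>\<tau>\<in>star \<Sigma> \<sigma>. psi_proj \<Psi> \<tau> \<sigma> (d \<tau>) (normal_gen \<tau> \<sigma>) * orbit_cycle \<tau> \<rho>))"

definition phi_div :: "('v set \<Rightarrow> 'v \<Rightarrow> 'v sympoly) \<Rightarrow> 'v set \<Rightarrow> 'v \<Rightarrow> rat" where
  "phi_div D = (\<lambda>\<sigma> x. augmentation (D \<sigma> x))"

definition phi_cyc :: "('v set \<Rightarrow> 'v sympoly) \<Rightarrow> 'v set \<Rightarrow> rat" where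
  "phi_cyc C = (\<lambda>\<sigma>. augmentation (C \<sigma>))"

end

theory Submission
  imports Defs
begin

text \<open>
  Each local equation \<open>d\<^sub>\<sigma>\<close> is lifted to a functional \<open>d\<^sub>\<sigma>\<^sup>\<Psi>\<close> on the whole space (\<open>lift d \<sigma>\<close>), and the
  coefficient \<open>\<langle>d\<^sub>\<tau> - d\<^sub>\<sigma>\<^sup>\<Psi>, n\<^bsub>\<tau>,\<sigma>\<^esub>\<rangle>\<close> is \<open>slope d \<tau> \<sigma>\<close>.  Since \<open>d\<^sub>\<sigma>\<^sup>\<Psi>\<close> depends linearly on the values of
  \<open>d\<^sub>\<sigma>\<close> on a basis of \<open>span \<sigma>\<close>, the formula for \<open>D \<cdot> V\<^sub>\<sigma>\<close> makes sense verbatim for divisors with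
  polynomial coefficients and is visibly bilinear (\<open>bilinear_act\<close>).  A bilinear map is determined by
  its values on generators, which gives uniqueness and reduces comparisons with other actions to
  generators (\<open>bilinear_action_hom\<close>).

  For commutativity, consider the coefficient of \<open>V\<^sub>\<rho>\<close> in \<open>D \<cdot> (E \<cdot> V\<^sub>\<sigma>) - E \<cdot> (D \<cdot> V\<^sub>\<sigma>)\<close>.  If \<open>\<sigma>\<close> is a facet of
  \<open>\<rho>\<close>, it vanishes because \<open>d\<^sub>\<rho>\<^sup>\<Psi> - d\<^sub>\<sigma>\<^sup>\<Psi>\<close> and \<open>e\<^sub>\<rho>\<^sup>\<Psi> - e\<^sub>\<sigma>\<^sup>\<Psi>\<close> are proportional: by transitivity of \<open>\<Psi>\<close> they are
  images of functionals on \<open>span \<rho>\<close> that vanish on \<open>span \<sigma>\<close>, and these form a line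
  (\<open>lift_diff_proportional\<close>).  If \<open>\<sigma>\<close> has codimension two in \<open>\<rho>\<close>, the same proportionality turns the
  coefficient, up to sign, into the sum of \<open>(f \<and> g)(n\<^bsub>\<tau>,\<sigma>\<^esub>, n\<^bsub>\<rho>,\<tau>\<^esub>)\<close> over the cones \<open>\<tau>\<close> between \<open>\<sigma>\<close> and \<open>\<rho>\<close>, where
  \<open>f = d\<^sub>\<rho>\<^sup>\<Psi> - d\<^sub>\<sigma>\<^sup>\<Psi>\<close> and \<open>g = e\<^sub>\<rho>\<^sup>\<Psi> - e\<^sub>\<sigma>\<^sup>\<Psi>\<close> vanish on \<open>\<sigma>\<close>.  There are exactly two such cones, and the two
  pairs \<open>(n\<^bsub>\<tau>,\<sigma>\<^esub>, n\<^bsub>\<rho>,\<tau>\<^esub>)\<close> are bases of the rank two lattice \<open>N\<^sub>\<rho> / N\<^sub>\<sigma>\<close> with opposite orientations, so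
  the sum is zero (\<open>sum_wedge_between\<close>).

  The same cancellation, with \<open>g\<close> replaced by an element \<open>m\<close> of \<open>M(\<sigma>)\<close>, shows that the action maps the
  relation of \<open>\<sigma>\<close> and \<open>m\<close> to a combination of relations (\<open>act_chow_generator\<close>).  The action therefore
  descends to the equivariant Chow group, where it is the intersection action because \<open>d\<^sub>\<sigma>\<^sup>\<Psi>\<close> is one of the
  admissible choices of \<open>m\<close> over \<open>d\<^sub>\<sigma>\<close>.  Finally, setting \<open>M\<close> to 0 leaves only the slopes, and
  \<open>slope d \<tau> \<sigma>\<close> is the pairing of \<open>n\<^bsub>\<tau>,\<sigma>\<^esub>\<close> with \<open>\<pi>\<^sub>\<sigma>(d\<^sub>\<tau>)\<close> (\<open>psi_proj_normal\<close>).
\<close>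

section \<open>The symmetric algebra\<close>

lemma const_0 [simp]: "const 0 = 0"
  and const_1 [simp]: "const 1 = 1"
  by (simp_all add: const_def)

lemma const_add: "const (a + b) = const a + const b"
  and const_diff: "const (a - b) = const a - const b"
  and const_minus: "const (- a) = - const a"
  and const_mult: "const (a * b) = const a * const b"
  by (simp_all add: const_def single_add single_diff single_uminus mult_single)

lemma const_sum: "const (sum f A) = (\<Sum>a\<in>A. const (f a))"
  by (induction A rule: infinite_finite_induct) (simp_all add: const_add)

lemma Lam_0 [simp]: "0 \<in> Lam"
  and Lam_const [simp]: "const c \<in> Lam"
  by (auto simp: Lam_def const_def)

lemma Lam_1 [simp]: "1 \<in> Lam"
  using Lam_const[of 1] by simp

lemma Lam_add: "p \<in> Lam \<Longrightarrow> q \<in> Lam \<Longrightarrow> p + q \<in> Lam"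
  unfolding Lam_def using Poly_Mapping.keys_add[of p q] by blast

lemma Lam_uminus: "p \<in> Lam \<Longrightarrow> - p \<in> Lam"
  unfolding Lam_def by simp

lemma Lam_diff: "p \<in> Lam \<Longrightarrow> q \<in> Lam \<Longrightarrow> p - q \<in> Lam"
  using Lam_add[of p "- q"] Lam_uminus[of q] by simp

lemma Lam_mult:
  assumes "p \<in> Lam" "q \<in> Lam"
  shows "p * q \<in> Lam"
proof -
  have "Poly_Mapping.keys t \<subseteq> zbasis" if t: "t \<in> Poly_Mapping.keys (p * q)" for t
  proof -
    obtain a b where "t = a + b" "a \<in> Poly_Mapping.keys p" "b \<in> Poly_Mapping.keys q"
      using t keys_mult[of p q] by blast
    then show ?thesis
      using assms Poly_Mapping.keys_add[of a b] unfolding Lam_def by blast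
  qed
  then show ?thesis by (simp add: Lam_def)
qed

lemma Lam_sum: "(\<And>a. a \<in> A \<Longrightarrow> f a \<in> Lam) \<Longrightarrow> sum f A \<in> Lam"
  by (induction A rule: infinite_finite_induct) (simp_all add: Lam_add)

definition variable :: "'v \<Rightarrow> 'v sympoly" where
  "variable b = Poly_Mapping.single (Poly_Mapping.single b 1) 1"

lemma Lam_variable: "b \<in> zbasis \<Longrightarrow> variable b \<in> Lam"
  by (auto simp: Lam_def variable_def)

lemma linear_form_conv_variable: "linear_form m = (\<Sum>b\<in>zbasis. const (m b) * variable b)"
  by (simp add: linear_form_def const_def variable_def mult_single)

lemma Lam_linear_form: "linear_form m \<in> Lam"
  unfolding linear_form_conv_variable
  by (intro Lam_sum Lam_mult Lam_const Lam_variable)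

lemma linear_form_diff: "linear_form (\<lambda>x. f x - g x) = linear_form f - linear_form g"
  by (simp add: linear_form_conv_variable const_diff left_diff_distrib sum_subtractf)

lemma linear_form_scale: "linear_form (\<lambda>x. c * f x) = const c * linear_form f"
  by (simp add: linear_form_conv_variable const_mult sum_distrib_left mult.assoc)

lemma augmentation_const [simp]: "augmentation (const c) = c"
  by (simp add: augmentation_def const_def)

lemma augmentation_variable [simp]: "augmentation (variable b) = 0"
proof -
  have "Poly_Mapping.single b (1::nat) \<noteq> 0"
    by (metis lookup_single_eq lookup_zero zero_neq_one)
  then show ?thesis by (simp add: augmentation_def variable_def lookup_single_not_eq)
qed

lemma augmentation_0 [simp]: "augmentation 0 = 0"
  by (simp add: augmentation_def)

lemma augmentation_add: "augmentation (p + q) = augmentation p + augmentation q"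
  by (simp add: augmentation_def lookup_add)

lemma augmentation_diff: "augmentation (p - q) = augmentation p - augmentation q"
  by (simp add: augmentation_def lookup_minus)

lemma augmentation_sum: "augmentation (sum f A) = (\<Sum>a\<in>A. augmentation (f a))"
  by (simp add: augmentation_def lookup_sum)

lemma augmentation_mult: "augmentation (p * q) = augmentation p * augmentation q"
proof -
  \<comment> \<open>exponents are natural numbers, so only the constant terms contribute to a constant term\<close>
  have zero: "0 = l + k \<longleftrightarrow> l = 0 \<and> k = 0" for l k :: "'a \<Rightarrow>\<^sub>0 nat"
    by (auto simp: poly_mapping_eq_iff fun_eq_iff lookup_add)
  have "(\<Sum>k. Poly_Mapping.lookup q k when 0 = l + k) = (Poly_Mapping.lookup q 0 when l = 0)" for l
    by (simp add: zero when_def)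
  then show ?thesis
    by (simp add: augmentation_def lookup_mult mult_when)
qed


section \<open>Linear functionals\<close>

lemma dual_add: "f \<in> dual L \<Longrightarrow> g \<in> dual L \<Longrightarrow> (\<lambda>x. f x + g x) \<in> dual L"
  and dual_diff: "f \<in> dual L \<Longrightarrow> g \<in> dual L \<Longrightarrow> (\<lambda>x. f x - g x) \<in> dual L"
  and dual_scale: "f \<in> dual L \<Longrightarrow> (\<lambda>x. c * f x) \<in> dual L"
  and dual_zero: "(\<lambda>x. 0) \<in> dual L"
  by (auto simp: dual_def algebra_simps)

lemma dual_sum: "(\<And>a. a \<in> A \<Longrightarrow> f a \<in> dual L) \<Longrightarrow> (\<lambda>x. \<Sum>a\<in>A. c a * f a x) \<in> dual L"
  by (induction A rule: infinite_finite_induct) (auto intro!: dual_zero dual_add dual_scale)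

lemma dual_outside: "f \<in> dual L \<Longrightarrow> x \<notin> L \<Longrightarrow> f x = 0"
  by (simp add: dual_def)

lemma functional_add: "u \<in> dual UNIV \<Longrightarrow> u (x + y) = u x + u y"
  and functional_scale: "u \<in> dual UNIV \<Longrightarrow> u (c *Q x) = c * u x"
  by (simp_all add: dual_def)

lemma functional_0: "u \<in> dual UNIV \<Longrightarrow> u 0 = 0"
  using functional_scale[of u 0 0] by simp

lemma functional_diff: "u \<in> dual UNIV \<Longrightarrow> u (x - y) = u x - u y"
  using functional_add[of u "x - y" y] by simp

lemma functional_sum: "u \<in> dual UNIV \<Longrightarrow> u (sum f A) = (\<Sum>a\<in>A. u (f a))"
  by (induction A rule: infinite_finite_induct) (simp_all add: functional_0 functional_add)

lemma functional_eq_on_span: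
  assumes "u \<in> dual UNIV" "v \<in> dual UNIV" "\<And>x. x \<in> S \<Longrightarrow> u x = v x" "x \<in> lq.span S"
  shows "u x = v x"
proof -
  have "lq.subspace {x. u x = v x}"
    using assms(1,2)
    by (auto simp: lq.subspace_def functional_add functional_scale functional_0)
  then show ?thesis
    using lq.span_induct[of x S "\<lambda>x. u x = v x"] assms(3,4) by blast
qed

lemma functional_0_on_span:
  assumes "u \<in> dual UNIV" "\<And>x. x \<in> S \<Longrightarrow> u x = 0" "x \<in> lq.span S"
  shows "u x = 0"
  using functional_eq_on_span[OF assms(1) dual_zero] assms(2,3) by blast

lemma restr_diff: "restr L (\<lambda>x. f x - g x) = (\<lambda>x. restr L f x - restr L g x)"
  by (auto simp: restr_def)

text \<open>
  A basis of the span of a cone together with its coordinate functionals expresses a linear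
  functional through finitely many of its values.  This is what extends constructions that are
  linear in a local equation to divisors with polynomial coefficients.
\<close>

definition span_basis :: "'v::lattice_space set \<Rightarrow> 'v set" where
  "span_basis S = (SOME B. lq.independent B \<and> lq.span B = lq.span S)"

definition coordinate :: "'v::lattice_space set \<Rightarrow> 'v \<Rightarrow> 'v \<Rightarrow> rat" where
  "coordinate S b = restr (lq.span S) (\<lambda>x. lq.representation (span_basis S) x b)"

lemma span_basis: "lq.independent (span_basis S)" "lq.span (span_basis S) = lq.span S"
proof -
  obtain B where "lq.independent B" "lq.span B = lq.span S"
    using lq.basis_exists[of S] by (metis lq.span_eq lq.span_superset subset_trans)
  then have "lq.independent (span_basis S) \<and> lq.span (span_basis S) = lq.span S"
    unfolding span_basis_def by (intro someI) blast
  then show "lq.independent (span_basis S)" "lq.span (span_basis S) = lq.span S" by auto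
qed

lemma finite_span_basis: "finite (span_basis S)"
  using span_basis(1) lq.finiteI_independent by blast

lemma coordinate_in_dual: "coordinate S b \<in> dual (lq.span S)"
  using span_basis[of S]
  by (auto simp: dual_def coordinate_def restr_def lq.span_add lq.span_scale
      lq.representation_add lq.representation_scale)

lemma dual_expansion:
  assumes f: "f \<in> dual (lq.span S)"
  shows "f = (\<lambda>x. \<Sum>b\<in>span_basis S. f b * coordinate S b x)"
proof
  fix x
  let ?B = "span_basis S" and ?r = "lq.representation (span_basis S) x"
  have lin: "f (\<Sum>b\<in>A. c b *Q b) = (\<Sum>b\<in>A. c b * f b)" if "A \<subseteq> ?B" for A c
    using finite_subset[OF that finite_span_basis] that
  proof (induction A rule: finite_induct)
    case empty
    have "f (0 *Q 0) = 0 * f 0"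
      using f lq.span_zero[of S] unfolding dual_def by blast
    then show ?case by simp
  next
    case (insert a A)
    have "a \<in> lq.span ?B" "(\<Sum>b\<in>A. c b *Q b) \<in> lq.span ?B"
      using insert.prems by (auto intro: lq.span_sum lq.span_scale lq.span_base)
    then have "a \<in> lq.span S" "(\<Sum>b\<in>A. c b *Q b) \<in> lq.span S"
      by (simp_all add: span_basis)
    then show ?case
      using insert f by (simp add: dual_def lq.span_scale)
  qed
  show "f x = (\<Sum>b\<in>?B. f b * coordinate S b x)"
  proof (cases "x \<in> lq.span S")
    case True
    then have "(\<Sum>b\<in>?B. ?r b *Q b) = x"
      by (intro lq.sum_representation_eq) (simp_all add: span_basis finite_span_basis)
    then show ?thesis
      using lin[of ?B ?r] True by (simp add: coordinate_def restr_def mult.commute)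
  next
    case False
    then show ?thesis
      by (simp add: coordinate_def restr_def dual_outside[OF f])
  qed
qed


section \<open>Lattice points and primitive normals\<close>

lemma lattice_N_add: "x \<in> lattice_N \<Longrightarrow> y \<in> lattice_N \<Longrightarrow> x + y \<in> lattice_N"
proof -
  assume "x \<in> lattice_N" "y \<in> lattice_N"
  then obtain f g :: "'a \<Rightarrow> int" where
    "x = (\<Sum>b\<in>zbasis. of_int (f b) *Q b)" "y = (\<Sum>b\<in>zbasis. of_int (g b) *Q b)"
    by (auto simp: lattice_N_def)
  then have "x + y = (\<Sum>b\<in>zbasis. of_int (f b + g b) *Q b)"
    by (simp add: sum.distrib qscale_left_distrib)
  then show ?thesis unfolding lattice_N_def by (intro CollectI exI)
qed

lemma lattice_N_scale: "x \<in> lattice_N \<Longrightarrow> of_int k *Q x \<in> lattice_N"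
proof -
  assume "x \<in> lattice_N"
  then obtain f :: "'a \<Rightarrow> int" where "x = (\<Sum>b\<in>zbasis. of_int (f b) *Q b)"
    by (auto simp: lattice_N_def)
  then have "of_int k *Q x = (\<Sum>b\<in>zbasis. of_int (k * f b) *Q b)"
    by (simp add: lq.scale_sum_right)
  then show ?thesis unfolding lattice_N_def by (intro CollectI exI)
qed

lemma lattice_N_diff: "x \<in> lattice_N \<Longrightarrow> y \<in> lattice_N \<Longrightarrow> x - y \<in> lattice_N"
  using lattice_N_add[of x "of_int (-1) *Q y"] lattice_N_scale[of y "-1"] by simp

lemma common_denominator:
  fixes f :: "'a \<Rightarrow> rat"
  assumes "finite A"
  shows "\<exists>k::nat. k > 0 \<and> (\<forall>a\<in>A. of_nat k * f a \<in> \<int>)"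
  using assms
proof (induction A rule: finite_induct)
  case (insert a A)
  then obtain k where k: "k > 0" "\<forall>a\<in>A. of_nat k * f a \<in> \<int>" by blast
  obtain i j where ij: "f a = of_int i / of_int j" "j > 0"
    using quotient_of_div quotient_of_denom_pos by (cases "quotient_of (f a)") blast
  have "of_nat (k * nat j) * f a = of_int (int k * i)"
    using ij by simp
  moreover have "of_nat (k * nat j) * f c = of_int j * (of_nat k * f c)" for c
    using ij by simp
  ultimately have "\<forall>c\<in>insert a A. of_nat (k * nat j) * f c \<in> \<int>"
    using k by (metis Ints_mult Ints_of_int insert_iff)
  moreover have "k * nat j > 0"
    using k ij by simp
  ultimately show ?case by blast
qed auto

lemma functional_clear_denominators:
  assumes u: "u \<in> dual UNIV"
  shows "\<exists>k::nat. k > 0 \<and> (\<lambda>x. of_nat k * u x) \<in> lattice_M"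
proof -
  obtain k :: nat where k: "k > 0" "\<forall>b\<in>zbasis. of_nat k * u b \<in> \<int>"
    using common_denominator[OF finite_zbasis] by blast
  have "of_nat k * u x \<in> \<int>" if "x \<in> lattice_N" for x
  proof -
    obtain f :: "'a \<Rightarrow> int" where x: "x = (\<Sum>b\<in>zbasis. of_int (f b) *Q b)"
      using \<open>x \<in> lattice_N\<close> by (auto simp: lattice_N_def)
    have "of_nat k * u x = (\<Sum>b\<in>zbasis. of_int (f b) * (of_nat k * u b))"
      by (simp add: x functional_sum[OF u] functional_scale[OF u] sum_distrib_left mult.left_commute)
    also have "\<dots> \<in> \<int>"
      using k(2) by (intro Ints_sum Ints_mult[OF Ints_of_int]) auto
    finally show ?thesis .
  qed
  then show ?thesis
    using k(1) dual_scale[OF u] by (auto simp: lattice_M_def)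
qed

lemma generator_in_conic_hull: "finite S \<Longrightarrow> s \<in> S \<Longrightarrow> s \<in> conic_hull S"
proof -
  assume S: "finite S" "s \<in> S"
  have "(\<Sum>t\<in>S. (if t = s then 1 else 0) *Q t) = (\<Sum>t\<in>S. if t = s then t else 0)"
    by (rule sum.cong) auto
  then have "s = (\<Sum>t\<in>S. (if t = s then 1 else 0) *Q t)"
    using S by simp
  then show ?thesis
    unfolding conic_hull_def by (intro CollectI exI[of _ "\<lambda>t. if t = s then 1 else 0"]) auto
qed

lemma functional_nonneg_conic_hull:
  assumes "u \<in> dual UNIV" "\<And>s. s \<in> S \<Longrightarrow> 0 \<le> u s" "x \<in> conic_hull S"
  shows "0 \<le> u x"
  using assms by (auto simp: conic_hull_def functional_sum functional_scale intro!: sum_nonneg)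

lemma functional_zero_conic_hull:
  assumes "u \<in> dual UNIV" "\<And>s. s \<in> S \<Longrightarrow> u s = 0" "x \<in> conic_hull S"
  shows "u x = 0"
  using assms by (auto simp: conic_hull_def functional_sum functional_scale intro!: sum.neutral)

lemma cone_face_subset: "cone_face \<sigma> \<tau> \<Longrightarrow> \<sigma> \<subseteq> \<tau>"
  by (auto simp: cone_face_def)

lemma cone_face_functional:
  assumes "cone_face \<sigma> \<tau>"
  obtains u where "u \<in> dual UNIV" "\<And>x. x \<in> \<tau> \<Longrightarrow> 0 \<le> u x"
    "\<And>x. x \<in> \<tau> \<Longrightarrow> u x = 0 \<longleftrightarrow> x \<in> \<sigma>" "\<And>x. x \<in> lq.span \<sigma> \<Longrightarrow> u x = 0"
proof -
  obtain u where u: "u \<in> dual UNIV" "\<forall>x\<in>\<tau>. 0 \<le> u x" "\<sigma> = {x \<in> \<tau>. u x = 0}"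
    using assms by (auto simp: cone_face_def)
  moreover have "u x = 0" if "x \<in> lq.span \<sigma>" for x
    by (rule functional_0_on_span[OF u(1) _ that]) (use u in auto)
  ultimately show thesis using that by auto
qed

lemma cone_face_inter_span: "cone_face \<sigma> \<tau> \<Longrightarrow> x \<in> \<tau> \<Longrightarrow> x \<in> lq.span \<sigma> \<longleftrightarrow> x \<in> \<sigma>"
  by (metis cone_face_functional lq.span_base)

lemma facet_subset: "facet \<sigma> \<tau> \<Longrightarrow> \<sigma> \<subseteq> \<tau>"
  by (simp add: facet_def cone_face_subset)

lemma facet_neq: "facet \<sigma> \<tau> \<Longrightarrow> \<sigma> \<noteq> \<tau>"
  by (auto simp: facet_def)

lemma facet_complement:
  assumes "facet \<sigma> \<tau>" "n \<in> lq.span \<tau>" "n \<notin> lq.span \<sigma>" "x \<in> lq.span \<tau>"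
  obtains q where "x - q *Q n \<in> lq.span \<sigma>"
proof -
  have sub: "insert n \<sigma> \<subseteq> lq.span \<tau>"
    using assms(2) facet_subset[OF assms(1)] lq.span_superset by blast
  have "lq.dim (lq.span \<tau>) \<le> lq.dim (insert n \<sigma>)"
    using assms(1,3) by (simp add: facet_def lq.dim_insert)
  then have "lq.span (insert n \<sigma>) = lq.span \<tau>"
    using lq.dim_eq_span[OF sub] by simp
  then have "x \<in> lq.span (insert n \<sigma>)"
    using assms(4) by simp
  then show thesis
    unfolding lq.span_breakdown_eq using that by blast
qed

text \<open>
  A supporting functional of the facet, cleared of denominators, is integral and positive on a
  generator \<open>s\<close> of \<open>\<tau>\<close> outside \<open>\<sigma>\<close>.  It bounds the integers \<open>k\<close> by which the class of \<open>s\<close>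
  modulo \<open>N\<^sub>\<sigma>\<close> is divisible; dividing by the largest of them gives a primitive class.
\<close>

lemma primitive_normal_exists:
  assumes fac: "facet \<sigma> \<tau>" and cone: "rational_cone \<tau>"
  shows "\<exists>n. primitive_normal \<tau> \<sigma> n"
proof -
  obtain u where u: "u \<in> dual UNIV" "\<And>x. x \<in> \<tau> \<Longrightarrow> 0 \<le> u x"
    "\<And>x. x \<in> \<tau> \<Longrightarrow> u x = 0 \<longleftrightarrow> x \<in> \<sigma>" "\<And>x. x \<in> lq.span \<sigma> \<Longrightarrow> u x = 0"
    using fac cone_face_functional unfolding facet_def by blast
  obtain S where S: "finite S" "S \<subseteq> lattice_N" "\<tau> = conic_hull S"
    using cone by (auto simp: rational_cone_def)
  obtain s where s: "s \<in> S" "u s \<noteq> 0"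
  proof -
    have "\<tau> \<subseteq> \<sigma>" if "\<forall>s\<in>S. u s = 0"
      using functional_zero_conic_hull[OF u(1)] u(3) S(3) that by blast
    then show thesis
      using that facet_subset[OF fac] facet_neq[OF fac] by blast
  qed
  then have s\<tau>: "s \<in> \<tau>" and sN: "s \<in> lattice_N" and us: "u s > 0"
    using S generator_in_conic_hull u(2)[of s] by (auto simp: less_le)
  obtain h :: nat where h: "h > 0" "(\<lambda>x. of_nat h * u x) \<in> lattice_M"
    using functional_clear_denominators[OF u(1)] by blast
  have int: "of_nat h * u x \<in> \<int>" if "x \<in> lattice_N" for x
    using h(2) that by (auto simp: lattice_M_def)
  \<comment> \<open>the integral functional \<open>h u\<close> bounds the divisibility of the class of \<open>s\<close>\<close>
  define P where "P k \<longleftrightarrow> k > 0 \<and> (\<exists>n\<in>lattice_N. s - of_nat k *Q n \<in> lq.span \<sigma>)" for k :: nat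
  obtain z where z: "of_nat h * u s = of_int z"
    using int[OF sN] by (auto elim: Ints_cases)
  have bound: "k \<le> nat z" if "P k" for k
  proof -
    obtain n where n: "n \<in> lattice_N" "s - of_nat k *Q n \<in> lq.span \<sigma>" and k: "k > 0"
      using \<open>P k\<close> by (auto simp: P_def)
    obtain j where j: "of_nat h * u n = of_int j"
      using int[OF n(1)] by (auto elim: Ints_cases)
    have "u s = of_nat k * u n"
      using u(4)[OF n(2)] by (simp add: functional_diff[OF u(1)] functional_scale[OF u(1)])
    then have "(of_int z :: rat) = of_int (int k * j)"
      by (simp flip: z j)
    then have zj: "z = int k * j"
      by (simp only: of_int_eq_iff)
    have "(of_int z :: rat) > 0"
      using h(1) us by (simp flip: z)
    then have "z > 0" by simp
    then have "j > 0"
      using zj k by (simp add: zero_less_mult_iff)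
    then have "int k * 1 \<le> z"
      unfolding zj by (intro mult_left_mono) auto
    then show ?thesis by simp
  qed
  have "P 1"
    using sN by (auto simp: P_def lq.span_zero intro!: bexI[of _ s])
  define k where "k = (GREATEST k. P k)"
  have Pk: "P k" and max: "\<And>j. P j \<Longrightarrow> j \<le> k"
    unfolding k_def using GreatestI_nat[of P 1 "nat z"] Greatest_le_nat[of P _ "nat z"] \<open>P 1\<close> bound
    by blast+
  then obtain n where n: "n \<in> lattice_N" "s - of_nat k *Q n \<in> lq.span \<sigma>" and k: "k > 0"
    by (auto simp: P_def)
  have ns: "n - inverse (of_nat k) *Q s \<in> lq.span \<sigma>"
  proof -
    have "n - inverse (of_nat k) *Q s = - (inverse (of_nat k) *Q (s - of_nat k *Q n))"
      using k by (simp add: lq.scale_right_diff_distrib)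
    then show ?thesis
      using n(2) by (simp add: lq.span_neg lq.span_scale del: lq.scale_minus_right)
  qed
  have "primitive_normal \<tau> \<sigma> n"
    unfolding primitive_normal_def
  proof (intro conjI allI ballI impI)
    show "n \<in> lattice_N" by (rule n(1))
    show "n \<notin> lq.span \<sigma>"
    proof
      assume "n \<in> lq.span \<sigma>"
      then have "s \<in> lq.span \<sigma>"
        using lq.span_add[OF n(2) lq.span_scale[of n \<sigma> "of_nat k"]] by simp
      then show False using u(4) us by force
    qed
    have "inverse (of_nat k) *Q s \<in> \<tau>"
    proof -
      obtain c where c: "\<forall>t\<in>S. 0 \<le> c t" "s = (\<Sum>t\<in>S. c t *Q t)"
        using s\<tau> unfolding S(3) conic_hull_def by blast
      then have "inverse (of_nat k) *Q s = (\<Sum>t\<in>S. (inverse (of_nat k) * c t) *Q t)"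
        by (metis (no_types, lifting) lq.scale_scale lq.scale_sum_right sum.cong)
      then show ?thesis
        unfolding S(3) conic_hull_def using c(1)
        by (intro CollectI exI[of _ "\<lambda>t. inverse (of_nat k) * c t"]) auto
    qed
    then show "\<exists>y\<in>\<tau>. n - y \<in> lq.span \<sigma>"
      using ns by blast
    fix j :: nat and n' :: 'a
    assume n': "n' \<in> lattice_N" and j: "2 \<le> j"
    show "n - of_nat j *Q n' \<notin> lq.span \<sigma>"
    proof
      assume "n - of_nat j *Q n' \<in> lq.span \<sigma>"
      from lq.span_add[OF n(2) lq.span_scale[OF this, of "of_nat k"]]
      have "s - of_nat (k * j) *Q n' \<in> lq.span \<sigma>"
        by (simp add: lq.scale_right_diff_distrib)
      then have "P (k * j)"
        using n' j k by (auto simp: P_def)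
      then have "k * j \<le> k * 1"
        using max by simp
      then show False using j k by simp
    qed
  qed
  then show ?thesis by blast
qed

text \<open>
  The quotient \<open>N\<^sub>\<tau> / N\<^sub>\<sigma>\<close> is infinite cyclic, and the primitive class generates it: if a
  lattice point had a coefficient with denominator \<open>k > 1\<close>, then \<open>n\<close> would be divisible by \<open>k\<close>.
\<close>

lemma primitive_normal_lattice:
  assumes prim: "primitive_normal \<tau> \<sigma> n" and fac: "facet \<sigma> \<tau>" and n: "n \<in> lq.span \<tau>"
    and x: "x \<in> lattice_N" "x \<in> lq.span \<tau>"
  obtains b :: int where "x - of_int b *Q n \<in> lq.span \<sigma>"
proof -
  have nN: "n \<in> lattice_N" and n\<sigma>: "n \<notin> lq.span \<sigma>"
    and np: "\<And>k n'. n' \<in> lattice_N \<Longrightarrow> k \<ge> 2 \<Longrightarrow> n - of_nat k *Q n' \<notin> lq.span \<sigma>"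
    using prim by (auto simp: primitive_normal_def)
  obtain q where q: "x - q *Q n \<in> lq.span \<sigma>"
    using facet_complement[OF fac n n\<sigma> x(2)] .
  obtain a k where ak: "q = of_int a / of_int k" "k > 0" "coprime a k"
    using quotient_of_div quotient_of_denom_pos quotient_of_coprime
    by (cases "quotient_of q") blast
  \<comment> \<open>by Bezout the lattice contains a point congruent to \<open>n / k\<close>\<close>
  obtain r t where rt: "r * a + t * k = 1"
    using ak(3) by (metis bezout_int coprime_imp_gcd_eq_1)
  define n' where "n' = of_int r *Q x + of_int t *Q n"
  have n'N: "n' \<in> lattice_N"
    using x nN by (simp add: n'_def lattice_N_add lattice_N_scale)
  have "n - of_int k *Q n' = of_int (- (r * k)) *Q (x - q *Q n)"
  proof -
    have "of_int r * of_int a + of_int t * of_int k = (1 :: rat)"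
      using rt by (metis of_int_1 of_int_add of_int_mult)
    moreover have "of_int (r * k) * q = of_int r * of_int a"
      using ak by simp
    ultimately have "of_int (r * k) * q + of_int (k * t) = (1 :: rat)"
      by (simp only: of_int_mult mult.commute[of "of_int k" "of_int t"])
    then have "n = (of_int (r * k) * q + of_int (k * t)) *Q n"
      by (simp only: lq.scale_one)
    then have "n - of_int k *Q n' = (of_int (r * k) * q + of_int (k * t)) *Q n - of_int k *Q n'"
      by simp
    also have "\<dots> = of_int (- (r * k)) *Q (x - q *Q n)"
      by (simp add: n'_def lq.scale_right_diff_distrib lq.scale_right_distrib lq.scale_left_distrib
          mult.commute)
    finally show ?thesis .
  qed
  then have "n - of_nat (nat k) *Q n' \<in> lq.span \<sigma>"
    using lq.span_scale[OF q] ak(2) by (metis of_nat_nat order_less_imp_le)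
  then have "\<not> nat k \<ge> 2"
    using np[OF n'N] by blast
  then have "k = 1" using ak(2) by linarith
  then show thesis using that q ak(1) by simp
qed


section \<open>The two cones between a cone and a face of codimension two\<close>

lemma toric_fan_face: "toric_fan \<Sigma> \<Longrightarrow> \<tau> \<in> \<Sigma> \<Longrightarrow> cone_face \<sigma> \<tau> \<Longrightarrow> \<sigma> \<in> \<Sigma>"
  by (simp add: toric_fan_def)

lemma toric_fan_subset_face:
  assumes "toric_fan \<Sigma>" "\<sigma> \<in> \<Sigma>" "\<tau> \<in> \<Sigma>" "\<sigma> \<subseteq> \<tau>"
  shows "cone_face \<sigma> \<tau>"
proof -
  have "cone_face (\<sigma> \<inter> \<tau>) \<tau>"
    using assms(1-3) by (simp add: toric_fan_def)
  then show ?thesis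
    using assms(4) by (simp add: Int_absorb2)
qed

lemma normal_gen_primitive:
  assumes "toric_fan \<Sigma>" "\<tau> \<in> \<Sigma>" "facet \<sigma> \<tau>"
  shows "primitive_normal \<tau> \<sigma> (normal_gen \<tau> \<sigma>)"
  unfolding normal_gen_def
  by (rule someI_ex, rule primitive_normal_exists) (use assms in \<open>auto simp: toric_fan_def\<close>)

lemma normal_gen_facts:
  assumes "toric_fan \<Sigma>" "\<tau> \<in> \<Sigma>" "facet \<sigma> \<tau>"
  shows "normal_gen \<tau> \<sigma> \<in> lattice_N" "normal_gen \<tau> \<sigma> \<notin> lq.span \<sigma>"
    "normal_gen \<tau> \<sigma> \<in> lq.span \<tau>"
    "\<exists>y\<in>\<tau>. y \<notin> \<sigma> \<and> normal_gen \<tau> \<sigma> - y \<in> lq.span \<sigma>"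
proof -
  let ?n = "normal_gen \<tau> \<sigma>"
  note prim = normal_gen_primitive[OF assms]
  show n: "?n \<in> lattice_N" "?n \<notin> lq.span \<sigma>"
    using prim by (simp_all add: primitive_normal_def)
  obtain y where y: "y \<in> \<tau>" "?n - y \<in> lq.span \<sigma>"
    using prim by (auto simp: primitive_normal_def)
  have "?n - y \<in> lq.span \<tau>"
    using y(2) lq.span_mono[OF facet_subset[OF assms(3)]] by blast
  from lq.span_add[OF this lq.span_base[OF y(1)]]
  show "?n \<in> lq.span \<tau>" by simp
  have "y \<notin> \<sigma>"
    using n(2) lq.span_add[OF y(2), of y] lq.span_base[of y \<sigma>] by auto
  then show "\<exists>y\<in>\<tau>. y \<notin> \<sigma> \<and> ?n - y \<in> lq.span \<sigma>"
    using y by blast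
qed

definition between :: "'v::lattice_space set set \<Rightarrow> 'v set \<Rightarrow> 'v set \<Rightarrow> 'v set set" where
  "between \<Sigma> \<sigma> \<rho> = {\<tau> \<in> \<Sigma>. facet \<sigma> \<tau> \<and> facet \<tau> \<rho>}"

text \<open>
  If the common face were larger than \<open>\<sigma>\<close>, it would span both \<open>\<tau>\<^sub>1\<close> and \<open>\<tau>\<^sub>2\<close>, since each has only
  one dimension more than \<open>\<sigma>\<close>; a face that spans its cone is the whole cone.
\<close>

lemma between_inter:
  assumes fan: "toric_fan \<Sigma>" and \<tau>: "\<tau>\<^sub>1 \<in> between \<Sigma> \<sigma> \<rho>" "\<tau>\<^sub>2 \<in> between \<Sigma> \<sigma> \<rho>" "\<tau>\<^sub>1 \<noteq> \<tau>\<^sub>2"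
  shows "\<tau>\<^sub>1 \<inter> \<tau>\<^sub>2 = \<sigma>"
proof -
  have mem: "\<tau>\<^sub>1 \<in> \<Sigma>" "\<tau>\<^sub>2 \<in> \<Sigma>" and fac: "facet \<sigma> \<tau>\<^sub>1" "facet \<sigma> \<tau>\<^sub>2"
    using \<tau> by (auto simp: between_def)
  let ?F = "\<tau>\<^sub>1 \<inter> \<tau>\<^sub>2"
  have face: "cone_face ?F \<tau>\<^sub>1" "cone_face ?F \<tau>\<^sub>2"
    using fan mem by (auto simp: toric_fan_def)
  have sub: "\<sigma> \<subseteq> ?F"
    using fac facet_subset by blast
  have "x \<in> \<sigma>" if x: "x \<in> ?F" for x
  proof (rule ccontr)
    assume "x \<notin> \<sigma>"
    then have x\<sigma>: "x \<notin> lq.span \<sigma>"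
      using x fac(1) cone_face_inter_span[of \<sigma> \<tau>\<^sub>1] by (auto simp: facet_def)
    have full: "y \<in> ?F" if y: "y \<in> \<tau>" and fac: "facet \<sigma> \<tau>" and face: "cone_face ?F \<tau>" for y \<tau>
    proof -
      have "x \<in> lq.span \<tau>"
        using x face cone_face_subset lq.span_base by blast
      then obtain q where "y - q *Q x \<in> lq.span \<sigma>"
        using facet_complement[OF fac _ x\<sigma>] lq.span_base[OF y] by blast
      then have "y - q *Q x \<in> lq.span ?F"
        using lq.span_mono[OF sub] by blast
      from lq.span_add[OF this lq.span_scale[OF lq.span_base[OF x], of q]]
      show ?thesis
        using cone_face_inter_span[OF face y] by simp
    qed
    have "\<tau>\<^sub>1 \<subseteq> ?F" "\<tau>\<^sub>2 \<subseteq> ?F"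
      using full face fac by blast+
    then show False using \<tau>(3) by blast
  qed
  then show ?thesis using sub by blast
qed

text \<open>
  The inner normal of the facet \<open>\<tau>\<close> of \<open>\<rho>\<close>.  All statements below about positions and
  orientations inside \<open>\<rho>\<close> are read off from the signs of such functionals on normal vectors.
\<close>

lemma facet_functional:
  assumes fan: "toric_fan \<Sigma>" and \<rho>: "\<rho> \<in> \<Sigma>" and \<tau>\<rho>: "facet \<tau> \<rho>"
  obtains u where "u \<in> dual UNIV" "\<And>x. x \<in> lq.span \<tau> \<Longrightarrow> u x = 0" "u (normal_gen \<rho> \<tau>) > 0"
    "\<And>\<sigma> \<tau>'. \<tau> \<in> between \<Sigma> \<sigma> \<rho> \<Longrightarrow> \<tau>' \<in> between \<Sigma> \<sigma> \<rho> \<Longrightarrow> \<tau>' \<noteq> \<tau> \<Longrightarrow> u (normal_gen \<tau>' \<sigma>) > 0"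
proof -
  obtain u where u: "u \<in> dual UNIV" "\<And>x. x \<in> \<rho> \<Longrightarrow> 0 \<le> u x"
    "\<And>x. x \<in> \<rho> \<Longrightarrow> u x = 0 \<longleftrightarrow> x \<in> \<tau>" "\<And>x. x \<in> lq.span \<tau> \<Longrightarrow> u x = 0"
    using \<tau>\<rho> cone_face_functional unfolding facet_def by blast
  have pos: "u n > 0" if "y \<in> \<rho>" "y \<notin> \<tau>" "n - y \<in> lq.span \<tau>" for n y
  proof -
    have "u y > 0"
      using u(2,3)[of y] that(1,2) by (auto simp: less_le)
    then show ?thesis
      using u(4)[OF that(3)] by (simp add: functional_diff[OF u(1)])
  qed
  have other: "u (normal_gen \<tau>' \<sigma>) > 0"
    if \<tau>: "\<tau> \<in> between \<Sigma> \<sigma> \<rho>" "\<tau>' \<in> between \<Sigma> \<sigma> \<rho>" "\<tau>' \<noteq> \<tau>" for \<sigma> \<tau>'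
  proof -
    have \<tau>': "\<tau>' \<in> \<Sigma>" "facet \<sigma> \<tau>'" "facet \<tau>' \<rho>" "facet \<sigma> \<tau>"
      using \<tau> by (auto simp: between_def)
    obtain y where y: "y \<in> \<tau>'" "y \<notin> \<sigma>" "normal_gen \<tau>' \<sigma> - y \<in> lq.span \<sigma>"
      using normal_gen_facts(4)[OF fan \<tau>'(1,2)] by blast
    show ?thesis
    proof (rule pos)
      show "y \<in> \<rho>" using y(1) facet_subset[OF \<tau>'(3)] by blast
      show "y \<notin> \<tau>" using y between_inter[OF fan \<tau>(2,1,3)] by blast
      show "normal_gen \<tau>' \<sigma> - y \<in> lq.span \<tau>"
        using y(3) lq.span_mono[OF facet_subset[OF \<tau>'(4)]] by blast
    qed
  qed
  have "u (normal_gen \<rho> \<tau>) > 0"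
    using normal_gen_facts(4)[OF fan \<rho> \<tau>\<rho>] pos by blast
  then show thesis
    using that u(1,4) other by blast
qed

text \<open>
  Modulo \<open>span \<sigma>\<close> the cone \<open>\<rho>\<close> lives in a plane.  Write the third ray as
  \<open>a n\<^sub>1 + b n\<^sub>2\<close>.  The inner normals of \<open>\<tau>\<^sub>1\<close> and \<open>\<tau>\<^sub>2\<close> show that \<open>a\<close> and \<open>b\<close> are positive, but then
  the inner normal of \<open>\<tau>\<^sub>3\<close>, which vanishes on the third ray, would be positive on it.
\<close>

lemma between_at_most_two:
  assumes fan: "toric_fan \<Sigma>" and \<rho>: "\<rho> \<in> \<Sigma>"
    and \<tau>: "\<tau>\<^sub>1 \<in> between \<Sigma> \<sigma> \<rho>" "\<tau>\<^sub>2 \<in> between \<Sigma> \<sigma> \<rho>" "\<tau>\<^sub>1 \<noteq> \<tau>\<^sub>2" "\<tau>\<^sub>3 \<in> between \<Sigma> \<sigma> \<rho>"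
  shows "\<tau>\<^sub>3 = \<tau>\<^sub>1 \<or> \<tau>\<^sub>3 = \<tau>\<^sub>2"
proof (rule ccontr)
  assume "\<not> ?thesis"
  then have neq: "\<tau>\<^sub>3 \<noteq> \<tau>\<^sub>1" "\<tau>\<^sub>3 \<noteq> \<tau>\<^sub>2" by auto
  have mem: "\<tau>\<^sub>1 \<in> \<Sigma>" "\<tau>\<^sub>2 \<in> \<Sigma>" "\<tau>\<^sub>3 \<in> \<Sigma>" and low: "facet \<sigma> \<tau>\<^sub>1" "facet \<sigma> \<tau>\<^sub>2" "facet \<sigma> \<tau>\<^sub>3"
    and up: "facet \<tau>\<^sub>1 \<rho>" "facet \<tau>\<^sub>2 \<rho>" "facet \<tau>\<^sub>3 \<rho>"
    using \<tau> by (auto simp: between_def)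
  let ?n = "\<lambda>\<tau>. normal_gen \<tau> \<sigma>"
  obtain u\<^sub>1 where u\<^sub>1: "u\<^sub>1 \<in> dual UNIV" "\<And>x. x \<in> lq.span \<tau>\<^sub>1 \<Longrightarrow> u\<^sub>1 x = 0"
    "u\<^sub>1 (?n \<tau>\<^sub>2) > 0" "u\<^sub>1 (?n \<tau>\<^sub>3) > 0"
    by (rule facet_functional[OF fan \<rho> up(1)]) (use \<tau> neq in blast)
  obtain u\<^sub>2 where u\<^sub>2: "u\<^sub>2 \<in> dual UNIV" "\<And>x. x \<in> lq.span \<tau>\<^sub>2 \<Longrightarrow> u\<^sub>2 x = 0"
    "u\<^sub>2 (?n \<tau>\<^sub>1) > 0" "u\<^sub>2 (?n \<tau>\<^sub>3) > 0"
    by (rule facet_functional[OF fan \<rho> up(2)]) (use \<tau> neq in blast)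
  obtain u\<^sub>3 where u\<^sub>3: "u\<^sub>3 \<in> dual UNIV" "\<And>x. x \<in> lq.span \<tau>\<^sub>3 \<Longrightarrow> u\<^sub>3 x = 0"
    "u\<^sub>3 (?n \<tau>\<^sub>1) > 0" "u\<^sub>3 (?n \<tau>\<^sub>2) > 0"
    by (rule facet_functional[OF fan \<rho> up(3)]) (use \<tau> neq in blast)
  have n: "?n \<tau>\<^sub>1 \<in> lq.span \<tau>\<^sub>1" "?n \<tau>\<^sub>2 \<in> lq.span \<tau>\<^sub>2" "?n \<tau>\<^sub>3 \<in> lq.span \<tau>\<^sub>3" "?n \<tau>\<^sub>1 \<notin> lq.span \<sigma>"
    using normal_gen_facts[OF fan] mem low by auto
  have n\<rho>: "?n \<tau>\<^sub>2 \<in> lq.span \<rho>" "?n \<tau>\<^sub>3 \<in> lq.span \<rho>"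
    using n lq.span_mono[OF facet_subset] up by blast+
  obtain b where b: "?n \<tau>\<^sub>3 - b *Q ?n \<tau>\<^sub>2 \<in> lq.span \<tau>\<^sub>1"
    using facet_complement[OF up(1) n\<rho>(1) _ n\<rho>(2)] u\<^sub>1(2,3) by (metis less_irrefl)
  obtain a where a: "?n \<tau>\<^sub>3 - b *Q ?n \<tau>\<^sub>2 - a *Q ?n \<tau>\<^sub>1 \<in> lq.span \<sigma>"
    using facet_complement[OF low(1) n(1,4) b] .
  have eval: "u (?n \<tau>\<^sub>3) = b * u (?n \<tau>\<^sub>2) + a * u (?n \<tau>\<^sub>1)"
    if "u \<in> dual UNIV" "\<And>x. x \<in> lq.span \<tau> \<Longrightarrow> u x = 0" "facet \<sigma> \<tau>" for u \<tau>
  proof -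
    have "u (?n \<tau>\<^sub>3 - b *Q ?n \<tau>\<^sub>2 - a *Q ?n \<tau>\<^sub>1) = 0"
      using that(2) a lq.span_mono[OF facet_subset[OF that(3)]] by blast
    then show ?thesis
      using that(1) by (simp add: functional_diff functional_scale)
  qed
  have "b * u\<^sub>1 (?n \<tau>\<^sub>2) > 0"
    using eval[OF u\<^sub>1(1,2) low(1)] u\<^sub>1(2)[OF n(1)] u\<^sub>1(4) by simp
  then have "b > 0" using u\<^sub>1(3) by (simp add: zero_less_mult_iff)
  have "a * u\<^sub>2 (?n \<tau>\<^sub>1) > 0"
    using eval[OF u\<^sub>2(1,2) low(2)] u\<^sub>2(2)[OF n(2)] u\<^sub>2(4) by simp
  then have "a > 0" using u\<^sub>2(3) by (simp add: zero_less_mult_iff)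
  have "b * u\<^sub>3 (?n \<tau>\<^sub>2) + a * u\<^sub>3 (?n \<tau>\<^sub>1) = 0"
    using eval[OF u\<^sub>3(1,2) low(3)] u\<^sub>3(2)[OF n(3)] by simp
  moreover have "b * u\<^sub>3 (?n \<tau>\<^sub>2) > 0" "a * u\<^sub>3 (?n \<tau>\<^sub>1) > 0"
    using \<open>a > 0\<close> \<open>b > 0\<close> u\<^sub>3 by simp_all
  ultimately show False by simp
qed

text \<open>
  In the pencil of functionals that vanish on \<open>\<sigma>\<close>, start with \<open>v\<close> supporting \<open>\<sigma>\<close> and subtract the
  multiple \<open>c u\<close> of the inner normal \<open>u\<close> of \<open>\<tau>\<close>, with \<open>c\<close> as large as nonnegativity on \<open>\<rho>\<close> permits.
  The result supports the facet of \<open>\<rho>\<close> on the other side of \<open>\<sigma>\<close>.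
\<close>

lemma between_second:
  assumes fan: "toric_fan \<Sigma>" and \<sigma>: "\<sigma> \<in> \<Sigma>" and \<rho>: "\<rho> \<in> \<Sigma>" and \<tau>: "\<tau> \<in> between \<Sigma> \<sigma> \<rho>"
  shows "\<exists>\<tau>'\<in>between \<Sigma> \<sigma> \<rho>. \<tau>' \<noteq> \<tau>"
proof -
  have low: "facet \<sigma> \<tau>" and up: "facet \<tau> \<rho>"
    using \<tau> by (auto simp: between_def)
  have sub: "\<sigma> \<subseteq> \<tau>" "\<tau> \<subseteq> \<rho>"
    using low up facet_subset by blast+
  have \<sigma>\<rho>: "cone_face \<sigma> \<rho>"
    using toric_fan_subset_face[OF fan \<sigma> \<rho>] sub by blast
  obtain S where S: "finite S" "\<rho> = conic_hull S"
    using fan \<rho> by (auto simp: toric_fan_def rational_cone_def)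
  have S\<rho>: "s \<in> \<rho>" if "s \<in> S" for s
    using generator_in_conic_hull[OF S(1) that] S(2) by simp
  obtain u where u: "u \<in> dual UNIV" "\<And>x. x \<in> \<rho> \<Longrightarrow> 0 \<le> u x"
    "\<And>x. x \<in> \<rho> \<Longrightarrow> u x = 0 \<longleftrightarrow> x \<in> \<tau>" "\<And>x. x \<in> lq.span \<tau> \<Longrightarrow> u x = 0"
    using up cone_face_functional unfolding facet_def by blast
  obtain v where v: "v \<in> dual UNIV" "\<And>x. x \<in> \<rho> \<Longrightarrow> 0 \<le> v x"
    "\<And>x. x \<in> \<rho> \<Longrightarrow> v x = 0 \<longleftrightarrow> x \<in> \<sigma>" "\<And>x. x \<in> lq.span \<sigma> \<Longrightarrow> v x = 0"
    using \<sigma>\<rho> cone_face_functional by blast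
  define T where "T = {s \<in> S. u s \<noteq> 0}"
  have "T \<noteq> {}"
  proof
    assume "T = {}"
    then have "\<rho> \<subseteq> \<tau>"
      using functional_zero_conic_hull[OF u(1)] u(3) S(2) by (auto simp: T_def)
    then show False
      using sub(2) facet_neq[OF up] by blast
  qed
  have upos: "u s > 0" if "s \<in> T" for s
    using that u(2)[OF S\<rho>, of s] by (auto simp: T_def less_le)
  \<comment> \<open>tilt the supporting hyperplane of \<open>\<sigma>\<close> until it meets a generator outside \<open>\<tau>\<close>\<close>
  define c where "c = Min ((\<lambda>s. v s / u s) ` T)"
  have finT: "finite T" using S(1) by (simp add: T_def)
  obtain s where s: "s \<in> T" "v s / u s = c"
  proof -
    have "c \<in> (\<lambda>s. v s / u s) ` T"
      unfolding c_def using finT \<open>T \<noteq> {}\<close> by (intro Min_in) auto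
    then show thesis using that by blast
  qed
  have cmin: "c \<le> v t / u t" if "t \<in> T" for t
    unfolding c_def using finT that by auto
  define w where "w = (\<lambda>x. v x - c * u x)"
  have w: "w \<in> dual UNIV"
    unfolding w_def by (intro dual_diff dual_scale u(1) v(1))
  have wS: "0 \<le> w t" if "t \<in> S" for t
  proof (cases "t \<in> T")
    case True
    then show ?thesis
      using cmin[OF True] upos[OF True] by (simp add: w_def field_simps)
  next
    case False
    then show ?thesis
      using that v(2)[OF S\<rho>[OF that]] by (simp add: w_def T_def)
  qed
  define \<tau>' where "\<tau>' = {x \<in> \<rho>. w x = 0}"
  have face: "cone_face \<tau>' \<rho>"
    unfolding cone_face_def \<tau>'_def
    using w functional_nonneg_conic_hull[OF w wS] S(2) by blast
  have \<tau>'\<Sigma>: "\<tau>' \<in> \<Sigma>"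
    using toric_fan_face[OF fan \<rho> face] .
  have \<sigma>\<tau>': "\<sigma> \<subseteq> \<tau>'"
  proof
    fix x assume x: "x \<in> \<sigma>"
    then have "x \<in> \<rho>" "x \<in> \<tau>" using sub by auto
    then show "x \<in> \<tau>'"
      using x u(3)[of x] v(3)[of x] by (simp add: \<tau>'_def w_def)
  qed
  have s\<rho>: "s \<in> \<rho>" using s(1) S\<rho> by (auto simp: T_def)
  have s\<tau>': "s \<in> \<tau>'"
    using s upos[OF s(1)] s\<rho> by (auto simp: \<tau>'_def w_def field_simps)
  have s\<tau>: "s \<notin> \<tau>"
    using upos[OF s(1)] u(3)[OF s\<rho>] by auto
  have "s \<notin> lq.span \<sigma>"
    using s\<tau> sub(1) cone_face_inter_span[OF \<sigma>\<rho> s\<rho>] by blast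
  then have "lq.dim \<sigma> + 1 = lq.dim (insert s \<sigma>)"
    by (simp add: lq.dim_insert)
  also have "\<dots> \<le> lq.dim \<tau>'"
    by (rule lq.dim_subset) (use s\<tau>' \<sigma>\<tau>' in blast)
  finally have lower: "lq.dim \<sigma> + 1 \<le> lq.dim \<tau>'" .
  obtain y where y: "y \<in> \<tau>" "y \<notin> \<sigma>"
    using sub(1) facet_neq[OF low] by blast
  have y\<rho>: "y \<in> \<rho>" using y sub by blast
  have "w y \<noteq> 0"
    using u(3)[OF y\<rho>] v(3)[OF y\<rho>] y by (simp add: w_def)
  then have "y \<notin> lq.span \<tau>'"
    using functional_0_on_span[OF w, of \<tau>' y] by (auto simp: \<tau>'_def)
  then have "lq.dim \<tau>' + 1 = lq.dim (insert y \<tau>')"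
    by (simp add: lq.dim_insert)
  also have "\<dots> \<le> lq.dim \<rho>"
    by (rule lq.dim_subset) (use y\<rho> in \<open>auto simp: \<tau>'_def\<close>)
  finally have upper: "lq.dim \<tau>' + 1 \<le> lq.dim \<rho>" .
  have "lq.dim \<rho> = lq.dim \<sigma> + 2"
    using low up by (simp add: facet_def)
  then have dims: "lq.dim \<tau>' = lq.dim \<sigma> + 1" "lq.dim \<rho> = lq.dim \<tau>' + 1"
    using lower upper by auto
  have "\<tau>' \<in> between \<Sigma> \<sigma> \<rho>"
    using \<tau>'\<Sigma> toric_fan_subset_face[OF fan \<sigma> \<tau>'\<Sigma> \<sigma>\<tau>'] face dims
    by (simp add: between_def facet_def)
  moreover have "\<tau>' \<noteq> \<tau>" using s\<tau> s\<tau>' by blast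
  ultimately show ?thesis by blast
qed

text \<open>
  The value of the alternating form \<open>f \<and> g\<close> on a pair of vectors.
\<close>

definition wedge :: "('v \<Rightarrow> rat) \<Rightarrow> ('v \<Rightarrow> rat) \<Rightarrow> 'v \<Rightarrow> 'v \<Rightarrow> rat" where
  "wedge f g x y = f x * g y - g x * f y"

text \<open>
  The vectors \<open>n\<^bsub>\<tau>\<^sub>1,\<sigma>\<^esub>\<close> and \<open>n\<^bsub>\<rho>,\<tau>\<^sub>1\<^esub>\<close> form a basis of the rank two lattice \<open>N\<^sub>\<rho> / N\<^sub>\<sigma>\<close>.  Hence
  every other pair is an integral combination of it, and \<open>e\<close> is the determinant of the one that
  belongs to \<open>\<tau>\<^sub>2\<close>.  The number \<open>b\<close> is the coefficient of \<open>n\<^bsub>\<rho>,\<tau>\<^sub>1\<^esub>\<close> in \<open>n\<^bsub>\<tau>\<^sub>2,\<sigma>\<^esub>\<close>; its sign records that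
  \<open>\<tau>\<^sub>2\<close> and \<open>\<rho>\<close> lie on the same side of \<open>\<tau>\<^sub>1\<close>.
\<close>

lemma wedge_change_of_basis:
  assumes fan: "toric_fan \<Sigma>" and \<rho>: "\<rho> \<in> \<Sigma>"
    and \<tau>: "\<tau>\<^sub>1 \<in> between \<Sigma> \<sigma> \<rho>" "\<tau>\<^sub>2 \<in> between \<Sigma> \<sigma> \<rho>" "\<tau>\<^sub>1 \<noteq> \<tau>\<^sub>2"
    and f: "f \<in> dual UNIV" "\<And>x. x \<in> lq.span \<sigma> \<Longrightarrow> f x = 0"
    and g: "g \<in> dual UNIV" "\<And>x. x \<in> lq.span \<sigma> \<Longrightarrow> g x = 0"
  obtains b e :: int where "b > 0"
    "wedge f g (normal_gen \<tau>\<^sub>1 \<sigma>) (normal_gen \<tau>\<^sub>2 \<sigma>)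
      = of_int b * wedge f g (normal_gen \<tau>\<^sub>1 \<sigma>) (normal_gen \<rho> \<tau>\<^sub>1)"
    "wedge f g (normal_gen \<tau>\<^sub>2 \<sigma>) (normal_gen \<rho> \<tau>\<^sub>2)
      = of_int e * wedge f g (normal_gen \<tau>\<^sub>1 \<sigma>) (normal_gen \<rho> \<tau>\<^sub>1)"
proof -
  have mem: "\<tau>\<^sub>1 \<in> \<Sigma>" "\<tau>\<^sub>2 \<in> \<Sigma>" and low: "facet \<sigma> \<tau>\<^sub>1" "facet \<sigma> \<tau>\<^sub>2"
    and up: "facet \<tau>\<^sub>1 \<rho>" "facet \<tau>\<^sub>2 \<rho>"
    using \<tau> by (auto simp: between_def)
  let ?n = "normal_gen \<tau>\<^sub>1 \<sigma>" and ?m = "normal_gen \<rho> \<tau>\<^sub>1"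
  note n = normal_gen_facts[OF fan mem(1) low(1)]
  note m = normal_gen_facts[OF fan \<rho> up(1)]
  have expand: "\<exists>a b :: int. x - of_int b *Q ?m - of_int a *Q ?n \<in> lq.span \<sigma>"
    if x: "x \<in> lattice_N" "x \<in> lq.span \<rho>" for x
  proof -
    obtain b :: int where b: "x - of_int b *Q ?m \<in> lq.span \<tau>\<^sub>1"
      using primitive_normal_lattice[OF normal_gen_primitive[OF fan \<rho> up(1)] up(1) m(3) x] .
    have "x - of_int b *Q ?m \<in> lattice_N"
      using x(1) m(1) by (simp add: lattice_N_diff lattice_N_scale)
    then obtain a :: int where "x - of_int b *Q ?m - of_int a *Q ?n \<in> lq.span \<sigma>"
      using primitive_normal_lattice[OF normal_gen_primitive[OF fan mem(1) low(1)] low(1) n(3) _ b]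
      by blast
    then show ?thesis by blast
  qed
  note n\<^sub>2 = normal_gen_facts[OF fan mem(2) low(2)]
  note m\<^sub>2 = normal_gen_facts[OF fan \<rho> up(2)]
  have "normal_gen \<tau>\<^sub>2 \<sigma> \<in> lq.span \<rho>"
    using n\<^sub>2(3) lq.span_mono[OF facet_subset[OF up(2)]] by blast
  then obtain a b :: int where ab: "normal_gen \<tau>\<^sub>2 \<sigma> - of_int b *Q ?m - of_int a *Q ?n \<in> lq.span \<sigma>"
    using expand[OF n\<^sub>2(1)] by blast
  obtain c d :: int where cd: "normal_gen \<rho> \<tau>\<^sub>2 - of_int d *Q ?m - of_int c *Q ?n \<in> lq.span \<sigma>"
    using expand[OF m\<^sub>2(1,3)] by blast
  have eval: "h x = of_int b * h ?m + of_int a * h ?n"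
    if "h \<in> dual UNIV" "\<And>x. x \<in> lq.span \<sigma> \<Longrightarrow> h x = 0" "x - of_int b *Q ?m - of_int a *Q ?n \<in> lq.span \<sigma>"
    for h x and a b :: int
    using that(2)[OF that(3)] by (simp add: functional_diff[OF that(1)] functional_scale[OF that(1)])
  obtain u where u: "u \<in> dual UNIV" "\<And>x. x \<in> lq.span \<tau>\<^sub>1 \<Longrightarrow> u x = 0" "u ?m > 0"
    "u (normal_gen \<tau>\<^sub>2 \<sigma>) > 0"
    by (rule facet_functional[OF fan \<rho> up(1)]) (use \<tau> in blast)
  have "u x = 0" if "x \<in> lq.span \<sigma>" for x
    using u(2) that lq.span_mono[OF facet_subset[OF low(1)]] by blast
  from eval[OF u(1) this ab] have "of_int b * u ?m > 0"
    using u(2)[OF n(3)] u(4) by simp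
  then have "b > 0"
    using u(3) by (simp add: zero_less_mult_iff)
  moreover have "wedge f g ?n (normal_gen \<tau>\<^sub>2 \<sigma>) = of_int b * wedge f g ?n ?m"
    by (simp add: wedge_def eval[OF f ab] eval[OF g ab] algebra_simps)
  moreover have "wedge f g (normal_gen \<tau>\<^sub>2 \<sigma>) (normal_gen \<rho> \<tau>\<^sub>2)
      = of_int (a * d - b * c) * wedge f g ?n ?m"
    by (simp add: wedge_def eval[OF f ab] eval[OF g ab] eval[OF f cd] eval[OF g cd] algebra_simps)
  ultimately show thesis using that by blast
qed

text \<open>
  Both pairs are bases of the same lattice, so the two values differ by a factor \<open>\<plusminus>1\<close>.  The form
  evaluated on the two rays of \<open>\<rho>\<close> in either order is a positive multiple of one of the two
  values, so the sign is \<open>-1\<close>.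
\<close>

lemma wedge_cancel:
  assumes fan: "toric_fan \<Sigma>" and \<rho>: "\<rho> \<in> \<Sigma>"
    and \<tau>: "\<tau>\<^sub>1 \<in> between \<Sigma> \<sigma> \<rho>" "\<tau>\<^sub>2 \<in> between \<Sigma> \<sigma> \<rho>" "\<tau>\<^sub>1 \<noteq> \<tau>\<^sub>2"
    and f: "f \<in> dual UNIV" "\<And>x. x \<in> lq.span \<sigma> \<Longrightarrow> f x = 0"
    and g: "g \<in> dual UNIV" "\<And>x. x \<in> lq.span \<sigma> \<Longrightarrow> g x = 0"
  shows "wedge f g (normal_gen \<tau>\<^sub>1 \<sigma>) (normal_gen \<rho> \<tau>\<^sub>1)
    + wedge f g (normal_gen \<tau>\<^sub>2 \<sigma>) (normal_gen \<rho> \<tau>\<^sub>2) = 0"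
proof -
  define w\<^sub>1 where "w\<^sub>1 = wedge f g (normal_gen \<tau>\<^sub>1 \<sigma>) (normal_gen \<rho> \<tau>\<^sub>1)"
  define w\<^sub>2 where "w\<^sub>2 = wedge f g (normal_gen \<tau>\<^sub>2 \<sigma>) (normal_gen \<rho> \<tau>\<^sub>2)"
  define w where "w = wedge f g (normal_gen \<tau>\<^sub>1 \<sigma>) (normal_gen \<tau>\<^sub>2 \<sigma>)"
  have swap: "wedge f g (normal_gen \<tau>\<^sub>2 \<sigma>) (normal_gen \<tau>\<^sub>1 \<sigma>) = - w"
    by (simp add: wedge_def w_def)
  obtain b e :: int where be: "b > 0" "w = of_int b * w\<^sub>1" "w\<^sub>2 = of_int e * w\<^sub>1"
    using wedge_change_of_basis[OF fan \<rho> \<tau> f g] unfolding w\<^sub>1_def w\<^sub>2_def w_def by blast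
  obtain b' e' :: int where be': "b' > 0" "- w = of_int b' * w\<^sub>2" "w\<^sub>1 = of_int e' * w\<^sub>2"
    using wedge_change_of_basis[OF fan \<rho> \<tau>(2,1) \<tau>(3)[symmetric] f g]
    unfolding swap w\<^sub>1_def w\<^sub>2_def by blast
  have "w\<^sub>1 + w\<^sub>2 = 0"
  proof (cases "w\<^sub>1 = 0")
    case True
    then show ?thesis using be(3) by simp
  next
    case False
    have "of_int (e' * e) * w\<^sub>1 = of_int e' * (of_int e * w\<^sub>1)"
      by (simp only: of_int_mult mult.assoc)
    also have "\<dots> = w\<^sub>1"
      by (simp only: be(3)[symmetric] be'(3)[symmetric])
    finally have "of_int (e' * e) * w\<^sub>1 = w\<^sub>1" .
    then have "(of_int (e' * e) :: rat) = 1"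
      using False by (metis mult_cancel_right1)
    then have "e' * e = 1"
      by (simp only: of_int_eq_1_iff)
    then consider "e = 1" | "e = - 1"
      using zmult_eq_1_iff by blast
    then show ?thesis
    proof cases
      case 1
      \<comment> \<open>positivity of \<open>b\<close> and \<open>b'\<close> says that the two bases have opposite orientations\<close>
      have "(of_int b + of_int b') * w\<^sub>1 = 0"
        using be(2,3) be'(2) 1 by (simp add: algebra_simps)
      moreover have "(of_int b + of_int b' :: rat) > 0"
        using be(1) be'(1) by simp
      ultimately show ?thesis using False by simp
    next
      case 2
      then show ?thesis using be(3) by simp
    qed
  qed
  then show ?thesis by (simp add: w\<^sub>1_def w\<^sub>2_def)
qed

text \<open>
  The sum is empty or consists of the two terms that cancel.  This is the identity behind both the
  commutativity of the action and its compatibility with rational equivalence.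
\<close>

lemma sum_wedge_between:
  assumes fan: "toric_fan \<Sigma>" and \<sigma>: "\<sigma> \<in> \<Sigma>" and \<rho>: "\<rho> \<in> \<Sigma>"
    and f: "f \<in> dual UNIV" "\<And>x. x \<in> \<sigma> \<Longrightarrow> f x = 0"
    and g: "g \<in> dual UNIV" "\<And>x. x \<in> \<sigma> \<Longrightarrow> g x = 0"
  shows "(\<Sum>\<tau>\<in>between \<Sigma> \<sigma> \<rho>. wedge f g (normal_gen \<tau> \<sigma>) (normal_gen \<rho> \<tau>)) = 0"
proof (cases "between \<Sigma> \<sigma> \<rho> = {}")
  case False
  then obtain \<tau>\<^sub>1 \<tau>\<^sub>2 where \<tau>: "\<tau>\<^sub>1 \<in> between \<Sigma> \<sigma> \<rho>" "\<tau>\<^sub>2 \<in> between \<Sigma> \<sigma> \<rho>" "\<tau>\<^sub>1 \<noteq> \<tau>\<^sub>2"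
    using between_second[OF fan \<sigma> \<rho>] by blast
  then have "between \<Sigma> \<sigma> \<rho> = {\<tau>\<^sub>1, \<tau>\<^sub>2}"
    using between_at_most_two[OF fan \<rho> \<tau>] by blast
  then show ?thesis
    using \<tau>(3) wedge_cancel[OF fan \<rho> \<tau> f(1) functional_0_on_span[OF f] g(1) functional_0_on_span[OF g]]
    by simp
qed simp

lemma restr_add_scale: "restr L (\<lambda>x. f x + c * g x) = (\<lambda>x. restr L f x + c * restr L g x)"
  for c :: rat
  by (auto simp: restr_def)


section \<open>Divisors with polynomial coefficients\<close>

lemma DivI:
  assumes "\<And>\<sigma>. \<sigma> \<in> \<Sigma> \<Longrightarrow> d \<sigma> \<in> dual (lq.span \<sigma>)"
    "\<And>\<sigma> \<tau>. \<sigma> \<in> \<Sigma> \<Longrightarrow> \<tau> \<in> \<Sigma> \<Longrightarrow> \<sigma> \<subseteq> \<tau> \<Longrightarrow> restr (lq.span \<sigma>) (d \<tau>) = d \<sigma>"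
    "\<And>\<sigma>. \<sigma> \<notin> \<Sigma> \<Longrightarrow> d \<sigma> = (\<lambda>x. 0)"
  shows "d \<in> Div \<Sigma>"
  using assms by (simp add: Div_def)

lemma Div_dual: "d \<in> Div \<Sigma> \<Longrightarrow> \<sigma> \<in> \<Sigma> \<Longrightarrow> d \<sigma> \<in> dual (lq.span \<sigma>)"
  by (simp add: Div_def)

lemma Div_restr:
  "d \<in> Div \<Sigma> \<Longrightarrow> \<sigma> \<in> \<Sigma> \<Longrightarrow> \<tau> \<in> \<Sigma> \<Longrightarrow> \<sigma> \<subseteq> \<tau> \<Longrightarrow> restr (lq.span \<sigma>) (d \<tau>) = d \<sigma>"
  by (simp add: Div_def)

lemma Div_zero: "(\<lambda>\<sigma> x. 0) \<in> Div \<Sigma>"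
  by (simp add: Div_def dual_zero restr_def)

lemma Div_add_scale:
  assumes "d \<in> Div \<Sigma>" "e \<in> Div \<Sigma>"
  shows "(\<lambda>\<sigma> x. d \<sigma> x + c * e \<sigma> x) \<in> Div \<Sigma>"
proof (rule DivI)
  fix \<sigma> \<tau> assume "\<sigma> \<in> \<Sigma>" "\<tau> \<in> \<Sigma>" "\<sigma> \<subseteq> \<tau>"
  then have "restr (lq.span \<sigma>) (d \<tau>) = d \<sigma>" "restr (lq.span \<sigma>) (e \<tau>) = e \<sigma>"
    using assms by (simp_all add: Div_def)
  then show "restr (lq.span \<sigma>) (\<lambda>x. d \<tau> x + c * e \<tau> x) = (\<lambda>x. d \<sigma> x + c * e \<sigma> x)"
    by (simp add: restr_add_scale)
qed (use assms in \<open>auto simp: Div_def intro!: dual_add dual_scale\<close>)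

text \<open>
  Since an action is compatible with multiplication by \<open>p\<close> and with sums, properties that are linear
  in the divisor reduce to divisors with constant coefficients.
\<close>

lemma DivT_induct [consumes 1, case_names generator add]:
  assumes "D \<in> DivT \<Sigma>"
    and gen: "\<And>p d. p \<in> Lam \<Longrightarrow> d \<in> Div \<Sigma> \<Longrightarrow> P (\<lambda>\<sigma> x. p * div_const d \<sigma> x)"
    and add: "\<And>D E. D \<in> DivT \<Sigma> \<Longrightarrow> E \<in> DivT \<Sigma> \<Longrightarrow> P D \<Longrightarrow> P E \<Longrightarrow> P (\<lambda>\<sigma> x. D \<sigma> x + E \<sigma> x)"
  shows "P D"
proof -
  obtain n :: nat and p d where D: "D = (\<lambda>\<sigma> x. \<Sum>k<n. p k * const (d k \<sigma> x))"
    and pd: "\<forall>k<n. p k \<in> Lam \<and> d k \<in> Div \<Sigma>"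
    using assms(1) unfolding DivT_def by blast
  have mem: "(\<lambda>\<sigma> x. \<Sum>k<i. p k * const (d k \<sigma> x)) \<in> DivT \<Sigma>" if "i \<le> n" for i
    unfolding DivT_def using pd that
    by (intro CollectI exI[of _ i] exI[of _ p] exI[of _ d]) auto
  have single: "(\<lambda>\<sigma> x. p k * const (d k \<sigma> x)) \<in> DivT \<Sigma>" if "k < n" for k
    unfolding DivT_def using pd that
    by (intro CollectI exI[of _ "1::nat"] exI[of _ "\<lambda>_. p k"] exI[of _ "\<lambda>_. d k"]) auto
  have "P (\<lambda>\<sigma> x. \<Sum>k<i. p k * const (d k \<sigma> x))" if "i \<le> n" for i
    using that
  proof (induction i)
    case 0
    show ?case using gen[OF Lam_0 Div_zero] by simp
  next
    case (Suc i)
    then have "P (\<lambda>\<sigma> x. (\<Sum>k<i. p k * const (d k \<sigma> x)) + p i * const (d i \<sigma> x))"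
      using gen[of "p i" "d i"] pd by (intro add mem single) (simp_all add: div_const_def)
    then show ?case by simp
  qed
  then show ?thesis using D by simp
qed

lemma div_const_in_DivT: "d \<in> Div \<Sigma> \<Longrightarrow> div_const d \<in> DivT \<Sigma>"
  unfolding DivT_def div_const_def
  by (intro CollectI exI[of _ "1::nat"] exI[of _ "\<lambda>_. const 1"] exI[of _ "\<lambda>_. d"]) auto

lemma DivT_smul: "p \<in> Lam \<Longrightarrow> d \<in> Div \<Sigma> \<Longrightarrow> (\<lambda>\<sigma> x. p * div_const d \<sigma> x) \<in> DivT \<Sigma>"
  unfolding DivT_def div_const_def
  by (intro CollectI exI[of _ "1::nat"] exI[of _ "\<lambda>_. p"] exI[of _ "\<lambda>_. d"]) auto

lemma DivT_add:
  assumes D: "D \<in> DivT \<Sigma>" and E: "E \<in> DivT \<Sigma>"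
  shows "(\<lambda>\<sigma> x. D \<sigma> x + E \<sigma> x) \<in> DivT \<Sigma>"
  using E D
proof (induction arbitrary: D rule: DivT_induct)
  case (generator p d)
  obtain n :: nat and q e where D: "D = (\<lambda>\<sigma> x. \<Sum>k<n. q k * const (e k \<sigma> x))"
    and qe: "\<forall>k<n. q k \<in> Lam \<and> e k \<in> Div \<Sigma>"
    using generator(3) unfolding DivT_def by blast
  have "(\<lambda>\<sigma> x. D \<sigma> x + p * div_const d \<sigma> x)
    = (\<lambda>\<sigma> x. \<Sum>k<Suc n. (q(n := p)) k * const ((e(n := d)) k \<sigma> x))"
    by (simp add: D div_const_def)
  moreover have "\<forall>k<Suc n. (q(n := p)) k \<in> Lam \<and> (e(n := d)) k \<in> Div \<Sigma>"
    using qe generator(1,2) by (auto simp: less_Suc_eq)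
  ultimately show ?case
    unfolding DivT_def by blast
next
  case (add E E')
  then show ?case by (simp flip: add.assoc)
qed

lemma DivT_mult:
  assumes p: "p \<in> Lam" and D: "D \<in> DivT \<Sigma>"
  shows "(\<lambda>\<sigma> x. p * D \<sigma> x) \<in> DivT \<Sigma>"
  using D
proof (induction rule: DivT_induct)
  case (generator q d)
  then show ?case
    using DivT_smul[of "p * q"] p by (simp add: Lam_mult mult.assoc)
next
  case (add D E)
  then show ?case
    using DivT_add by (simp add: distrib_left)
qed

lemma DivT_Lam: "D \<in> DivT \<Sigma> \<Longrightarrow> D \<sigma> x \<in> Lam"
  by (induction rule: DivT_induct) (auto simp: div_const_def intro: Lam_mult Lam_add)

lemma phi_div_in_Div: "D \<in> DivT \<Sigma> \<Longrightarrow> phi_div D \<in> Div \<Sigma>"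
proof (induction rule: DivT_induct)
  case (generator p d)
  then show ?case
    using Div_add_scale[OF Div_zero, of d \<Sigma> "augmentation p"]
    by (simp add: phi_div_def div_const_def augmentation_mult)
next
  case (add D E)
  then show ?case
    using Div_add_scale[of "phi_div D" \<Sigma> "phi_div E" 1]
    by (simp add: phi_div_def augmentation_add)
qed

definition facets :: "'v::lattice_space set set \<Rightarrow> 'v set \<Rightarrow> 'v set set" where
  "facets \<Sigma> \<rho> = {\<sigma> \<in> \<Sigma>. facet \<sigma> \<rho>}"

text \<open>
  This rearranges a double application of the action, so that the coefficient of a fixed
  cycle becomes a sum over the cones between \<open>\<sigma>\<close> and \<open>\<rho>\<close>.
\<close>

lemma sum_facets_facets:
  assumes "finite \<Sigma>"
  shows "(\<Sum>\<tau>\<in>facets \<Sigma> \<rho>. \<Sum>\<sigma>\<in>facets \<Sigma> \<tau>. F \<tau> \<sigma>) = (\<Sum>\<sigma>\<in>\<Sigma>. \<Sum>\<tau>\<in>between \<Sigma> \<sigma> \<rho>. F \<tau> \<sigma>)"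
proof -
  have "(\<Sum>\<tau>\<in>facets \<Sigma> \<rho>. \<Sum>\<sigma>\<in>facets \<Sigma> \<tau>. F \<tau> \<sigma>)
      = (\<Sum>\<sigma>\<in>\<Sigma>. \<Sum>\<tau> | \<tau> \<in> facets \<Sigma> \<rho> \<and> facet \<sigma> \<tau>. F \<tau> \<sigma>)"
    using sum.swap_restrict[of "facets \<Sigma> \<rho>" \<Sigma> F "\<lambda>\<tau> \<sigma>. facet \<sigma> \<tau>"] assms
    by (simp add: facets_def)
  also have "\<dots> = (\<Sum>\<sigma>\<in>\<Sigma>. \<Sum>\<tau>\<in>between \<Sigma> \<sigma> \<rho>. F \<tau> \<sigma>)"
    by (intro sum.cong) (auto simp: facets_def between_def)
  finally show ?thesis .
qed


section \<open>Lifted local equations\<close>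

locale generic_fan =
  fixes \<Sigma> :: "'v::lattice_space set set"
    and \<L> :: "'v set set"
    and \<Psi> :: "'v set \<Rightarrow> 'v set \<Rightarrow> ('v \<Rightarrow> rat) \<Rightarrow> 'v \<Rightarrow> rat"
  assumes fan: "toric_fan \<Sigma>"
    and complement: "complement_map \<L> \<Psi>"
    and generic: "psi_generic \<L> \<Sigma>"
begin

lemma finite_fan: "finite \<Sigma>"
  using fan by (simp add: toric_fan_def)

lemma finite_facets: "finite (facets \<Sigma> \<rho>)"
  using finite_fan by (simp add: facets_def)

lemma finite_star: "finite (star \<Sigma> \<rho>)"
  using finite_fan by (simp add: star_def)

lemma span_in_L: "\<sigma> \<in> \<Sigma> \<Longrightarrow> lq.span \<sigma> \<in> \<L>"
  using generic by (simp add: psi_generic_def)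

lemma UNIV_in_L: "UNIV \<in> \<L>"
  using complement by (simp add: complement_map_def)

context
  fixes L\<^sub>1 L\<^sub>2
  assumes L: "L\<^sub>1 \<in> \<L>" "L\<^sub>2 \<in> \<L>" "L\<^sub>1 \<subseteq> L\<^sub>2"
begin

private lemmas section_props =
  complement[unfolded complement_map_def, THEN conjunct2, THEN conjunct2, THEN conjunct1,
    rule_format, OF L]

lemma section_dual: "f \<in> dual L\<^sub>1 \<Longrightarrow> \<Psi> L\<^sub>1 L\<^sub>2 f \<in> dual L\<^sub>2"
  and section_restr: "f \<in> dual L\<^sub>1 \<Longrightarrow> restr L\<^sub>1 (\<Psi> L\<^sub>1 L\<^sub>2 f) = f"
  using section_props by simp_all

lemma section_add: "f \<in> dual L\<^sub>1 \<Longrightarrow> g \<in> dual L\<^sub>1 \<Longrightarrow>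
    \<Psi> L\<^sub>1 L\<^sub>2 (\<lambda>x. f x + g x) = (\<lambda>x. \<Psi> L\<^sub>1 L\<^sub>2 f x + \<Psi> L\<^sub>1 L\<^sub>2 g x)"
  using section_props by simp

lemma section_scale: "f \<in> dual L\<^sub>1 \<Longrightarrow> \<Psi> L\<^sub>1 L\<^sub>2 (\<lambda>x. c * f x) = (\<lambda>x. c * \<Psi> L\<^sub>1 L\<^sub>2 f x)"
  using section_props by simp

lemma section_trans: "L\<^sub>3 \<in> \<L> \<Longrightarrow> L\<^sub>2 \<subseteq> L\<^sub>3 \<Longrightarrow> f \<in> dual L\<^sub>1 \<Longrightarrow>
    \<Psi> L\<^sub>1 L\<^sub>3 f = \<Psi> L\<^sub>2 L\<^sub>3 (\<Psi> L\<^sub>1 L\<^sub>2 f)"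
  using complement[unfolded complement_map_def, THEN conjunct2, THEN conjunct2, THEN conjunct2,
    rule_format, OF L(1,2) _ L(3)] .

end

text \<open>
  The map \<open>f \<mapsto> f\<^sup>\<Psi>\<close> from functionals on \<open>span \<sigma>\<close> to functionals on the whole space.
\<close>

definition psi :: "'v set \<Rightarrow> ('v \<Rightarrow> rat) \<Rightarrow> 'v \<Rightarrow> rat" where
  "psi \<sigma> f = \<Psi> (lq.span \<sigma>) UNIV f"

lemma psi_functional: "\<sigma> \<in> \<Sigma> \<Longrightarrow> f \<in> dual (lq.span \<sigma>) \<Longrightarrow> psi \<sigma> f \<in> dual UNIV"
  unfolding psi_def by (rule section_dual) (simp_all add: span_in_L UNIV_in_L)

lemma psi_on_span:
  assumes "\<sigma> \<in> \<Sigma>" "f \<in> dual (lq.span \<sigma>)" "x \<in> lq.span \<sigma>"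
  shows "psi \<sigma> f x = f x"
proof -
  have "restr (lq.span \<sigma>) (psi \<sigma> f) = f"
    unfolding psi_def by (rule section_restr) (simp_all add: span_in_L UNIV_in_L assms)
  then have "restr (lq.span \<sigma>) (psi \<sigma> f) x = f x"
    by (rule fun_cong)
  then show ?thesis
    using assms(3) by (simp add: restr_def)
qed

lemma psi_add:
  "\<sigma> \<in> \<Sigma> \<Longrightarrow> f \<in> dual (lq.span \<sigma>) \<Longrightarrow> g \<in> dual (lq.span \<sigma>) \<Longrightarrow>
    psi \<sigma> (\<lambda>x. f x + g x) = (\<lambda>x. psi \<sigma> f x + psi \<sigma> g x)"
  unfolding psi_def by (rule section_add) (simp_all add: span_in_L UNIV_in_L)

lemma psi_scale:
  "\<sigma> \<in> \<Sigma> \<Longrightarrow> f \<in> dual (lq.span \<sigma>) \<Longrightarrow> psi \<sigma> (\<lambda>x. c * f x) = (\<lambda>x. c * psi \<sigma> f x)"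
  unfolding psi_def by (rule section_scale) (simp_all add: span_in_L UNIV_in_L)

lemma psi_diff:
  assumes "\<sigma> \<in> \<Sigma>" "f \<in> dual (lq.span \<sigma>)" "g \<in> dual (lq.span \<sigma>)"
  shows "psi \<sigma> (\<lambda>x. f x - g x) = (\<lambda>x. psi \<sigma> f x - psi \<sigma> g x)"
  using psi_add[OF assms(1,2) dual_scale[OF assms(3), of "-1"]] psi_scale[OF assms(1,3), of "-1"]
  by simp

lemma psi_sum:
  assumes \<sigma>: "\<sigma> \<in> \<Sigma>" and f: "\<And>a. f a \<in> dual (lq.span \<sigma>)"
  shows "psi \<sigma> (\<lambda>x. \<Sum>a\<in>A. c a * f a x) = (\<lambda>x. \<Sum>a\<in>A. c a * psi \<sigma> (f a) x)"
proof (induction A rule: infinite_finite_induct)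
  case (infinite A)
  then show ?case using psi_scale[OF \<sigma> dual_zero, of 0] by simp
next
  case empty
  then show ?case using psi_scale[OF \<sigma> dual_zero, of 0] by simp
next
  case (insert a A)
  then show ?case
    using psi_add[OF \<sigma> dual_scale[OF f, of "c a" a] dual_sum[of A f, OF f]]
    by (simp add: psi_scale[OF \<sigma> f])
qed

lemma psi_expansion:
  assumes "\<sigma> \<in> \<Sigma>" "f \<in> dual (lq.span \<sigma>)"
  shows "psi \<sigma> f x = (\<Sum>b\<in>span_basis \<sigma>. f b * psi \<sigma> (coordinate \<sigma> b) x)"
proof -
  have "psi \<sigma> f = psi \<sigma> (\<lambda>x. \<Sum>b\<in>span_basis \<sigma>. f b * coordinate \<sigma> b x)"
    by (rule arg_cong[OF dual_expansion[OF assms(2)]])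
  also have "\<dots> = (\<lambda>x. \<Sum>b\<in>span_basis \<sigma>. f b * psi \<sigma> (coordinate \<sigma> b) x)"
    by (rule psi_sum[OF assms(1) coordinate_in_dual])
  finally show ?thesis by (rule fun_cong)
qed

text \<open>
  \<open>lift d \<sigma>\<close> is \<open>d\<^sub>\<sigma>\<^sup>\<Psi>\<close>, and \<open>slope d \<tau> \<sigma>\<close> is the coefficient of \<open>V\<^sub>\<tau>\<close> in \<open>D \<cdot> V\<^sub>\<sigma>\<close>.
\<close>

definition lift :: "('v set \<Rightarrow> 'v \<Rightarrow> rat) \<Rightarrow> 'v set \<Rightarrow> 'v \<Rightarrow> rat" where
  "lift d \<sigma> = psi \<sigma> (d \<sigma>)"

definition slope :: "('v set \<Rightarrow> 'v \<Rightarrow> rat) \<Rightarrow> 'v set \<Rightarrow> 'v set \<Rightarrow> rat" where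
  "slope d \<tau> \<sigma> = d \<tau> (normal_gen \<tau> \<sigma>) - lift d \<sigma> (normal_gen \<tau> \<sigma>)"

lemma lift_functional: "d \<in> Div \<Sigma> \<Longrightarrow> \<sigma> \<in> \<Sigma> \<Longrightarrow> lift d \<sigma> \<in> dual UNIV"
  by (simp add: lift_def psi_functional Div_dual)

lemma lift_on_span: "d \<in> Div \<Sigma> \<Longrightarrow> \<sigma> \<in> \<Sigma> \<Longrightarrow> x \<in> lq.span \<sigma> \<Longrightarrow> lift d \<sigma> x = d \<sigma> x"
  by (simp add: lift_def psi_on_span Div_dual)

lemma lift_agree:
  assumes "d \<in> Div \<Sigma>" "\<sigma> \<in> \<Sigma>" "\<tau> \<in> \<Sigma>" "\<sigma> \<subseteq> \<tau>" "x \<in> lq.span \<sigma>"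
  shows "lift d \<tau> x = lift d \<sigma> x"
proof -
  have "x \<in> lq.span \<tau>"
    using assms(4,5) lq.span_mono by blast
  then have "lift d \<tau> x = restr (lq.span \<sigma>) (d \<tau>) x"
    using assms by (simp add: lift_on_span restr_def)
  then show ?thesis
    using assms by (simp add: Div_restr lift_on_span)
qed

lemma slope_eq:
  "d \<in> Div \<Sigma> \<Longrightarrow> \<tau> \<in> \<Sigma> \<Longrightarrow> facet \<sigma> \<tau> \<Longrightarrow>
    slope d \<tau> \<sigma> = lift d \<tau> (normal_gen \<tau> \<sigma>) - lift d \<sigma> (normal_gen \<tau> \<sigma>)"
  by (simp add: slope_def lift_on_span normal_gen_facts[OF fan])

text \<open>
  This is the place where transitivity of \<open>\<Psi>\<close> enters: lifting \<open>d\<^sub>\<sigma>\<close> through \<open>span \<tau>\<close> shows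
  that the difference of the two lifts is itself the lift of a functional on \<open>span \<tau>\<close>.
\<close>

lemma lift_diff_conv_psi:
  assumes d: "d \<in> Div \<Sigma>" and \<sigma>: "\<sigma> \<in> \<Sigma>" and \<tau>: "\<tau> \<in> \<Sigma>" and sub: "\<sigma> \<subseteq> \<tau>"
  defines "k \<equiv> (\<lambda>x. d \<tau> x - \<Psi> (lq.span \<sigma>) (lq.span \<tau>) (d \<sigma>) x)"
  shows "k \<in> dual (lq.span \<tau>)" "psi \<tau> k = (\<lambda>x. lift d \<tau> x - lift d \<sigma> x)"
proof -
  have span: "lq.span \<sigma> \<subseteq> lq.span \<tau>"
    using sub by (rule lq.span_mono)
  have \<Psi>: "\<Psi> (lq.span \<sigma>) (lq.span \<tau>) (d \<sigma>) \<in> dual (lq.span \<tau>)"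
    using section_dual[OF span_in_L[OF \<sigma>] span_in_L[OF \<tau>] span Div_dual[OF d \<sigma>]] .
  show "k \<in> dual (lq.span \<tau>)"
    unfolding k_def by (intro dual_diff Div_dual[OF d \<tau>] \<Psi>)
  have "lift d \<sigma> = psi \<tau> (\<Psi> (lq.span \<sigma>) (lq.span \<tau>) (d \<sigma>))"
    unfolding lift_def psi_def
    by (rule section_trans) (simp_all add: span_in_L UNIV_in_L \<sigma> \<tau> span Div_dual[OF d \<sigma>])
  then show "psi \<tau> k = (\<lambda>x. lift d \<tau> x - lift d \<sigma> x)"
    unfolding k_def using psi_diff[OF \<tau> Div_dual[OF d \<tau>] \<Psi>] by (simp add: lift_def)
qed

text \<open>
  By the preceding lemma both differences are lifts of functionals on \<open>span \<tau>\<close> that vanish on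
  \<open>span \<sigma>\<close>.  Such functionals form a line on which evaluation at \<open>n\<^bsub>\<tau>,\<sigma>\<^esub>\<close> is a coordinate, and this
  evaluation gives the slope.
\<close>

lemma lift_diff_proportional:
  assumes d: "d \<in> Div \<Sigma>" and e: "e \<in> Div \<Sigma>" and \<sigma>: "\<sigma> \<in> \<Sigma>" and \<tau>: "\<tau> \<in> \<Sigma>"
    and fac: "facet \<sigma> \<tau>"
  shows "slope d \<tau> \<sigma> * (lift e \<tau> x - lift e \<sigma> x) = slope e \<tau> \<sigma> * (lift d \<tau> x - lift d \<sigma> x)"
proof -
  note sub = facet_subset[OF fac]
  define n where "n = normal_gen \<tau> \<sigma>"
  define k where "k c = (\<lambda>x. c \<tau> x - \<Psi> (lq.span \<sigma>) (lq.span \<tau>) (c \<sigma>) x)"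
    for c :: "'v set \<Rightarrow> 'v \<Rightarrow> rat"
  have k: "k c \<in> dual (lq.span \<tau>)" "psi \<tau> (k c) = (\<lambda>x. lift c \<tau> x - lift c \<sigma> x)"
    if "c \<in> Div \<Sigma>" for c
    unfolding k_def by (intro lift_diff_conv_psi that \<sigma> \<tau> sub)+
  have n: "n \<in> lq.span \<tau>" "n \<notin> lq.span \<sigma>"
    unfolding n_def using normal_gen_facts[OF fan \<tau> fac] by auto
  have kx: "k c x = lift c \<tau> x - lift c \<sigma> x" if "c \<in> Div \<Sigma>" "x \<in> lq.span \<tau>" for c x
    using psi_on_span[OF \<tau> k(1)[OF that(1)] that(2)] k(2)[OF that(1)] by simp
  have multiple: "k c x = q * k c n" if c: "c \<in> Div \<Sigma>" and x: "x \<in> lq.span \<tau>" "x - q *Q n \<in> lq.span \<sigma>"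
    for c q x
  proof -
    have "lift c \<tau> (x - q *Q n) = lift c \<sigma> (x - q *Q n)"
      by (rule lift_agree[OF c \<sigma> \<tau> sub x(2)])
    then show ?thesis
      using lift_functional[OF c] \<sigma> \<tau>
      by (simp add: kx c x n functional_diff functional_scale algebra_simps)
  qed
  have "(\<lambda>x. k d n * k e x) = (\<lambda>x. k e n * k d x)"
  proof
    fix x
    show "k d n * k e x = k e n * k d x"
    proof (cases "x \<in> lq.span \<tau>")
      case True
      then obtain q where q: "x - q *Q n \<in> lq.span \<sigma>"
        using facet_complement[OF fac n] by blast
      show ?thesis
        using multiple[OF d True q] multiple[OF e True q] by simp
    next
      case False
      then show ?thesis
        using dual_outside[OF k(1)[OF d]] dual_outside[OF k(1)[OF e]] by simp
    qed
  qed
  then have "psi \<tau> (\<lambda>x. k d n * k e x) x = psi \<tau> (\<lambda>x. k e n * k d x) x"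
    by simp
  then show ?thesis
    using kx[OF d n(1)] kx[OF e n(1)] slope_eq[OF d \<tau> fac] slope_eq[OF e \<tau> fac]
    by (simp add: psi_scale[OF \<tau> k(1)[OF d]] psi_scale[OF \<tau> k(1)[OF e]] k(2) d e n_def)
qed

text \<open>
  The vanishing of the sum of \<open>f \<and> g\<close> for \<open>f = d\<^sub>\<rho>\<^sup>\<Psi> - d\<^sub>\<sigma>\<^sup>\<Psi>\<close>, rewritten in terms of slopes: \<open>f\<close> has the value
  \<open>slope d \<tau> \<sigma>\<close> at \<open>n\<^bsub>\<tau>,\<sigma>\<^esub>\<close>, while at \<open>n\<^bsub>\<rho>,\<tau>\<^esub>\<close> it differs from \<open>slope d \<rho> \<tau>\<close> by the value of
  \<open>d\<^sub>\<tau>\<^sup>\<Psi> - d\<^sub>\<sigma>\<^sup>\<Psi>\<close>.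
\<close>

lemma sum_slope_functional:
  assumes d: "d \<in> Div \<Sigma>" and \<sigma>: "\<sigma> \<in> \<Sigma>" and \<rho>: "\<rho> \<in> \<Sigma>"
    and g: "g \<in> dual UNIV" "\<And>x. x \<in> \<sigma> \<Longrightarrow> g x = 0"
  shows "(\<Sum>\<tau>\<in>between \<Sigma> \<sigma> \<rho>. slope d \<rho> \<tau> * g (normal_gen \<tau> \<sigma>))
    = (\<Sum>\<tau>\<in>between \<Sigma> \<sigma> \<rho>. slope d \<tau> \<sigma> * g (normal_gen \<rho> \<tau>)
        - g (normal_gen \<tau> \<sigma>) * (lift d \<tau> (normal_gen \<rho> \<tau>) - lift d \<sigma> (normal_gen \<rho> \<tau>)))"
proof (cases "between \<Sigma> \<sigma> \<rho> = {}")
  case False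
  then have sub: "\<sigma> \<subseteq> \<rho>"
    by (auto simp: between_def dest!: facet_subset)
  define f where "f = (\<lambda>x. lift d \<rho> x - lift d \<sigma> x)"
  have f: "f \<in> dual UNIV"
    unfolding f_def by (intro dual_diff lift_functional d \<sigma> \<rho>)
  have f0: "f x = 0" if "x \<in> \<sigma>" for x
    unfolding f_def using lift_agree[OF d \<sigma> \<rho> sub lq.span_base[OF that]] by simp
  have "slope d \<rho> \<tau> * g (normal_gen \<tau> \<sigma>)
      = (slope d \<tau> \<sigma> * g (normal_gen \<rho> \<tau>)
        - g (normal_gen \<tau> \<sigma>) * (lift d \<tau> (normal_gen \<rho> \<tau>) - lift d \<sigma> (normal_gen \<rho> \<tau>)))
        - wedge f g (normal_gen \<tau> \<sigma>) (normal_gen \<rho> \<tau>)" if "\<tau> \<in> between \<Sigma> \<sigma> \<rho>" for \<tau>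
  proof -
    have \<tau>: "\<tau> \<in> \<Sigma>" "facet \<sigma> \<tau>" "facet \<tau> \<rho>"
      using that by (auto simp: between_def)
    have "f (normal_gen \<tau> \<sigma>) = slope d \<tau> \<sigma>"
      unfolding f_def slope_eq[OF d \<tau>(1,2)]
      using lift_agree[OF d \<tau>(1) \<rho> facet_subset[OF \<tau>(3)] normal_gen_facts(3)[OF fan \<tau>(1,2)]] by simp
    then show ?thesis
      unfolding wedge_def by (simp add: slope_eq[OF d \<rho> \<tau>(3)] f_def algebra_simps)
  qed
  then show ?thesis
    using sum_wedge_between[OF fan \<sigma> \<rho> f f0 g] by (simp add: sum_subtractf)
qed simp

text \<open>
  The case \<open>g = e\<^sub>\<rho>\<^sup>\<Psi> - e\<^sub>\<sigma>\<^sup>\<Psi>\<close> of the preceding lemma.  The correction terms for \<open>d\<close> and \<open>e\<close> agree because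
  the differences of lifts are proportional.
\<close>

lemma sum_slope_slope:
  assumes d: "d \<in> Div \<Sigma>" and e: "e \<in> Div \<Sigma>" and \<sigma>: "\<sigma> \<in> \<Sigma>" and \<rho>: "\<rho> \<in> \<Sigma>"
  shows "(\<Sum>\<tau>\<in>between \<Sigma> \<sigma> \<rho>. slope d \<rho> \<tau> * slope e \<tau> \<sigma>)
    = (\<Sum>\<tau>\<in>between \<Sigma> \<sigma> \<rho>. slope e \<rho> \<tau> * slope d \<tau> \<sigma>)"
proof (cases "between \<Sigma> \<sigma> \<rho> = {}")
  case False
  then have sub: "\<sigma> \<subseteq> \<rho>"
    by (auto simp: between_def dest!: facet_subset)
  define g where "g = (\<lambda>x. lift e \<rho> x - lift e \<sigma> x)"
  have g: "g \<in> dual UNIV"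
    unfolding g_def by (intro dual_diff lift_functional e \<sigma> \<rho>)
  have g0: "g x = 0" if "x \<in> \<sigma>" for x
    unfolding g_def using lift_agree[OF e \<sigma> \<rho> sub lq.span_base[OF that]] by simp
  have gn: "g (normal_gen \<tau> \<sigma>) = slope e \<tau> \<sigma>"
    and summand: "slope d \<tau> \<sigma> * g (normal_gen \<rho> \<tau>)
        - g (normal_gen \<tau> \<sigma>) * (lift d \<tau> (normal_gen \<rho> \<tau>) - lift d \<sigma> (normal_gen \<rho> \<tau>))
      = slope e \<rho> \<tau> * slope d \<tau> \<sigma>"
    if "\<tau> \<in> between \<Sigma> \<sigma> \<rho>" for \<tau>
  proof -
    have \<tau>: "\<tau> \<in> \<Sigma>" "facet \<sigma> \<tau>" "facet \<tau> \<rho>"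
      using that by (auto simp: between_def)
    show gn: "g (normal_gen \<tau> \<sigma>) = slope e \<tau> \<sigma>"
      unfolding g_def slope_eq[OF e \<tau>(1,2)]
      using lift_agree[OF e \<tau>(1) \<rho> facet_subset[OF \<tau>(3)] normal_gen_facts(3)[OF fan \<tau>(1,2)]] by simp
    have "g (normal_gen \<rho> \<tau>)
        = slope e \<rho> \<tau> + (lift e \<tau> (normal_gen \<rho> \<tau>) - lift e \<sigma> (normal_gen \<rho> \<tau>))"
      unfolding g_def slope_eq[OF e \<rho> \<tau>(3)] by simp
    then show "slope d \<tau> \<sigma> * g (normal_gen \<rho> \<tau>)
        - g (normal_gen \<tau> \<sigma>) * (lift d \<tau> (normal_gen \<rho> \<tau>) - lift d \<sigma> (normal_gen \<rho> \<tau>))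
      = slope e \<rho> \<tau> * slope d \<tau> \<sigma>"
      using lift_diff_proportional[OF d e \<sigma> \<tau>(1,2), of "normal_gen \<rho> \<tau>"]
      unfolding gn by (simp only: distrib_left) (simp add: mult.commute)
  qed
  have "(\<Sum>\<tau>\<in>between \<Sigma> \<sigma> \<rho>. slope d \<rho> \<tau> * slope e \<tau> \<sigma>)
      = (\<Sum>\<tau>\<in>between \<Sigma> \<sigma> \<rho>. slope d \<rho> \<tau> * g (normal_gen \<tau> \<sigma>))"
    by (rule sum.cong) (simp_all add: gn)
  also note sum_slope_functional[OF d \<sigma> \<rho> g g0]
  also have "(\<Sum>\<tau>\<in>between \<Sigma> \<sigma> \<rho>. slope d \<tau> \<sigma> * g (normal_gen \<rho> \<tau>)
        - g (normal_gen \<tau> \<sigma>) * (lift d \<tau> (normal_gen \<rho> \<tau>) - lift d \<sigma> (normal_gen \<rho> \<tau>)))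
      = (\<Sum>\<tau>\<in>between \<Sigma> \<sigma> \<rho>. slope e \<rho> \<tau> * slope d \<tau> \<sigma>)"
    by (rule sum.cong[OF refl summand])
  finally show ?thesis .
qed simp

end


section \<open>Cycles and bilinear actions\<close>

lemma sum_orbit_cycle:
  fixes c :: "'v set \<Rightarrow> 'r::comm_semiring_1"
  assumes "finite A"
  shows "(\<Sum>\<tau>\<in>A. c \<tau> * orbit_cycle \<tau> \<rho>) = (if \<rho> \<in> A then c \<rho> else 0)"
    and "(\<Sum>\<tau>\<in>A. c \<tau> * orbit_cycle \<rho> \<tau>) = (if \<rho> \<in> A then c \<rho> else 0)"
proof -
  have "(\<Sum>\<tau>\<in>A. c \<tau> * orbit_cycle \<tau> \<rho>) = (\<Sum>\<tau>\<in>A. if \<tau> = \<rho> then c \<tau> else 0)"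
    by (rule sum.cong) (auto simp: orbit_cycle_def)
  then show "(\<Sum>\<tau>\<in>A. c \<tau> * orbit_cycle \<tau> \<rho>) = (if \<rho> \<in> A then c \<rho> else 0)"
    using assms by simp
  have "(\<Sum>\<tau>\<in>A. c \<tau> * orbit_cycle \<rho> \<tau>) = (\<Sum>\<tau>\<in>A. if \<tau> = \<rho> then c \<tau> else 0)"
    by (rule sum.cong) (auto simp: orbit_cycle_def)
  then show "(\<Sum>\<tau>\<in>A. c \<tau> * orbit_cycle \<rho> \<tau>) = (if \<rho> \<in> A then c \<rho> else 0)"
    using assms by simp
qed

lemma ZT_Lam: "C \<in> ZT \<Sigma> \<Longrightarrow> C \<sigma> \<in> Lam"
  and ZT_outside: "C \<in> ZT \<Sigma> \<Longrightarrow> \<sigma> \<notin> \<Sigma> \<Longrightarrow> C \<sigma> = 0"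
  by (simp_all add: ZT_def)

lemma ZT_zero: "(\<lambda>_. 0) \<in> ZT \<Sigma>"
  by (simp add: ZT_def)

lemma ZT_orbit_cycle: "\<sigma> \<in> \<Sigma> \<Longrightarrow> orbit_cycle \<sigma> \<in> ZT \<Sigma>"
  by (auto simp: ZT_def orbit_cycle_def)

lemma ZT_cyc_add: "C \<in> ZT \<Sigma> \<Longrightarrow> C' \<in> ZT \<Sigma> \<Longrightarrow> cyc_add C C' \<in> ZT \<Sigma>"
  by (simp add: ZT_def cyc_add_def Lam_add)

lemma ZT_cyc_smul: "p \<in> Lam \<Longrightarrow> C \<in> ZT \<Sigma> \<Longrightarrow> cyc_smul p C \<in> ZT \<Sigma>"
  by (simp add: ZT_def cyc_smul_def Lam_mult)

lemma ZT_induct [consumes 2, case_names zero generator add]: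
  assumes "finite \<Sigma>" "C \<in> ZT \<Sigma>"
    and zero: "P (\<lambda>_. 0)"
    and gen: "\<And>p \<sigma>. p \<in> Lam \<Longrightarrow> \<sigma> \<in> \<Sigma> \<Longrightarrow> P (cyc_smul p (orbit_cycle \<sigma>))"
    and add: "\<And>C C'. C \<in> ZT \<Sigma> \<Longrightarrow> C' \<in> ZT \<Sigma> \<Longrightarrow> P C \<Longrightarrow> P C' \<Longrightarrow> P (cyc_add C C')"
  shows "P C"
proof -
  have "(\<lambda>\<rho>. if \<rho> \<in> S then C \<rho> else 0) \<in> ZT \<Sigma> \<and> P (\<lambda>\<rho>. if \<rho> \<in> S then C \<rho> else 0)"
    if "finite S" "S \<subseteq> \<Sigma>" for S
    using that
  proof (induction S rule: finite_induct)
    case empty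
    then show ?case using zero ZT_zero by simp
  next
    case (insert \<sigma> S)
    have eq: "(\<lambda>\<rho>. if \<rho> \<in> insert \<sigma> S then C \<rho> else 0)
      = cyc_add (\<lambda>\<rho>. if \<rho> \<in> S then C \<rho> else 0) (cyc_smul (C \<sigma>) (orbit_cycle \<sigma>))"
      using insert.hyps by (auto simp: cyc_add_def cyc_smul_def orbit_cycle_def)
    have "cyc_smul (C \<sigma>) (orbit_cycle \<sigma>) \<in> ZT \<Sigma>" "P (cyc_smul (C \<sigma>) (orbit_cycle \<sigma>))"
      using insert.prems ZT_Lam[OF assms(2)] by (auto intro: ZT_cyc_smul ZT_orbit_cycle gen)
    then show ?case
      unfolding eq using insert.IH insert.prems by (auto intro!: ZT_cyc_add add)
  qed
  from this[OF assms(1) subset_refl]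
  have "P (\<lambda>\<rho>. if \<rho> \<in> \<Sigma> then C \<rho> else 0)" by blast
  moreover have "(\<lambda>\<rho>. if \<rho> \<in> \<Sigma> then C \<rho> else 0) = C"
    using ZT_outside[OF assms(2)] by auto
  ultimately show ?thesis by simp
qed

text \<open>
  A homomorphism from cycles to a second module that intertwines two actions on the generators
  intertwines them everywhere.  For the identity this is uniqueness of the action, for the
  projection to the Chow group it is the lifting property.  The second module has no explicit
  zero; \<open>vanish\<close> identifies it.
\<close>

lemma bilinear_action_hom:
  assumes fin: "finite \<Sigma>"
    and act: "bilinear_action \<Sigma> (ZT \<Sigma>) cyc_add cyc_smul act"
    and act': "bilinear_action \<Sigma> A add smul act'"
    and h: "\<And>C. C \<in> ZT \<Sigma> \<Longrightarrow> h C \<in> A"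
      "\<And>C C'. C \<in> ZT \<Sigma> \<Longrightarrow> C' \<in> ZT \<Sigma> \<Longrightarrow> h (cyc_add C C') = add (h C) (h C')"
      "\<And>p C. p \<in> Lam \<Longrightarrow> C \<in> ZT \<Sigma> \<Longrightarrow> h (cyc_smul p C) = smul p (h C)"
    and vanish: "\<And>a. a \<in> A \<Longrightarrow> smul 0 a = h (\<lambda>_. 0)"
    and agree: "\<And>d \<sigma>. d \<in> Div \<Sigma> \<Longrightarrow> \<sigma> \<in> \<Sigma> \<Longrightarrow>
      h (act (div_const d) (orbit_cycle \<sigma>)) = act' (div_const d) (h (orbit_cycle \<sigma>))"
    and D: "D \<in> DivT \<Sigma>" and C: "C \<in> ZT \<Sigma>"
  shows "h (act D C) = act' D (h C)"
proof -
  note act = act[unfolded bilinear_action_def, THEN conjunct1, rule_format]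
    act[unfolded bilinear_action_def, THEN conjunct2, THEN conjunct1, rule_format]
    act[unfolded bilinear_action_def, THEN conjunct2, THEN conjunct2, THEN conjunct1, rule_format]
    act[unfolded bilinear_action_def, THEN conjunct2, THEN conjunct2, THEN conjunct2,
      THEN conjunct1, rule_format]
    act[unfolded bilinear_action_def, THEN conjunct2, THEN conjunct2, THEN conjunct2,
      THEN conjunct2, rule_format]
  note act' = act'[unfolded bilinear_action_def, THEN conjunct1, rule_format]
    act'[unfolded bilinear_action_def, THEN conjunct2, THEN conjunct1, rule_format]
    act'[unfolded bilinear_action_def, THEN conjunct2, THEN conjunct2, THEN conjunct1, rule_format]
    act'[unfolded bilinear_action_def, THEN conjunct2, THEN conjunct2, THEN conjunct2,
      THEN conjunct1, rule_format]
    act'[unfolded bilinear_action_def, THEN conjunct2, THEN conjunct2, THEN conjunct2,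
      THEN conjunct2, rule_format]
  have gen: "h (act (div_const d) C) = act' (div_const d) (h C)" if d: "d \<in> Div \<Sigma>" for d
    using fin C
  proof (induction rule: ZT_induct)
    case zero
    have D: "div_const d \<in> DivT \<Sigma>" using div_const_in_DivT[OF d] .
    have z: "cyc_smul 0 C = (\<lambda>_. 0)" for C
      by (simp add: cyc_smul_def)
    have "h (act (div_const d) (\<lambda>_. 0)) = h (\<lambda>_. 0)"
      using act(5)[OF Lam_0 D ZT_zero] unfolding z by simp
    moreover have "act' (div_const d) (h (\<lambda>_. 0)) = h (\<lambda>_. 0)"
    proof -
      have "act' (div_const d) (smul 0 (h (\<lambda>_. 0))) = smul 0 (act' (div_const d) (h (\<lambda>_. 0)))"
        by (rule act'(5)[OF Lam_0 D h(1)[OF ZT_zero]])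
      then show ?thesis
        using vanish[OF h(1)[OF ZT_zero]] vanish[OF act'(1)[OF D h(1)[OF ZT_zero]]] by simp
    qed
    ultimately show ?case by simp
  next
    case (generator p \<sigma>)
    have D: "div_const d \<in> DivT \<Sigma>" using div_const_in_DivT[OF d] .
    note \<sigma> = ZT_orbit_cycle[OF generator(2)]
    have "h (act (div_const d) (cyc_smul p (orbit_cycle \<sigma>)))
        = smul p (h (act (div_const d) (orbit_cycle \<sigma>)))"
      by (simp only: act(5)[OF generator(1) D \<sigma>] h(3)[OF generator(1) act(1)[OF D \<sigma>]])
    also have "\<dots> = act' (div_const d) (h (cyc_smul p (orbit_cycle \<sigma>)))"
      by (simp only: agree[OF d generator(2)] h(3)[OF generator(1) \<sigma>]
          act'(5)[OF generator(1) D h(1)[OF \<sigma>]])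
    finally show ?case .
  next
    case (add C C')
    have D: "div_const d \<in> DivT \<Sigma>" using div_const_in_DivT[OF d] .
    show ?case
      using add by (simp add: act(4)[OF D] h(2) act(1)[OF D] act'(4)[OF D] h(1))
  qed
  show ?thesis using D
  proof (induction rule: DivT_induct)
    case (generator p d)
    note D = div_const_in_DivT[OF generator(2)]
    show ?case
      by (simp only: act(3)[OF generator(1) D C] h(3)[OF generator(1) act(1)[OF D C]]
          gen[OF generator(2)] act'(3)[OF generator(1) D h(1)[OF C]])
  next
    case (add D E)
    then show ?case
      by (simp add: act(2)[OF _ _ C] h(2)[OF act(1)[OF _ C] act(1)[OF _ C]] act'(2)[OF _ _ h(1)[OF C]])
  qed
qed


section \<open>Relations in the equivariant Chow group\<close>

lemma chow_relations_zero: "(\<lambda>_. 0) \<in> chow_relations \<Sigma>"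
  unfolding chow_relations_def by (intro CollectI exI[of _ "0::nat"]) auto

lemma chow_relations_step:
  assumes "R \<in> chow_relations \<Sigma>" "p \<in> Lam" "\<sigma> \<in> \<Sigma>" "m \<in> lattice_M_perp \<sigma>"
  shows "(\<lambda>\<rho>. R \<rho> + p * chow_generator \<Sigma> \<sigma> m \<rho>) \<in> chow_relations \<Sigma>"
proof -
  obtain n :: nat and q s l where R: "R = (\<lambda>\<rho>. \<Sum>k<n. q k * chow_generator \<Sigma> (s k) (l k) \<rho>)"
    and qsl: "\<forall>k<n. q k \<in> Lam \<and> s k \<in> \<Sigma> \<and> l k \<in> lattice_M_perp (s k)"
    using assms(1) unfolding chow_relations_def by blast
  have "(\<lambda>\<rho>. R \<rho> + p * chow_generator \<Sigma> \<sigma> m \<rho>)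
    = (\<lambda>\<rho>. \<Sum>k<Suc n. (q(n := p)) k * chow_generator \<Sigma> ((s(n := \<sigma>)) k) ((l(n := m)) k) \<rho>)"
    by (simp add: R)
  moreover have "\<forall>k<Suc n. (q(n := p)) k \<in> Lam \<and> (s(n := \<sigma>)) k \<in> \<Sigma> \<and>
      (l(n := m)) k \<in> lattice_M_perp ((s(n := \<sigma>)) k)"
    using qsl assms by (auto simp: less_Suc_eq)
  ultimately show ?thesis
    unfolding chow_relations_def by blast
qed

lemma chow_relations_induct [consumes 1, case_names zero step]:
  assumes "R \<in> chow_relations \<Sigma>"
    and zero: "P (\<lambda>_. 0)"
    and step: "\<And>R p \<sigma> m. R \<in> chow_relations \<Sigma> \<Longrightarrow> P R \<Longrightarrow> p \<in> Lam \<Longrightarrow> \<sigma> \<in> \<Sigma> \<Longrightarrow>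
      m \<in> lattice_M_perp \<sigma> \<Longrightarrow> P (\<lambda>\<rho>. R \<rho> + p * chow_generator \<Sigma> \<sigma> m \<rho>)"
  shows "P R"
proof -
  obtain n :: nat and q s l where R: "R = (\<lambda>\<rho>. \<Sum>k<n. q k * chow_generator \<Sigma> (s k) (l k) \<rho>)"
    and qsl: "\<forall>k<n. q k \<in> Lam \<and> s k \<in> \<Sigma> \<and> l k \<in> lattice_M_perp (s k)"
    using assms(1) unfolding chow_relations_def by blast
  define T where "T i = (\<lambda>\<rho>. \<Sum>k<i. q k * chow_generator \<Sigma> (s k) (l k) \<rho>)" for i :: nat
  have T: "T 0 = (\<lambda>_. 0)" "\<And>i. T (Suc i) = (\<lambda>\<rho>. T i \<rho> + q i * chow_generator \<Sigma> (s i) (l i) \<rho>)"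
    by (simp_all add: T_def)
  have "T i \<in> chow_relations \<Sigma> \<and> P (T i)" if "i \<le> n" for i
    using that
  proof (induction i)
    case 0
    then show ?case using zero chow_relations_zero by (simp add: T)
  next
    case (Suc i)
    then have "T i \<in> chow_relations \<Sigma>" "P (T i)" "q i \<in> Lam" "s i \<in> \<Sigma>" "l i \<in> lattice_M_perp (s i)"
      using qsl by auto
    then show ?case
      unfolding T using step chow_relations_step by blast
  qed
  then show ?thesis using R T_def by auto
qed

lemma chow_relations_add:
  assumes R: "R \<in> chow_relations \<Sigma>" and "R' \<in> chow_relations \<Sigma>"
  shows "(\<lambda>\<rho>. R \<rho> + R' \<rho>) \<in> chow_relations \<Sigma>"
  using assms(2)
proof (induction rule: chow_relations_induct)
  case zero
  then show ?case using R by simp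
next
  case (step R' p \<sigma> m)
  then show ?case
    using chow_relations_step[of "\<lambda>\<rho>. R \<rho> + R' \<rho>" \<Sigma> p \<sigma> m] by (simp add: add.assoc)
qed

lemma chow_relations_smul:
  assumes "p \<in> Lam" "R \<in> chow_relations \<Sigma>"
  shows "(\<lambda>\<rho>. p * R \<rho>) \<in> chow_relations \<Sigma>"
  using assms(2)
proof (induction rule: chow_relations_induct)
  case zero
  then show ?case using chow_relations_zero by simp
next
  case (step R q \<sigma> m)
  then show ?case
    using chow_relations_step[of "\<lambda>\<rho>. p * R \<rho>" \<Sigma> "p * q" \<sigma> m] assms(1)
    by (simp add: distrib_left mult.assoc Lam_mult)
qed

lemma chow_relations_sum:
  "(\<And>a. a \<in> A \<Longrightarrow> R a \<in> chow_relations \<Sigma>) \<Longrightarrow> (\<lambda>\<rho>. \<Sum>a\<in>A. R a \<rho>) \<in> chow_relations \<Sigma>"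
  by (induction A rule: infinite_finite_induct) (simp_all add: chow_relations_zero chow_relations_add)

lemma chow_generator_scale:
  "chow_generator \<Sigma> \<sigma> (\<lambda>x. c * m x) \<rho> = const c * chow_generator \<Sigma> \<sigma> m \<rho>"
  by (simp add: chow_generator_def linear_form_scale const_mult right_diff_distrib
      sum_distrib_left mult.assoc)

text \<open>
  The relations are stated for \<open>m \<in> M(\<sigma>)\<close>; since \<open>\<Lambda>\<close> contains the rationals, they hold for
  \<open>m \<in> M(\<sigma>) \<otimes> Q\<close> after clearing denominators.
\<close>

lemma rational_chow_generator:
  assumes \<sigma>: "\<sigma> \<in> \<Sigma>" and m: "m \<in> dual UNIV" "\<And>x. x \<in> \<sigma> \<Longrightarrow> m x = 0"
  shows "chow_generator \<Sigma> \<sigma> m \<in> chow_relations \<Sigma>"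
proof -
  obtain k :: nat where k: "k > 0" "(\<lambda>x. of_nat k * m x) \<in> lattice_M"
    using functional_clear_denominators[OF m(1)] by blast
  define l where "l = (\<lambda>x. of_nat k * m x)"
  have "l \<in> lattice_M_perp \<sigma>"
    using k m(2) by (simp add: l_def lattice_M_perp_def)
  from chow_relations_step[OF chow_relations_zero Lam_const \<sigma> this, of "inverse (of_nat k)"]
  have "(\<lambda>\<rho>. const (inverse (of_nat k)) * chow_generator \<Sigma> \<sigma> l \<rho>) \<in> chow_relations \<Sigma>"
    by simp
  moreover have "const (inverse (of_nat k)) * chow_generator \<Sigma> \<sigma> l \<rho> = chow_generator \<Sigma> \<sigma> m \<rho>" for \<rho>
    unfolding l_def chow_generator_scale
    by (simp add: mult.assoc[symmetric] const_mult[symmetric] k(1))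
  ultimately show ?thesis by simp
qed

lemma chow_class_eq:
  assumes C: "C \<in> ZT \<Sigma>" "C' \<in> ZT \<Sigma>"
  shows "chow_class \<Sigma> C = chow_class \<Sigma> C' \<longleftrightarrow> (\<lambda>\<rho>. C \<rho> - C' \<rho>) \<in> chow_relations \<Sigma>"
proof -
  have "equiv (ZT \<Sigma>) (chow_equiv \<Sigma>)"
  proof (rule equivI)
    show "chow_equiv \<Sigma> \<subseteq> ZT \<Sigma> \<times> ZT \<Sigma>"
      by (auto simp: chow_equiv_def)
    show "refl_on (ZT \<Sigma>) (chow_equiv \<Sigma>)"
      by (auto simp: chow_equiv_def refl_on_def chow_relations_zero)
    show "sym (chow_equiv \<Sigma>)"
    proof (rule symI)
      fix C C' assume "(C, C') \<in> chow_equiv \<Sigma>"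
      then show "(C', C) \<in> chow_equiv \<Sigma>"
        using chow_relations_smul[OF Lam_const[of "- 1"], of "\<lambda>\<rho>. C \<rho> - C' \<rho>" \<Sigma>]
        by (simp add: chow_equiv_def const_minus)
    qed
    show "trans (chow_equiv \<Sigma>)"
    proof (rule transI)
      fix C C' C'' assume "(C, C') \<in> chow_equiv \<Sigma>" "(C', C'') \<in> chow_equiv \<Sigma>"
      then show "(C, C'') \<in> chow_equiv \<Sigma>"
        using chow_relations_add[of "\<lambda>\<rho>. C \<rho> - C' \<rho>" \<Sigma> "\<lambda>\<rho>. C' \<rho> - C'' \<rho>"]
        by (simp add: chow_equiv_def)
    qed
  qed
  from eq_equiv_class_iff[OF this C] show ?thesis
    using C by (simp add: chow_class_def chow_equiv_def)
qed

lemma in_chow_class_iff: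
  "C' \<in> chow_class \<Sigma> C \<longleftrightarrow> C \<in> ZT \<Sigma> \<and> C' \<in> ZT \<Sigma> \<and> (\<lambda>\<rho>. C \<rho> - C' \<rho>) \<in> chow_relations \<Sigma>"
  by (simp add: chow_class_def chow_equiv_def)

lemma self_in_chow_class: "C \<in> ZT \<Sigma> \<Longrightarrow> C \<in> chow_class \<Sigma> C"
  by (simp add: in_chow_class_iff chow_relations_zero)

lemma chow_class_in_group: "C \<in> ZT \<Sigma> \<Longrightarrow> chow_class \<Sigma> C \<in> chow_group \<Sigma>"
  by (simp add: chow_group_def chow_class_def quotientI)

lemma chow_group_cases:
  assumes "c \<in> chow_group \<Sigma>"
  obtains C where "C \<in> ZT \<Sigma>" "c = chow_class \<Sigma> C"
  using assms by (auto simp: chow_group_def chow_class_def elim: quotientE)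

lemma chow_add_class:
  assumes C: "C \<in> ZT \<Sigma>" "C' \<in> ZT \<Sigma>"
  shows "chow_add \<Sigma> (chow_class \<Sigma> C) (chow_class \<Sigma> C') = chow_class \<Sigma> (cyc_add C C')"
proof -
  have eq: "chow_class \<Sigma> (cyc_add B B') = chow_class \<Sigma> (cyc_add C C')"
    if "B \<in> chow_class \<Sigma> C" "B' \<in> chow_class \<Sigma> C'" for B B'
  proof -
    have B: "B \<in> ZT \<Sigma>" "B' \<in> ZT \<Sigma>" "(\<lambda>\<rho>. C \<rho> - B \<rho>) \<in> chow_relations \<Sigma>"
      "(\<lambda>\<rho>. C' \<rho> - B' \<rho>) \<in> chow_relations \<Sigma>"
      using that by (auto simp: in_chow_class_iff)
    have "chow_class \<Sigma> (cyc_add C C') = chow_class \<Sigma> (cyc_add B B')"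
      using chow_relations_add[OF B(3,4)]
      by (simp add: chow_class_eq ZT_cyc_add C B(1,2)) (simp add: cyc_add_def algebra_simps)
    then show ?thesis by simp
  qed
  have "(\<Union>B'\<in>chow_class \<Sigma> C'. chow_class \<Sigma> (cyc_add B B')) = chow_class \<Sigma> (cyc_add C C')"
    if "B \<in> chow_class \<Sigma> C" for B
    using eq[OF that] self_in_chow_class[OF C(2)] by blast
  then show ?thesis
    unfolding chow_add_def using self_in_chow_class[OF C(1)] by blast
qed

lemma chow_smul_class:
  assumes p: "p \<in> Lam" and C: "C \<in> ZT \<Sigma>"
  shows "chow_smul \<Sigma> p (chow_class \<Sigma> C) = chow_class \<Sigma> (cyc_smul p C)"
proof -
  have "chow_class \<Sigma> (cyc_smul p B) = chow_class \<Sigma> (cyc_smul p C)" if "B \<in> chow_class \<Sigma> C" for B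
  proof -
    have B: "B \<in> ZT \<Sigma>" "(\<lambda>\<rho>. C \<rho> - B \<rho>) \<in> chow_relations \<Sigma>"
      using that by (auto simp: in_chow_class_iff)
    have "chow_class \<Sigma> (cyc_smul p C) = chow_class \<Sigma> (cyc_smul p B)"
      using chow_relations_smul[OF p B(2)]
      by (simp add: chow_class_eq ZT_cyc_smul p C B(1)) (simp add: cyc_smul_def algebra_simps)
    then show ?thesis by simp
  qed
  then show ?thesis
    unfolding chow_smul_def using self_in_chow_class[OF C] by blast
qed


section \<open>The action on equivariant cycles\<close>

context generic_fan
begin

lemma star_iff_facets: "\<sigma> \<in> \<Sigma> \<Longrightarrow> \<rho> \<in> star \<Sigma> \<sigma> \<longleftrightarrow> \<rho> \<in> \<Sigma> \<and> \<sigma> \<in> facets \<Sigma> \<rho>"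
  by (auto simp: star_def facets_def)

text \<open>
  The \<open>\<Lambda>\<close>-linear extensions of \<open>d \<mapsto> d\<^sub>\<sigma>\<^sup>\<Psi>(x)\<close> and of \<open>d \<mapsto> d\<^sub>\<sigma>\<^sup>\<Psi> \<in> M \<subseteq> \<Lambda>\<close>.  Both are linear in the values
  of \<open>d\<^sub>\<sigma>\<close> on a basis of \<open>span \<sigma>\<close>, so they are defined by substituting polynomial values; no choice
  of a representation of \<open>D\<close> as a sum of tensors is involved.
\<close>

definition psi_ext :: "('v set \<Rightarrow> 'v \<Rightarrow> 'v sympoly) \<Rightarrow> 'v set \<Rightarrow> 'v \<Rightarrow> 'v sympoly" where
  "psi_ext D \<sigma> x = (\<Sum>b\<in>span_basis \<sigma>. D \<sigma> b * const (psi \<sigma> (coordinate \<sigma> b) x))"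

definition psi_form :: "('v set \<Rightarrow> 'v \<Rightarrow> 'v sympoly) \<Rightarrow> 'v set \<Rightarrow> 'v sympoly" where
  "psi_form D \<sigma> = (\<Sum>b\<in>zbasis. psi_ext D \<sigma> b * variable b)"

text \<open>
  The coefficient of \<open>V\<^sub>\<rho>\<close> in \<open>D \<cdot> C\<close>: it collects the contribution of \<open>V\<^sub>\<rho>\<close> itself and those of the
  facets of \<open>\<rho>\<close>.
\<close>

definition act :: "('v set \<Rightarrow> 'v \<Rightarrow> 'v sympoly) \<Rightarrow> ('v set \<Rightarrow> 'v sympoly) \<Rightarrow> 'v set \<Rightarrow> 'v sympoly" where
  "act D C = (\<lambda>\<rho>. if \<rho> \<in> \<Sigma> then psi_form D \<rho> * C \<rho> + (\<Sum>\<sigma>\<in>facets \<Sigma> \<rho>.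
    (D \<rho> (normal_gen \<rho> \<sigma>) - psi_ext D \<sigma> (normal_gen \<rho> \<sigma>)) * C \<sigma>) else 0)"

lemma psi_ext_const:
  "d \<in> Div \<Sigma> \<Longrightarrow> \<sigma> \<in> \<Sigma> \<Longrightarrow> psi_ext (div_const d) \<sigma> x = const (lift d \<sigma> x)"
  by (simp add: psi_ext_def lift_def psi_expansion[OF _ Div_dual] const_sum const_mult div_const_def)

lemma psi_form_const:
  "d \<in> Div \<Sigma> \<Longrightarrow> \<sigma> \<in> \<Sigma> \<Longrightarrow> psi_form (div_const d) \<sigma> = linear_form (lift d \<sigma>)"
  by (simp add: psi_form_def psi_ext_const linear_form_conv_variable)

lemma div_const_apply: "div_const d \<sigma> x = const (d \<sigma> x)"
  by (simp add: div_const_def)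

lemma act_const:
  assumes "d \<in> Div \<Sigma>" "\<rho> \<in> \<Sigma>"
  shows "act (div_const d) C \<rho> = linear_form (lift d \<rho>) * C \<rho>
    + (\<Sum>\<sigma>\<in>facets \<Sigma> \<rho>. const (slope d \<rho> \<sigma>) * C \<sigma>)"
proof -
  have "(\<Sum>\<sigma>\<in>facets \<Sigma> \<rho>. (div_const d \<rho> (normal_gen \<rho> \<sigma>)
      - psi_ext (div_const d) \<sigma> (normal_gen \<rho> \<sigma>)) * C \<sigma>)
    = (\<Sum>\<sigma>\<in>facets \<Sigma> \<rho>. const (slope d \<rho> \<sigma>) * C \<sigma>)"
    by (rule sum.cong)
      (auto simp: facets_def psi_ext_const[OF assms(1)] slope_def const_diff div_const_apply)
  then show ?thesis
    using assms by (simp add: act_def psi_form_const)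
qed

lemma act_outside: "\<rho> \<notin> \<Sigma> \<Longrightarrow> act D C \<rho> = 0"
  by (simp add: act_def)

lemma psi_ext_add: "psi_ext (\<lambda>\<sigma> x. D \<sigma> x + E \<sigma> x) \<sigma> x = psi_ext D \<sigma> x + psi_ext E \<sigma> x"
  by (simp add: psi_ext_def distrib_right sum.distrib)

lemma psi_ext_smul: "psi_ext (\<lambda>\<sigma> x. p * D \<sigma> x) \<sigma> x = p * psi_ext D \<sigma> x"
  by (simp add: psi_ext_def sum_distrib_left mult.assoc)

lemma psi_form_add: "psi_form (\<lambda>\<sigma> x. D \<sigma> x + E \<sigma> x) \<sigma> = psi_form D \<sigma> + psi_form E \<sigma>"
  by (simp add: psi_form_def psi_ext_add distrib_right sum.distrib)

lemma psi_form_smul: "psi_form (\<lambda>\<sigma> x. p * D \<sigma> x) \<sigma> = p * psi_form D \<sigma>"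
  by (simp add: psi_form_def psi_ext_smul sum_distrib_left mult.assoc)

lemma act_add_left: "act (\<lambda>\<sigma> x. D \<sigma> x + E \<sigma> x) C = cyc_add (act D C) (act E C)"
  by (rule ext) (simp add: act_def cyc_add_def psi_form_add psi_ext_add algebra_simps
      flip: sum.distrib)

lemma act_smul_left: "act (\<lambda>\<sigma> x. p * D \<sigma> x) C = cyc_smul p (act D C)"
  by (rule ext) (simp add: act_def cyc_smul_def psi_form_smul psi_ext_smul algebra_simps
      sum_distrib_left)

lemma act_add_right: "act D (cyc_add C C') = cyc_add (act D C) (act D C')"
  by (rule ext) (simp add: act_def cyc_add_def algebra_simps flip: sum.distrib)

lemma act_smul_right: "act D (cyc_smul p C) = cyc_smul p (act D C)"
  by (rule ext) (simp add: act_def cyc_smul_def algebra_simps sum_distrib_left)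

lemma act_in_ZT:
  assumes "D \<in> DivT \<Sigma>" "C \<in> ZT \<Sigma>"
  shows "act D C \<in> ZT \<Sigma>"
proof -
  have ext: "psi_ext D \<sigma> x \<in> Lam" for \<sigma> x
    unfolding psi_ext_def by (intro Lam_sum Lam_mult DivT_Lam[OF assms(1)] Lam_const)
  have "psi_form D \<rho> * C \<rho> + (\<Sum>\<sigma>\<in>facets \<Sigma> \<rho>.
    (D \<rho> (normal_gen \<rho> \<sigma>) - psi_ext D \<sigma> (normal_gen \<rho> \<sigma>)) * C \<sigma>) \<in> Lam" for \<rho>
    unfolding psi_form_def
    by (intro Lam_add Lam_sum Lam_mult Lam_diff Lam_variable DivT_Lam[OF assms(1)] ext
        ZT_Lam[OF assms(2)])
  then show ?thesis
    by (simp add: ZT_def act_def)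
qed

lemma bilinear_act: "bilinear_action \<Sigma> (ZT \<Sigma>) cyc_add cyc_smul act"
  unfolding bilinear_action_def
  by (simp add: act_in_ZT act_add_left act_smul_left act_add_right act_smul_right)

lemma act_orbit_cycle:
  assumes d: "d \<in> Div \<Sigma>" and \<sigma>: "\<sigma> \<in> \<Sigma>"
  shows "act (div_const d) (orbit_cycle \<sigma>) \<rho>
    = (\<Sum>\<tau>\<in>star \<Sigma> \<sigma>. const (slope d \<tau> \<sigma>) * orbit_cycle \<tau> \<rho>)
      + linear_form (lift d \<sigma>) * orbit_cycle \<sigma> \<rho>"
proof (cases "\<rho> \<in> \<Sigma>")
  case True
  then show ?thesis
    by (simp add: act_const[OF d] sum_orbit_cycle finite_facets finite_star star_iff_facets[OF \<sigma>])
      (auto simp: orbit_cycle_def)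
next
  case False
  then show ?thesis
    using \<sigma> by (simp add: act_outside sum_orbit_cycle finite_star star_iff_facets[OF \<sigma>])
      (auto simp: orbit_cycle_def)
qed

lemma psi_action_act: "psi_action \<Sigma> \<Psi> act"
  unfolding psi_action_def Let_def
  using bilinear_act act_orbit_cycle by (simp add: fun_eq_iff slope_def lift_def psi_def)

lemma linear_form_lift_proportional:
  assumes "d \<in> Div \<Sigma>" "e \<in> Div \<Sigma>" "\<sigma> \<in> \<Sigma>" "\<tau> \<in> \<Sigma>" "facet \<sigma> \<tau>"
  shows "const (slope d \<tau> \<sigma>) * (linear_form (lift e \<tau>) - linear_form (lift e \<sigma>))
    = const (slope e \<tau> \<sigma>) * (linear_form (lift d \<tau>) - linear_form (lift d \<sigma>))"
  using lift_diff_proportional[OF assms]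
  by (simp flip: linear_form_diff linear_form_scale)

lemma act_act_const:
  assumes d: "d \<in> Div \<Sigma>" and e: "e \<in> Div \<Sigma>" and \<rho>: "\<rho> \<in> \<Sigma>"
  shows "act (div_const d) (act (div_const e) C) \<rho>
    = linear_form (lift d \<rho>) * linear_form (lift e \<rho>) * C \<rho>
      + (\<Sum>\<sigma>\<in>facets \<Sigma> \<rho>. (linear_form (lift d \<rho>) * const (slope e \<rho> \<sigma>)
          + const (slope d \<rho> \<sigma>) * linear_form (lift e \<sigma>)) * C \<sigma>)
      + (\<Sum>\<sigma>\<in>\<Sigma>. const (\<Sum>\<tau>\<in>between \<Sigma> \<sigma> \<rho>. slope d \<rho> \<tau> * slope e \<tau> \<sigma>) * C \<sigma>)"
proof -
  have "(\<Sum>\<tau>\<in>facets \<Sigma> \<rho>. const (slope d \<rho> \<tau>) * act (div_const e) C \<tau>)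
      = (\<Sum>\<tau>\<in>facets \<Sigma> \<rho>. const (slope d \<rho> \<tau>) * (linear_form (lift e \<tau>) * C \<tau>
          + (\<Sum>\<sigma>\<in>facets \<Sigma> \<tau>. const (slope e \<tau> \<sigma>) * C \<sigma>)))"
    by (rule sum.cong) (auto simp: facets_def act_const[OF e])
  also have "\<dots> = (\<Sum>\<tau>\<in>facets \<Sigma> \<rho>. const (slope d \<rho> \<tau>) * linear_form (lift e \<tau>) * C \<tau>)
      + (\<Sum>\<tau>\<in>facets \<Sigma> \<rho>. \<Sum>\<sigma>\<in>facets \<Sigma> \<tau>. const (slope d \<rho> \<tau> * slope e \<tau> \<sigma>) * C \<sigma>)"
    by (simp add: distrib_left sum.distrib sum_distrib_left const_mult mult.assoc)
  also have "(\<Sum>\<tau>\<in>facets \<Sigma> \<rho>. \<Sum>\<sigma>\<in>facets \<Sigma> \<tau>. const (slope d \<rho> \<tau> * slope e \<tau> \<sigma>) * C \<sigma>)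
      = (\<Sum>\<sigma>\<in>\<Sigma>. const (\<Sum>\<tau>\<in>between \<Sigma> \<sigma> \<rho>. slope d \<rho> \<tau> * slope e \<tau> \<sigma>) * C \<sigma>)"
    unfolding sum_facets_facets[OF finite_fan] by (simp add: const_sum sum_distrib_right)
  finally show ?thesis
    by (simp add: act_const[OF d \<rho>] act_const[OF e \<rho>] distrib_left distrib_right sum.distrib
        sum_distrib_left mult.assoc)
qed

text \<open>
  The coefficients of \<open>C \<sigma>\<close> for \<open>\<sigma>\<close> a facet of \<open>\<rho>\<close> are symmetric in \<open>d\<close> and \<open>e\<close> by proportionality of
  the differences of lifts, those of codimension two by the symmetry of the sums of products of slopes.
\<close>

lemma act_commute_const:
  assumes d: "d \<in> Div \<Sigma>" and e: "e \<in> Div \<Sigma>"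
  shows "act (div_const d) (act (div_const e) C) = act (div_const e) (act (div_const d) C)"
proof
  fix \<rho>
  show "act (div_const d) (act (div_const e) C) \<rho> = act (div_const e) (act (div_const d) C) \<rho>"
  proof (cases "\<rho> \<in> \<Sigma>")
    case \<rho>: True
    have "(\<Sum>\<sigma>\<in>facets \<Sigma> \<rho>. (linear_form (lift d \<rho>) * const (slope e \<rho> \<sigma>)
          + const (slope d \<rho> \<sigma>) * linear_form (lift e \<sigma>)) * C \<sigma>)
      = (\<Sum>\<sigma>\<in>facets \<Sigma> \<rho>. (linear_form (lift e \<rho>) * const (slope d \<rho> \<sigma>)
          + const (slope e \<rho> \<sigma>) * linear_form (lift d \<sigma>)) * C \<sigma>)"
    proof (rule sum.cong[OF refl])
      fix \<sigma> assume "\<sigma> \<in> facets \<Sigma> \<rho>"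
      then have "\<sigma> \<in> \<Sigma>" "facet \<sigma> \<rho>" by (auto simp: facets_def)
      from linear_form_lift_proportional[OF d e this(1) \<rho> this(2)]
      have "linear_form (lift d \<rho>) * const (slope e \<rho> \<sigma>)
          + const (slope d \<rho> \<sigma>) * linear_form (lift e \<sigma>)
        = linear_form (lift e \<rho>) * const (slope d \<rho> \<sigma>)
          + const (slope e \<rho> \<sigma>) * linear_form (lift d \<sigma>)"
        by (simp add: algebra_simps)
      then show "(linear_form (lift d \<rho>) * const (slope e \<rho> \<sigma>)
          + const (slope d \<rho> \<sigma>) * linear_form (lift e \<sigma>)) * C \<sigma>
        = (linear_form (lift e \<rho>) * const (slope d \<rho> \<sigma>)
          + const (slope e \<rho> \<sigma>) * linear_form (lift d \<sigma>)) * C \<sigma>"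
        by simp
    qed
    moreover have "(\<Sum>\<sigma>\<in>\<Sigma>. const (\<Sum>\<tau>\<in>between \<Sigma> \<sigma> \<rho>. slope d \<rho> \<tau> * slope e \<tau> \<sigma>) * C \<sigma>)
      = (\<Sum>\<sigma>\<in>\<Sigma>. const (\<Sum>\<tau>\<in>between \<Sigma> \<sigma> \<rho>. slope e \<rho> \<tau> * slope d \<tau> \<sigma>) * C \<sigma>)"
      using sum_slope_slope[OF d e _ \<rho>] by (intro sum.cong) auto
    ultimately show ?thesis
      unfolding act_act_const[OF d e \<rho>] act_act_const[OF e d \<rho>]
      by (simp add: mult.commute[of "linear_form (lift d \<rho>)" "linear_form (lift e \<rho>)"])
  qed (simp add: act_outside)
qed

lemma act_commute:
  assumes D: "D \<in> DivT \<Sigma>" and E: "E \<in> DivT \<Sigma>"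
  shows "act D (act E C) = act E (act D C)"
proof -
  have gen: "act (div_const d) (act E C) = act E (act (div_const d) C)" if d: "d \<in> Div \<Sigma>" for d
    using E
    by (induction rule: DivT_induct)
      (simp_all add: act_smul_left act_smul_right act_add_left act_add_right act_commute_const[OF d])
  show ?thesis
    using D
    by (induction rule: DivT_induct)
      (simp_all add: act_smul_left act_smul_right act_add_left act_add_right gen)
qed

end


section \<open>Compatibility with the equivariant Chow group\<close>

context generic_fan
begin

lemma chow_generator_apply:
  "chow_generator \<Sigma> \<sigma> m \<rho> = linear_form m * orbit_cycle \<sigma> \<rho>
    - (if \<rho> \<in> star \<Sigma> \<sigma> then const (m (normal_gen \<rho> \<sigma>)) else 0)"
  by (simp add: chow_generator_def sum_orbit_cycle finite_star)

lemma chow_generator_in_ZT: "\<sigma> \<in> \<Sigma> \<Longrightarrow> chow_generator \<Sigma> \<sigma> m \<in> ZT \<Sigma>"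
  unfolding ZT_def chow_generator_apply
  by (auto simp: orbit_cycle_def star_def intro: Lam_diff Lam_linear_form Lam_uminus)

text \<open>
  Modulo \<open>d\<^sub>\<sigma>\<^sup>\<Psi>\<close> times the given relation, the coefficient of \<open>V\<^sub>\<tau>\<close> for \<open>\<tau> \<rightarrow> \<sigma>\<close> is the linear form
  \<open>l \<tau>\<close>.  It lies in \<open>M(\<tau>) \<otimes> Q\<close>, and the remaining terms in codimension two are
  those of the relations that belong to the forms \<open>l \<tau>\<close>.
\<close>

lemma act_chow_generator:
  assumes d: "d \<in> Div \<Sigma>" and \<sigma>: "\<sigma> \<in> \<Sigma>" and m: "m \<in> dual UNIV" "\<And>x. x \<in> \<sigma> \<Longrightarrow> m x = 0"
  defines "l \<equiv> \<lambda>\<tau> x. slope d \<tau> \<sigma> * m x - m (normal_gen \<tau> \<sigma>) * (lift d \<tau> x - lift d \<sigma> x)"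
  shows "act (div_const d) (chow_generator \<Sigma> \<sigma> m) \<rho>
    = linear_form (lift d \<sigma>) * chow_generator \<Sigma> \<sigma> m \<rho>
      + (\<Sum>\<tau>\<in>star \<Sigma> \<sigma>. chow_generator \<Sigma> \<tau> (l \<tau>) \<rho>)"
proof (cases "\<rho> \<in> \<Sigma>")
  case False
  then have "\<rho> \<noteq> \<tau>" "\<rho> \<notin> star \<Sigma> \<tau>" if "\<tau> \<in> \<Sigma>" for \<tau>
    using that by (auto simp: star_def)
  then have "chow_generator \<Sigma> \<tau> m' \<rho> = 0" if "\<tau> \<in> \<Sigma>" for \<tau> m'
    using that by (simp add: chow_generator_apply orbit_cycle_def)
  then show ?thesis
    using False \<sigma> by (simp add: act_outside star_def)
next
  case \<rho>: True
  define S where "S = (\<Sum>\<tau>\<in>between \<Sigma> \<sigma> \<rho>. l \<tau> (normal_gen \<rho> \<tau>))"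
  have between: "between \<Sigma> \<sigma> \<rho> = {\<tau> \<in> facets \<Sigma> \<rho>. \<tau> \<in> star \<Sigma> \<sigma>}"
    "between \<Sigma> \<sigma> \<rho> = {\<tau> \<in> star \<Sigma> \<sigma>. \<rho> \<in> star \<Sigma> \<tau>}"
    using \<rho> by (auto simp: between_def facets_def star_def)
  have "(\<Sum>\<tau>\<in>facets \<Sigma> \<rho>. const (slope d \<rho> \<tau>) * chow_generator \<Sigma> \<sigma> m \<tau>)
    = (\<Sum>\<tau>\<in>facets \<Sigma> \<rho>. const (slope d \<rho> \<tau>) * linear_form m * orbit_cycle \<sigma> \<tau>)
      - (\<Sum>\<tau>\<in>facets \<Sigma> \<rho>. if \<tau> \<in> star \<Sigma> \<sigma>
          then const (slope d \<rho> \<tau> * m (normal_gen \<tau> \<sigma>)) else 0)"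
    unfolding chow_generator_apply sum_subtractf[symmetric]
    by (rule sum.cong) (auto simp: right_diff_distrib const_mult mult.assoc)
  also have "\<dots> = (if \<sigma> \<in> facets \<Sigma> \<rho> then const (slope d \<rho> \<sigma>) * linear_form m else 0)
      - const (\<Sum>\<tau>\<in>between \<Sigma> \<sigma> \<rho>. slope d \<rho> \<tau> * m (normal_gen \<tau> \<sigma>))"
    unfolding between(1) const_sum unfolding sum.inter_filter[OF finite_facets]
    by (simp add: sum_orbit_cycle finite_facets)
  also have "(\<Sum>\<tau>\<in>between \<Sigma> \<sigma> \<rho>. slope d \<rho> \<tau> * m (normal_gen \<tau> \<sigma>)) = S"
    unfolding S_def l_def by (rule sum_slope_functional[OF d \<sigma> \<rho> m])
  finally have left: "act (div_const d) (chow_generator \<Sigma> \<sigma> m) \<rho>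
    = linear_form (lift d \<rho>) * chow_generator \<Sigma> \<sigma> m \<rho>
      + (if \<sigma> \<in> facets \<Sigma> \<rho> then const (slope d \<rho> \<sigma>) * linear_form m else 0) - const S"
    by (simp add: act_const[OF d \<rho>])
  have "(\<Sum>\<tau>\<in>star \<Sigma> \<sigma>. chow_generator \<Sigma> \<tau> (l \<tau>) \<rho>)
    = (\<Sum>\<tau>\<in>star \<Sigma> \<sigma>. linear_form (l \<tau>) * orbit_cycle \<tau> \<rho>)
      - (\<Sum>\<tau>\<in>star \<Sigma> \<sigma>. if \<rho> \<in> star \<Sigma> \<tau> then const (l \<tau> (normal_gen \<rho> \<tau>)) else 0)"
    unfolding chow_generator_apply by (rule sum_subtractf)
  also have "\<dots> = (if \<sigma> \<in> facets \<Sigma> \<rho> then linear_form (l \<rho>) else 0) - const S"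
    unfolding S_def between(2) const_sum unfolding sum.inter_filter[OF finite_star]
    using \<rho> by (simp add: sum_orbit_cycle finite_star star_iff_facets[OF \<sigma>])
  finally have right: "(\<Sum>\<tau>\<in>star \<Sigma> \<sigma>. chow_generator \<Sigma> \<tau> (l \<tau>) \<rho>)
    = (if \<sigma> \<in> facets \<Sigma> \<rho> then linear_form (l \<rho>) else 0) - const S" .
  have l: "linear_form (l \<rho>) = const (slope d \<rho> \<sigma>) * linear_form m
      - const (m (normal_gen \<rho> \<sigma>)) * (linear_form (lift d \<rho>) - linear_form (lift d \<sigma>))"
    unfolding l_def by (simp add: linear_form_diff linear_form_scale)
  have "\<sigma> \<notin> facets \<Sigma> \<sigma>"
    by (simp add: facets_def facet_def)
  then show ?thesis
    unfolding left right l unfolding chow_generator_apply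
    using \<rho> by (auto simp: star_iff_facets[OF \<sigma>] orbit_cycle_def algebra_simps)
qed

lemma act_chow_generator_relation:
  assumes d: "d \<in> Div \<Sigma>" and \<sigma>: "\<sigma> \<in> \<Sigma>" and m: "m \<in> lattice_M_perp \<sigma>"
  shows "act (div_const d) (chow_generator \<Sigma> \<sigma> m) \<in> chow_relations \<Sigma>"
proof -
  have m': "m \<in> dual UNIV" "\<And>x. x \<in> \<sigma> \<Longrightarrow> m x = 0"
    using m by (auto simp: lattice_M_perp_def lattice_M_def)
  define l where "l = (\<lambda>\<tau> x. slope d \<tau> \<sigma> * m x
    - m (normal_gen \<tau> \<sigma>) * (lift d \<tau> x - lift d \<sigma> x))"
  have "chow_generator \<Sigma> \<tau> (l \<tau>) \<in> chow_relations \<Sigma>" if "\<tau> \<in> star \<Sigma> \<sigma>" for \<tau>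
  proof (rule rational_chow_generator)
    show \<tau>: "\<tau> \<in> \<Sigma>" using that by (simp add: star_def)
    have fac: "facet \<sigma> \<tau>" using that by (simp add: star_def)
    note sub = facet_subset[OF fac]
    define f where "f = (\<lambda>x. lift d \<tau> x - lift d \<sigma> x)"
    have f: "f \<in> dual UNIV"
      unfolding f_def by (intro dual_diff lift_functional d \<sigma> \<tau>)
    have "(\<lambda>x. slope d \<tau> \<sigma> * m x - m (normal_gen \<tau> \<sigma>) * f x) \<in> dual UNIV"
      by (intro dual_diff dual_scale m' f)
    then show "l \<tau> \<in> dual UNIV"
      by (simp add: l_def f_def)
    fix x assume "x \<in> \<tau>"
    note n = normal_gen_facts[OF fan \<tau> fac]
    obtain q where q: "x - q *Q normal_gen \<tau> \<sigma> \<in> lq.span \<sigma>"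
      using facet_complement[OF fac n(3,2) lq.span_base[OF \<open>x \<in> \<tau>\<close>]] .
    have "m x = q * m (normal_gen \<tau> \<sigma>)"
      using functional_0_on_span[OF m' q]
      by (simp add: functional_diff[OF m'(1)] functional_scale[OF m'(1)])
    moreover have "f x = q * f (normal_gen \<tau> \<sigma>)"
      using lift_agree[OF d \<sigma> \<tau> sub q] f
      by (simp add: f_def functional_diff lift_functional[OF d] functional_scale \<sigma> \<tau> algebra_simps)
    moreover have "f (normal_gen \<tau> \<sigma>) = slope d \<tau> \<sigma>"
      by (simp add: f_def slope_eq[OF d \<tau> fac])
    moreover have "l \<tau> x = slope d \<tau> \<sigma> * m x - m (normal_gen \<tau> \<sigma>) * f x"
      by (simp add: l_def f_def)
    ultimately show "l \<tau> x = 0" by simp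
  qed
  then have "(\<lambda>\<rho>. \<Sum>\<tau>\<in>star \<Sigma> \<sigma>. chow_generator \<Sigma> \<tau> (l \<tau>) \<rho>) \<in> chow_relations \<Sigma>"
    by (rule chow_relations_sum)
  from chow_relations_step[OF this Lam_linear_form \<sigma> m, of "lift d \<sigma>"]
  have "(\<lambda>\<rho>. linear_form (lift d \<sigma>) * chow_generator \<Sigma> \<sigma> m \<rho>
      + (\<Sum>\<tau>\<in>star \<Sigma> \<sigma>. chow_generator \<Sigma> \<tau> (l \<tau>) \<rho>)) \<in> chow_relations \<Sigma>"
    by (simp add: add.commute)
  moreover have "act (div_const d) (chow_generator \<Sigma> \<sigma> m)
    = (\<lambda>\<rho>. linear_form (lift d \<sigma>) * chow_generator \<Sigma> \<sigma> m \<rho>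
      + (\<Sum>\<tau>\<in>star \<Sigma> \<sigma>. chow_generator \<Sigma> \<tau> (l \<tau>) \<rho>))"
    unfolding l_def using act_chow_generator[OF d \<sigma> m'] by (intro ext)
  ultimately show ?thesis by simp
qed

lemma act_relations:
  assumes D: "D \<in> DivT \<Sigma>" and R: "R \<in> chow_relations \<Sigma>"
  shows "act D R \<in> chow_relations \<Sigma>"
proof -
  have gen: "act (div_const d) R \<in> chow_relations \<Sigma>" if d: "d \<in> Div \<Sigma>" for d
    using R
  proof (induction rule: chow_relations_induct)
    case zero
    have "act (div_const d) (\<lambda>_. 0) = (\<lambda>_. 0)"
      by (rule ext) (simp add: act_def)
    then show ?case by (simp add: chow_relations_zero)
  next
    case (step R p \<sigma> m)
    have "act (div_const d) (\<lambda>\<rho>. R \<rho> + p * chow_generator \<Sigma> \<sigma> m \<rho>)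
      = (\<lambda>\<rho>. act (div_const d) R \<rho> + p * act (div_const d) (chow_generator \<Sigma> \<sigma> m) \<rho>)"
      using act_add_right[of "div_const d" R "cyc_smul p (chow_generator \<Sigma> \<sigma> m)"]
      unfolding act_smul_right by (simp add: cyc_add_def cyc_smul_def)
    then show ?case
      using chow_relations_add[OF step.IH
          chow_relations_smul[OF step.hyps(2) act_chow_generator_relation[OF d step.hyps(3,4)]]]
      by simp
  qed
  show ?thesis
    using D
  proof (induction rule: DivT_induct)
    case (generator p d)
    then show ?case
      using chow_relations_smul[OF _ gen] by (simp add: act_smul_left cyc_smul_def)
  next
    case (add D E)
    then show ?case
      using chow_relations_add by (simp add: act_add_left cyc_add_def)
  qed
qed

definition chow_act ::
    "('v set \<Rightarrow> 'v \<Rightarrow> 'v sympoly) \<Rightarrow> ('v set \<Rightarrow> 'v sympoly) set \<Rightarrow> ('v set \<Rightarrow> 'v sympoly) set" where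
  "chow_act D c = (\<Union>C\<in>c. chow_class \<Sigma> (act D C))"

lemma chow_act_class:
  assumes D: "D \<in> DivT \<Sigma>" and C: "C \<in> ZT \<Sigma>"
  shows "chow_act D (chow_class \<Sigma> C) = chow_class \<Sigma> (act D C)"
proof -
  have "chow_class \<Sigma> (act D B) = chow_class \<Sigma> (act D C)" if "B \<in> chow_class \<Sigma> C" for B
  proof -
    have B: "B \<in> ZT \<Sigma>" "(\<lambda>\<rho>. C \<rho> - B \<rho>) \<in> chow_relations \<Sigma>"
      using that by (auto simp: in_chow_class_iff)
    have "act D C = cyc_add (act D B) (act D (\<lambda>\<rho>. C \<rho> - B \<rho>))"
      unfolding act_add_right[symmetric] by (simp add: cyc_add_def)
    then have "(\<lambda>\<rho>. act D C \<rho> - act D B \<rho>) = act D (\<lambda>\<rho>. C \<rho> - B \<rho>)"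
      by (simp add: cyc_add_def)
    then have "chow_class \<Sigma> (act D C) = chow_class \<Sigma> (act D B)"
      using act_relations[OF D B(2)] by (simp add: chow_class_eq act_in_ZT D C B(1))
    then show ?thesis by simp
  qed
  then show ?thesis
    unfolding chow_act_def using self_in_chow_class[OF C] by blast
qed

lemma bilinear_chow_act:
  "bilinear_action \<Sigma> (chow_group \<Sigma>) (chow_add \<Sigma>) (chow_smul \<Sigma>) chow_act"
  unfolding bilinear_action_def
proof (intro conjI ballI)
  fix D c assume "D \<in> DivT \<Sigma>" "c \<in> chow_group \<Sigma>"
  then show "chow_act D c \<in> chow_group \<Sigma>"
    by (auto elim!: chow_group_cases simp: chow_act_class act_in_ZT chow_class_in_group)
next
  fix D E c assume D: "D \<in> DivT \<Sigma>" "E \<in> DivT \<Sigma>" and "c \<in> chow_group \<Sigma>"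
  then obtain C where C: "C \<in> ZT \<Sigma>" "c = chow_class \<Sigma> C"
    by (elim chow_group_cases)
  have "(\<lambda>\<sigma> x. D \<sigma> x + E \<sigma> x) \<in> DivT \<Sigma>"
    using D by (rule DivT_add)
  then show "chow_act (\<lambda>\<sigma> x. D \<sigma> x + E \<sigma> x) c = chow_add \<Sigma> (chow_act D c) (chow_act E c)"
    using C D by (simp add: chow_act_class act_add_left chow_add_class act_in_ZT)
next
  fix p :: "'v sympoly" and D c assume p: "p \<in> Lam" and D: "D \<in> DivT \<Sigma>" and "c \<in> chow_group \<Sigma>"
  then obtain C where C: "C \<in> ZT \<Sigma>" "c = chow_class \<Sigma> C"
    by (elim chow_group_cases)
  have "(\<lambda>\<sigma> x. p * D \<sigma> x) \<in> DivT \<Sigma>"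
    using p D by (rule DivT_mult)
  then show "chow_act (\<lambda>\<sigma> x. p * D \<sigma> x) c = chow_smul \<Sigma> p (chow_act D c)"
    using C D p by (simp add: chow_act_class act_smul_left chow_smul_class act_in_ZT)
next
  fix D c c' assume D: "D \<in> DivT \<Sigma>" and "c \<in> chow_group \<Sigma>" "c' \<in> chow_group \<Sigma>"
  then show "chow_act D (chow_add \<Sigma> c c') = chow_add \<Sigma> (chow_act D c) (chow_act D c')"
    by (auto elim!: chow_group_cases
        simp: chow_act_class act_add_right chow_add_class act_in_ZT ZT_cyc_add)
next
  fix p :: "'v sympoly" and D c assume "p \<in> Lam" "D \<in> DivT \<Sigma>" "c \<in> chow_group \<Sigma>"
  then show "chow_act D (chow_smul \<Sigma> p c) = chow_smul \<Sigma> p (chow_act D c)"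
    by (auto elim!: chow_group_cases
        simp: chow_act_class act_smul_right chow_smul_class act_in_ZT ZT_cyc_smul)
qed

text \<open>
  Two choices of \<open>m\<close> over the same \<open>d\<^sub>\<sigma>\<close> change the right-hand side by the relation of their
  difference, so \<open>m = d\<^sub>\<sigma>\<^sup>\<Psi>\<close> represents all of them.
\<close>

lemma chow_act_orbit_cycle:
  assumes d: "d \<in> Div \<Sigma>" and \<sigma>: "\<sigma> \<in> \<Sigma>" and m: "m \<in> dual UNIV" "restr (lq.span \<sigma>) m = d \<sigma>"
  shows "chow_act (div_const d) (chow_class \<Sigma> (orbit_cycle \<sigma>)) = chow_class \<Sigma>
    (\<lambda>\<rho>. (\<Sum>\<tau>\<in>star \<Sigma> \<sigma>. const (d \<tau> (normal_gen \<tau> \<sigma>) - m (normal_gen \<tau> \<sigma>)) * orbit_cycle \<tau> \<rho>)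
      + linear_form m * orbit_cycle \<sigma> \<rho>)" (is "_ = chow_class \<Sigma> ?R")
proof -
  let ?A = "act (div_const d) (orbit_cycle \<sigma>)"
  define g where "g = (\<lambda>x. lift d \<sigma> x - m x)"
  have "g \<in> dual UNIV"
    unfolding g_def by (intro dual_diff lift_functional d \<sigma> m)
  moreover have "g x = 0" if "x \<in> \<sigma>" for x
  proof -
    have x: "x \<in> lq.span \<sigma>" using that by (rule lq.span_base)
    have "restr (lq.span \<sigma>) m x = d \<sigma> x" using m(2) by (rule fun_cong)
    then show ?thesis
      using x by (simp add: g_def lift_on_span[OF d \<sigma>] restr_def)
  qed
  ultimately have rel: "chow_generator \<Sigma> \<sigma> g \<in> chow_relations \<Sigma>"
    by (rule rational_chow_generator[OF \<sigma>])
  have diff: "?A \<rho> - ?R \<rho> = chow_generator \<Sigma> \<sigma> g \<rho>" for \<rho>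
    by (simp add: act_orbit_cycle[OF d \<sigma>] chow_generator_apply sum_orbit_cycle finite_star)
      (simp add: slope_def g_def linear_form_diff const_diff algebra_simps)
  have A: "?A \<in> ZT \<Sigma>"
    by (intro act_in_ZT div_const_in_DivT d ZT_orbit_cycle \<sigma>)
  have "?R = cyc_add ?A (cyc_smul (const (- 1)) (chow_generator \<Sigma> \<sigma> g))"
    by (simp add: cyc_add_def cyc_smul_def const_minus diff[symmetric])
  also have "\<dots> \<in> ZT \<Sigma>"
    by (intro ZT_cyc_add ZT_cyc_smul A Lam_const chow_generator_in_ZT \<sigma>)
  finally have "chow_class \<Sigma> ?A = chow_class \<Sigma> ?R"
    using A rel diff by (simp add: chow_class_eq)
  then show ?thesis
    by (simp add: chow_act_class div_const_in_DivT d ZT_orbit_cycle \<sigma>)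
qed

lemma chow_action_chow_act: "chow_action \<Sigma> chow_act"
  unfolding chow_action_def using bilinear_chow_act chow_act_orbit_cycle by blast

lemma act_unique:
  assumes act': "psi_action \<Sigma> \<Psi> act'" and D: "D \<in> DivT \<Sigma>" and C: "C \<in> ZT \<Sigma>"
  shows "act' D C = act D C"
proof -
  have bil: "bilinear_action \<Sigma> (ZT \<Sigma>) cyc_add cyc_smul act'"
    using act' by (simp add: psi_action_def)
  have agree: "act (div_const d) (orbit_cycle \<sigma>) = act' (div_const d) (orbit_cycle \<sigma>)"
    if "d \<in> Div \<Sigma>" "\<sigma> \<in> \<Sigma>" for d \<sigma>
    using act' psi_action_act that by (simp add: psi_action_def Let_def)
  have "act D C = act' D C"
    by (rule bilinear_action_hom[OF finite_fan bilinear_act bil, where h = "\<lambda>C. C"])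
      (simp_all add: agree D C cyc_smul_def)
  then show ?thesis by simp
qed

text \<open>
  The formula for the action on cycles is the formula for the action on the Chow group with the
  choice \<open>m = d\<^sub>\<sigma>\<^sup>\<Psi>\<close>.
\<close>

lemma act_lifts_chow_action:
  assumes \<mu>: "chow_action \<Sigma> \<mu>" and D: "D \<in> DivT \<Sigma>" and C: "C \<in> ZT \<Sigma>"
  shows "chow_class \<Sigma> (act D C) = \<mu> D (chow_class \<Sigma> C)"
proof -
  have bil: "bilinear_action \<Sigma> (chow_group \<Sigma>) (chow_add \<Sigma>) (chow_smul \<Sigma>) \<mu>"
    using \<mu> by (simp add: chow_action_def)
  have agree: "chow_class \<Sigma> (act (div_const d) (orbit_cycle \<sigma>))
      = \<mu> (div_const d) (chow_class \<Sigma> (orbit_cycle \<sigma>))"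
    if d: "d \<in> Div \<Sigma>" and \<sigma>: "\<sigma> \<in> \<Sigma>" for d \<sigma>
  proof -
    have "restr (lq.span \<sigma>) (lift d \<sigma>) = d \<sigma>"
      unfolding lift_def psi_def
      by (rule section_restr) (simp_all add: span_in_L UNIV_in_L \<sigma> Div_dual[OF d])
    moreover have "act (div_const d) (orbit_cycle \<sigma>)
      = (\<lambda>\<rho>. (\<Sum>\<tau>\<in>star \<Sigma> \<sigma>. const (d \<tau> (normal_gen \<tau> \<sigma>) - lift d \<sigma> (normal_gen \<tau> \<sigma>))
          * orbit_cycle \<tau> \<rho>) + linear_form (lift d \<sigma>) * orbit_cycle \<sigma> \<rho>)"
      by (rule ext) (simp add: act_orbit_cycle[OF d \<sigma>] slope_def)
    ultimately show ?thesis
      using \<mu> d \<sigma> lift_functional[OF d \<sigma>] by (simp add: chow_action_def)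
  qed
  have vanish: "chow_smul \<Sigma> 0 c = chow_class \<Sigma> (\<lambda>_. 0)" if "c \<in> chow_group \<Sigma>" for c
    using that by (auto elim!: chow_group_cases simp: chow_smul_class cyc_smul_def)
  show ?thesis
    by (rule bilinear_action_hom[OF finite_fan bilinear_act bil])
      (simp_all add: agree D C vanish chow_class_in_group chow_add_class chow_smul_class)
qed


section \<open>Compatibility with the non-equivariant action\<close>

lemma psi_proj_eq:
  assumes d: "d \<in> Div \<Sigma>" and \<sigma>: "\<sigma> \<in> \<Sigma>" and \<tau>: "\<tau> \<in> \<Sigma>" and sub: "\<sigma> \<subseteq> \<tau>"
  shows "psi_proj \<Psi> \<tau> \<sigma> (d \<tau>) = (\<lambda>x. d \<tau> x - \<Psi> (lq.span \<sigma>) (lq.span \<tau>) (d \<sigma>) x)"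
    (is "_ = ?k")
  unfolding psi_proj_def
proof (rule the_equality)
  note L = span_in_L[OF \<sigma>] span_in_L[OF \<tau>] lq.span_mono[OF sub]
  have restr_d: "restr (lq.span \<sigma>) (d \<tau>) = d \<sigma>"
    by (rule Div_restr[OF d \<sigma> \<tau> sub])
  show "?k \<in> dual (lq.span \<tau>) \<and> restr (lq.span \<sigma>) ?k = (\<lambda>x. 0) \<and>
      (\<lambda>x. d \<tau> x - ?k x) \<in> \<Psi> (lq.span \<sigma>) (lq.span \<tau>) ` dual (lq.span \<sigma>)"
    using lift_diff_conv_psi(1)[OF d \<sigma> \<tau> sub] Div_dual[OF d \<sigma>]
    by (simp add: restr_diff restr_d section_restr[OF L])
  fix g
  assume g: "g \<in> dual (lq.span \<tau>) \<and> restr (lq.span \<sigma>) g = (\<lambda>x. 0) \<and>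
      (\<lambda>x. d \<tau> x - g x) \<in> \<Psi> (lq.span \<sigma>) (lq.span \<tau>) ` dual (lq.span \<sigma>)"
  then obtain f where f: "f \<in> dual (lq.span \<sigma>)"
    "(\<lambda>x. d \<tau> x - g x) = \<Psi> (lq.span \<sigma>) (lq.span \<tau>) f"
    by auto
  have "f = restr (lq.span \<sigma>) (\<lambda>x. d \<tau> x - g x)"
    unfolding f(2) by (rule section_restr[OF L f(1), symmetric])
  also have "\<dots> = d \<sigma>"
    using g by (simp add: restr_diff restr_d)
  finally have "\<Psi> (lq.span \<sigma>) (lq.span \<tau>) (d \<sigma>) = (\<lambda>x. d \<tau> x - g x)"
    using f(2) by simp
  then show "g = ?k" by simp
qed

text \<open>
  The projection \<open>\<pi>\<^sub>\<sigma>(d\<^sub>\<tau>)\<close> is \<open>d\<^sub>\<tau> - i\<^sup>\<Psi>(d\<^sub>\<sigma>)\<close>, and \<open>i\<^sup>\<Psi>(d\<^sub>\<sigma>)\<close> agrees with \<open>d\<^sub>\<sigma>\<^sup>\<Psi>\<close> on \<open>span \<tau>\<close> by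
  transitivity.
\<close>

lemma psi_proj_normal:
  assumes d: "d \<in> Div \<Sigma>" and \<sigma>: "\<sigma> \<in> \<Sigma>" and \<tau>: "\<tau> \<in> \<Sigma>" and fac: "facet \<sigma> \<tau>"
  shows "psi_proj \<Psi> \<tau> \<sigma> (d \<tau>) (normal_gen \<tau> \<sigma>) = slope d \<tau> \<sigma>"
proof -
  note k = lift_diff_conv_psi[OF d \<sigma> \<tau> facet_subset[OF fac]]
  show ?thesis
    using psi_on_span[OF \<tau> k(1) normal_gen_facts(3)[OF fan \<tau> fac]]
    unfolding k(2) psi_proj_eq[OF d \<sigma> \<tau> facet_subset[OF fac]] slope_eq[OF d \<tau> fac] by simp
qed

text \<open>
  Setting \<open>M\<close> to 0 kills the term \<open>d\<^sub>\<sigma>\<^sup>\<Psi> V\<^sub>\<sigma>\<close> and leaves the slopes of the divisor \<open>phi_div D\<close>.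
\<close>

lemma act_lifts_noneq_action:
  assumes D: "D \<in> DivT \<Sigma>"
  shows "phi_cyc (act D C) = noneq_action \<Sigma> \<Psi> (phi_div D) (phi_cyc C)"
proof
  fix \<rho>
  define d where "d = phi_div D"
  have d: "d \<in> Div \<Sigma>"
    unfolding d_def by (rule phi_div_in_Div[OF D])
  have ext: "augmentation (psi_ext D \<sigma> x) = lift d \<sigma> x" if "\<sigma> \<in> \<Sigma>" for \<sigma> x
    using psi_expansion[OF that Div_dual[OF d that], of x]
    by (simp add: psi_ext_def augmentation_sum augmentation_mult lift_def d_def phi_div_def)
  have form: "augmentation (psi_form D \<sigma>) = 0" for \<sigma>
    by (simp add: psi_form_def augmentation_sum augmentation_mult)
  have "noneq_action \<Sigma> \<Psi> d (phi_cyc C) \<rho>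
      = (\<Sum>\<sigma>\<in>\<Sigma>. if \<rho> \<in> star \<Sigma> \<sigma> then slope d \<rho> \<sigma> * augmentation (C \<sigma>) else 0)"
    unfolding noneq_action_def
  proof (rule sum.cong[OF refl])
    fix \<sigma> assume \<sigma>: "\<sigma> \<in> \<Sigma>"
    have "(\<Sum>\<tau>\<in>star \<Sigma> \<sigma>. psi_proj \<Psi> \<tau> \<sigma> (d \<tau>) (normal_gen \<tau> \<sigma>) * orbit_cycle \<tau> \<rho>)
        = (\<Sum>\<tau>\<in>star \<Sigma> \<sigma>. slope d \<tau> \<sigma> * orbit_cycle \<tau> \<rho>)"
      by (rule sum.cong) (auto simp: star_def psi_proj_normal[OF d \<sigma>])
    then show "phi_cyc C \<sigma> * (\<Sum>\<tau>\<in>star \<Sigma> \<sigma>. psi_proj \<Psi> \<tau> \<sigma> (d \<tau>) (normal_gen \<tau> \<sigma>) * orbit_cycle \<tau> \<rho>)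
        = (if \<rho> \<in> star \<Sigma> \<sigma> then slope d \<rho> \<sigma> * augmentation (C \<sigma>) else 0)"
      by (simp add: sum_orbit_cycle finite_star phi_cyc_def)
  qed
  also have "\<dots> = (\<Sum>\<sigma> | \<sigma> \<in> \<Sigma> \<and> \<rho> \<in> star \<Sigma> \<sigma>. slope d \<rho> \<sigma> * augmentation (C \<sigma>))"
    by (simp add: sum.inter_filter[OF finite_fan])
  also have "\<dots> = phi_cyc (act D C) \<rho>"
  proof (cases "\<rho> \<in> \<Sigma>")
    case True
    then have "{\<sigma> \<in> \<Sigma>. \<rho> \<in> star \<Sigma> \<sigma>} = facets \<Sigma> \<rho>"
      by (auto simp: star_def facets_def)
    moreover have "(\<Sum>\<sigma>\<in>facets \<Sigma> \<rho>. augmentation ((D \<rho> (normal_gen \<rho> \<sigma>)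
          - psi_ext D \<sigma> (normal_gen \<rho> \<sigma>)) * C \<sigma>))
        = (\<Sum>\<sigma>\<in>facets \<Sigma> \<rho>. slope d \<rho> \<sigma> * augmentation (C \<sigma>))"
      by (rule sum.cong)
        (auto simp: facets_def augmentation_mult augmentation_diff ext slope_def d_def phi_div_def)
    ultimately show ?thesis
      using True by (simp add: phi_cyc_def act_def augmentation_add augmentation_sum
          augmentation_mult[of "psi_form D \<rho>"] form)
  next
    case False
    then have "{\<sigma> \<in> \<Sigma>. \<rho> \<in> star \<Sigma> \<sigma>} = {}"
      by (auto simp: star_def)
    then show ?thesis
      using False by (simp only: sum.empty) (simp add: phi_cyc_def act_outside)
  qed
  finally show "phi_cyc (act D C) \<rho> = noneq_action \<Sigma> \<Psi> (phi_div D) (phi_cyc C) \<rho>"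
    by (simp add: d_def)
qed

end

theorem theorem1:
  fixes \<Sigma> :: "'v::lattice_space set set"
    and \<L> :: "'v set set"
    and \<Psi> :: "'v set \<Rightarrow> 'v set \<Rightarrow> ('v \<Rightarrow> rat) \<Rightarrow> 'v \<Rightarrow> rat"
  assumes "toric_fan \<Sigma>"
    and "complement_map \<L> \<Psi>"
    and "psi_generic \<L> \<Sigma>"
  shows "\<exists>act. psi_action \<Sigma> \<Psi> act \<and>
    (\<forall>act'. psi_action \<Sigma> \<Psi> act' \<longrightarrow> (\<forall>D\<in>DivT \<Sigma>. \<forall>C\<in>ZT \<Sigma>. act' D C = act D C)) \<and>
    (\<exists>\<mu>. chow_action \<Sigma> \<mu>) \<and>
    (\<forall>\<mu>. chow_action \<Sigma> \<mu> \<longrightarrow>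
      (\<forall>D\<in>DivT \<Sigma>. \<forall>C\<in>ZT \<Sigma>. chow_class \<Sigma> (act D C) = \<mu> D (chow_class \<Sigma> C))) \<and>
    (\<forall>D\<in>DivT \<Sigma>. \<forall>E\<in>DivT \<Sigma>. \<forall>C\<in>ZT \<Sigma>. act D (act E C) = act E (act D C)) \<and>
    (\<forall>D\<in>DivT \<Sigma>. \<forall>C\<in>ZT \<Sigma>. phi_cyc (act D C) = noneq_action \<Sigma> \<Psi> (phi_div D) (phi_cyc C))"
proof -
  interpret generic_fan \<Sigma> \<L> \<Psi>
    using assms by unfold_locales
  show ?thesis
  proof (intro exI[of _ act] conjI allI impI ballI)
    show "psi_action \<Sigma> \<Psi> act" by (rule psi_action_act)
    show "\<exists>\<mu>. chow_action \<Sigma> \<mu>" using chow_action_chow_act by blast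
    show "act' D C = act D C"
      if "psi_action \<Sigma> \<Psi> act'" "D \<in> DivT \<Sigma>" "C \<in> ZT \<Sigma>" for act' D C
      using that by (rule act_unique)
    show "chow_class \<Sigma> (act D C) = \<mu> D (chow_class \<Sigma> C)"
      if "chow_action \<Sigma> \<mu>" "D \<in> DivT \<Sigma>" "C \<in> ZT \<Sigma>" for \<mu> D C
      using that by (rule act_lifts_chow_action)
    show "act D (act E C) = act E (act D C)" if "D \<in> DivT \<Sigma>" "E \<in> DivT \<Sigma>" for D E C
      using that by (rule act_commute)
    show "phi_cyc (act D C) = noneq_action \<Sigma> \<Psi> (phi_div D) (phi_cyc C)"
      if "D \<in> DivT \<Sigma>" for D C
      using that by (rule act_lifts_noneq_action)
  qed
qed

end
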